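(* Suppose no anticipation, overlap, parallel trends (PT), repeated cross-sectional sampling, and time invariance hold (see context), and that: (i) for each $g\ge1$, $\mathbb E\Big[\Big(\frac{\mathfrak T_{\mathcal T}Y-\mu_{G\ne1,\mathcal T}(X)}{\lambda_{\mathcal T}}-\frac{\mathfrak T_{\mathcal T-1}Y-\mu_{G\ne1,\mathcal T-1}(X)}{\lambda_{\mathcal T-1}}\Big)^2\,\Big|\,X,G=g\Big]$, $1/p_g$, and $\omega_g$ are bounded functions of $X$; (ii) the first-stage estimators satisfy: (1) $\sum_{g\ge2}\hat w_g(x)=1$ for all $x\in\mathcal X$ and $\|\hat w_g\|_\infty=O_p(1)$, $g\ge2$; (2) $\|\hat\mu_{G\ne1,t}-\mu_{G\ne1,t}\|_{L_2(F_X)}=o_p(1)$ for $t=\mathcal T-1,\mathcal T$, and for $g\ge2$, $\|\hat p_1/\hat p_g-p_1/p_g\|_{L_2(F_X)}=o_p(1)$ and $\|\hat w_g-\omega_g\|_{L_2(F_X)}=o_p(1)$; (3) for $g\ge2$ and $t=\mathcal T-1,\mathcal T$, $\|\hat p_1/\hat p_g-p_1/p_g\|_{L_2(F_X)}\|\hat\mu_{G\ne1,t}-\mu_{G\ne1,t}\|_{L_2(F_X)}=o_p(n^{-1/2})$. Then $\sqrt n(\hat\theta_{\mathrm{rc}}-\theta)\overset d\to N(0,V^{\mathrm{rc}}_{\mathrm{PT}})$ as $n\to\infty$ (with $N_G,\mathcal T,L$ fixed), where $V^{\mathrm{rc}}_{\mathrm{PT}}=\mathbb E[\psi^{\mathrm{rc}}_{\mathrm{PT}}(S^{\mathrm{rc}})^2]$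 and $$\psi^{\mathrm{rc}}_{\mathrm{PT}}(S^{\mathrm{rc}})=-\frac\theta{\pi_1}\mathcal G_1-\frac{\mathfrak T_{\mathcal T}-\lambda_{\mathcal T}}{\lambda_{\mathcal T}}\Big(\frac{\mathbb E(\varphi_{\mathcal T-1})}{\pi_1\lambda_{\mathcal T-1}}+\theta\Big)+\frac{\mathfrak T_{\mathcal T-1}-\lambda_{\mathcal T-1}}{\lambda_{\mathcal T-1}}\cdot\frac{\mathbb E(\varphi_{\mathcal T-1})}{\pi_1\lambda_{\mathcal T-1}}$$ $$\qquad+\frac1{\pi_1}\Big(\mathcal G_1-\sum_{g=2}^{N_G+1}\mathcal G_g\omega_g(X)\frac{p_1(X)}{p_g(X)}\Big)\Big(\frac{\mathfrak T_{\mathcal T}Y-\mu_{G\ne1,\mathcal T}(X)}{\lambda_{\mathcal T}}-\frac{\mathfrak T_{\mathcal T-1}Y-\mu_{G\ne1,\mathcal T-1}(X)}{\lambda_{\mathcal T-1}}\Big),$$ with $\varphi_{\mathcal T-1}=\Big(\mathcal G_1-\sum_{g=2}^{N_G+1}\mathcal G_g\omega_g(X)\frac{p_1(X)}{p_g(X)}\Big)(\mathfrak T_{\mathcal T-1}Y-\mu_{G\ne1,\mathcal T-1}(X))$.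
   Context: Setting. There are $N_G+1$ groups; $G\in\{1,\dots,N_G+1\}$, $\mathcal G_g=\mathbf 1\{G=g\}$. Group $1$ is treated in the final period $\mathcal T$ only; other groups are never treated. $Y_t(1),Y_t(0)$ are potential outcomes and $Y_t=\mathcal G_1Y_t(1)+(1-\mathcal G_1)Y_t(0)$, $t=1,\dots,\mathcal T$. $X$ is a vector of covariates with support $\mathcal X$ and distribution $F_X$; $\|f\|_{L_2(F_X)}=(\int f^2dF_X)^{1/2}$. $T\in\{1,\dots,\mathcal T\}$ is the sampling period, $\mathfrak T_t=\mathbf 1\{T=t\}$, observed outcome $Y=\sum_{t=1}^{\mathcal T}\mathfrak T_tY_t$. Target: $\theta=\mathbb E[Y_{\mathcal T}(1)-Y_{\mathcal T}(0)\mid G=1]$. Assumptions. No anticipation: $Y_t(1)=Y_t(0)$ for $t\le\mathcal T-1$. Overlap: $p_g(X)=\mathbb P(G=g\mid X)>0$ a.s. for all $g$. (PT): for each $g\ge2$, $\mathbb E[Y_{\mathcal T}(0)-Y_{\mathcal T-1}(0)\mid G=1,X]=\mathbb E[Y_{\mathcal T}(0)-Y_{\mathcal T-1}(0)\mid G=g,X]$ a.s. Repeated cross-sectional sampling: $\{S_i^{\mathrm{rc}}\}_{i=1}^n$ is an i.i.d. sample of $S^{\mathrm{rc}}=(Y,G,T,X)$. Time invariance: $(Y_1,\dots,Y_{\mathcal T},X,G)$ is independent of $T$, and $\lambda_t=\mathbb P(T=t)>0$ for each $t$. Notation. $\pi_1=\mathbb P(G=1)$; $\mu_{G\ne1,t}(x)=\mathbb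 E[\mathfrak T_tY\mid G\ne1,X=x]$; and $$\phi_{\mathrm{rc}}(S^{\mathrm{rc}};\mu_{G\ne1,\mathcal T},\mu_{G\ne1,\mathcal T-1},p,w;\pi_1,\lambda_{\mathcal T},\lambda_{\mathcal T-1})=\frac1{\pi_1}\Big(\mathcal G_1-\sum_{g=2}^{N_G+1}\mathcal G_gw_g(X)\frac{p_1(X)}{p_g(X)}\Big)\Big(\Big(\frac{\mathfrak T_{\mathcal T}}{\lambda_{\mathcal T}}-\frac{\mathfrak T_{\mathcal T-1}}{\lambda_{\mathcal T-1}}\Big)Y-\Big(\frac{\mu_{G\ne1,\mathcal T}(X)}{\lambda_{\mathcal T}}-\frac{\mu_{G\ne1,\mathcal T-1}(X)}{\lambda_{\mathcal T-1}}\Big)\Big).$$ Estimator. Split $\{1,\dots,n\}$ into $L$ equal folds $I_1,\dots,I_L$; for each $\ell$, nuisance estimators $\hat\mu^\ell_{G\ne1,t},\hat p^\ell,\hat w^\ell$ are constructed from observations not in $I_\ell$. With $\hat\pi_1=n^{-1}\sum_i\mathcal G_{1i}$, $\hat\lambda_t=n^{-1}\sum_i\mathfrak T_{ti}$, $$\hat\theta_{\mathrm{rc}}=\frac1n\sum_{\ell=1}^L\sum_{i\in I_\ell}\phi_{\mathrm{rc}}(S^{\mathrm{rc}}_i;\hat\mu^\ell_{G\ne1,\mathcal T},\hat\mu^\ell_{G\ne1,\mathcal T-1},\hat p^\ell,\hat w^\ell;\hat\pi_1,\hat\lambda_{\mathcal T},\hat\lambda_{\mathcal T-1}).$$ Conditions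 on nuisance estimators written without superscript are required of the fold-$\ell$ estimators for each $\ell$. $\omega=(\omega_2,\dots,\omega_{N_G+1})$ is the probability limit (pseudo-true value) of $\hat w$; convention $\omega_1\equiv1$.
   Formalization: The regression functions μ_{G≠1,t}, t = 𝒯−1, 𝒯, are additionally assumed to lie in L_2(F_X); this follows from (i) when 𝒯 ≥ 3, and for 𝒯 = 2 the claim can fail without it (heavy-tailed μ with identically zero residual). *)

theory Defs
  imports "HOL-Probability.Probability"
begin

text \<open>An observation is a tuple \<open>(y, g, t, x)\<close> of outcome, group, sampling period and covariates.\<close>

type_synonym 'x obs = "real \<times> nat \<times> nat \<times> 'x"

definition obs_measure :: "'x::euclidean_space obs measure" where
  "obs_measure = borel \<Otimes>\<^sub>M count_space UNIV \<Otimes>\<^sub>M count_space UNIV \<Otimes>\<^sub>M borel"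

definition period_outcome ::
  "(nat \<Rightarrow> 'p \<Rightarrow> real) \<Rightarrow> (nat \<Rightarrow> 'p \<Rightarrow> real) \<Rightarrow> ('p \<Rightarrow> nat) \<Rightarrow> nat \<Rightarrow> 'p \<Rightarrow> real" where
  "period_outcome Y1 Y0 G t u = of_bool (G u = 1) * Y1 t u + (1 - of_bool (G u = 1)) * Y0 t u"

definition observed_outcome ::
  "nat \<Rightarrow> (nat \<Rightarrow> 'p \<Rightarrow> real) \<Rightarrow> (nat \<Rightarrow> 'p \<Rightarrow> real) \<Rightarrow> ('p \<Rightarrow> nat) \<Rightarrow> ('p \<Rightarrow> nat) \<Rightarrow> 'p \<Rightarrow> real" where
  "observed_outcome \<T> Y1 Y0 G T u = (\<Sum>t = 1..\<T>. of_bool (T u = t) * period_outcome Y1 Y0 G t u)"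

definition rc_obs ::
  "nat \<Rightarrow> (nat \<Rightarrow> 'p \<Rightarrow> real) \<Rightarrow> (nat \<Rightarrow> 'p \<Rightarrow> real) \<Rightarrow> ('p \<Rightarrow> nat) \<Rightarrow> ('p \<Rightarrow> nat) \<Rightarrow> ('p \<Rightarrow> 'x)
    \<Rightarrow> 'p \<Rightarrow> 'x obs" where
  "rc_obs \<T> Y1 Y0 G T X u = (observed_outcome \<T> Y1 Y0 G T u, G u, T u, X u)"

text \<open>The law of the population given an event \<open>{u. A u}\<close>, and the \<open>\<sigma>\<close>-algebra generated by the
  covariates. Conditional expectations given \<open>A\<close> and \<open>X\<close> are conditional expectations
  given \<open>X\<close> under \<open>given P A\<close>.\<close>

definition given :: "'p measure \<Rightarrow> ('p \<Rightarrow> bool) \<Rightarrow> 'p measure" where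
  "given P A = uniform_measure P {u \<in> space P. A u}"

definition gen_by :: "'p measure \<Rightarrow> ('p \<Rightarrow> 'x::topological_space) \<Rightarrow> 'p measure" where
  "gen_by P X = vimage_algebra (space P) X borel"

text \<open>\<open>f\<close> is a version of the regression function \<open>x \<mapsto> E[Z | X = x]\<close> under \<open>Q\<close>.\<close>

definition regression_fun ::
  "'p measure \<Rightarrow> ('p \<Rightarrow> 'x::topological_space) \<Rightarrow> ('p \<Rightarrow> real) \<Rightarrow> ('x \<Rightarrow> real) \<Rightarrow> bool" where
  "regression_fun Q X Z f \<longleftrightarrow>
     f \<in> borel_measurable borel \<and> (AE u in Q. f (X u) = real_cond_exp Q (gen_by Q X) Z u)"

text \<open>The library's \<open>indep_var\<close> needs both variables to have the same value type.\<close>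

definition indep_rv ::
  "'p measure \<Rightarrow> 'a measure \<Rightarrow> ('p \<Rightarrow> 'a) \<Rightarrow> 'b measure \<Rightarrow> ('p \<Rightarrow> 'b) \<Rightarrow> bool" where
  "indep_rv P N U N' U' \<longleftrightarrow> U \<in> P \<rightarrow>\<^sub>M N \<and> U' \<in> P \<rightarrow>\<^sub>M N' \<and>
     prob_space.indep_set P (sets (vimage_algebra (space P) U N))
       (sets (vimage_algebra (space P) U' N'))"

definition msupport :: "'x::topological_space measure \<Rightarrow> 'x set" where
  "msupport F = {x. \<forall>U. open U \<longrightarrow> x \<in> U \<longrightarrow> emeasure F U > 0}"

text \<open>The norms are extended-valued: the Bochner integral of a non-integrable function
  is \<open>0\<close>, so the case of an infinite \<open>L\<^sub>2\<close> norm has to be separated.\<close>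

definition L2_norm :: "'x measure \<Rightarrow> ('x \<Rightarrow> real) \<Rightarrow> ennreal" where
  "L2_norm F f =
     (if integrable F (\<lambda>x. (f x)\<^sup>2) then ennreal (sqrt (\<integral>x. (f x)\<^sup>2 \<partial>F)) else \<infinity>)"

definition sup_norm :: "'x set \<Rightarrow> ('x \<Rightarrow> real) \<Rightarrow> ennreal" where
  "sup_norm A f = (SUP x\<in>A. ennreal \<bar>f x\<bar>)"

text \<open>Outer probabilities are used because a supremum over an uncountable set need not
  be measurable; on measurable events they are the ordinary probabilities.\<close>

definition bigO_p :: "'s measure \<Rightarrow> (nat \<Rightarrow> real) \<Rightarrow> (nat \<Rightarrow> 's \<Rightarrow> ennreal) \<Rightarrow> bool" where
  "bigO_p M a Z \<longleftrightarrow>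
     (\<forall>\<epsilon>>0. \<exists>C::real. \<forall>\<^sub>F n in sequentially.
        outer_measure_of M {\<xi> \<in> space M. Z n \<xi> > ennreal (C * a n)} \<le> ennreal \<epsilon>)"

definition smallo_p :: "'s measure \<Rightarrow> (nat \<Rightarrow> real) \<Rightarrow> (nat \<Rightarrow> 's \<Rightarrow> ennreal) \<Rightarrow> bool" where
  "smallo_p M a Z \<longleftrightarrow>
     (\<forall>\<epsilon>>0. (\<lambda>n. outer_measure_of M {\<xi> \<in> space M. Z n \<xi> > ennreal (\<epsilon> * a n)}) \<longlonglongrightarrow> 0)"

text \<open>\<open>N(m, v)\<close> as the law of \<open>m + \<surd>v Z\<close> with \<open>Z\<close> standard normal, so that \<open>N(m, 0)\<close> is
  the point mass at \<open>m\<close>.\<close>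

definition normal_law :: "real \<Rightarrow> real \<Rightarrow> real measure" where
  "normal_law m v = distr std_normal_distribution borel (\<lambda>z. m + sqrt v * z)"

definition group_contrast ::
  "nat \<Rightarrow> (nat \<Rightarrow> 'x \<Rightarrow> real) \<Rightarrow> (nat \<Rightarrow> 'x \<Rightarrow> real) \<Rightarrow> nat \<Rightarrow> 'x \<Rightarrow> real" where
  "group_contrast NG p w g x =
     of_bool (g = 1) - (\<Sum>h = 2..NG + 1. of_bool (g = h) * w h x * (p 1 x / p h x))"

text \<open>In \<open>phi_rc\<close> and below, \<open>\<mu> t\<close> and \<open>lam t\<close> are only evaluated at \<open>t = \<T>\<close> and \<open>t = \<T> - 1\<close>.\<close>

definition phi_rc ::
  "nat \<Rightarrow> nat \<Rightarrow> 'x obs \<Rightarrow> (nat \<Rightarrow> 'x \<Rightarrow> real) \<Rightarrow> (nat \<Rightarrow> 'x \<Rightarrow> real) \<Rightarrow> (nat \<Rightarrow> 'x \<Rightarrow> real)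
    \<Rightarrow> real \<Rightarrow> (nat \<Rightarrow> real) \<Rightarrow> real" where
  "phi_rc NG \<T> S \<mu> p w pi1 lam = (case S of (y, g, t, x) \<Rightarrow>
     1 / pi1 * group_contrast NG p w g x *
     ((of_bool (t = \<T>) / lam \<T> - of_bool (t = \<T> - 1) / lam (\<T> - 1)) * y
       - (\<mu> \<T> x / lam \<T> - \<mu> (\<T> - 1) x / lam (\<T> - 1))))"

definition scaled_residual ::
  "nat \<Rightarrow> (nat \<Rightarrow> 'x \<Rightarrow> real) \<Rightarrow> (nat \<Rightarrow> real) \<Rightarrow> 'x obs \<Rightarrow> real" where
  "scaled_residual \<T> \<mu> lam S = (case S of (y, g, t, x) \<Rightarrow>
     (of_bool (t = \<T>) * y - \<mu> \<T> x) / lam \<T>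
       - (of_bool (t = \<T> - 1) * y - \<mu> (\<T> - 1) x) / lam (\<T> - 1))"

definition varphi ::
  "nat \<Rightarrow> nat \<Rightarrow> (nat \<Rightarrow> 'x \<Rightarrow> real) \<Rightarrow> (nat \<Rightarrow> 'x \<Rightarrow> real) \<Rightarrow> (nat \<Rightarrow> 'x \<Rightarrow> real) \<Rightarrow> 'x obs \<Rightarrow> real" where
  "varphi NG s \<mu> p w S = (case S of (y, g, t, x) \<Rightarrow>
     group_contrast NG p w g x * (of_bool (t = s) * y - \<mu> s x))"

text \<open>The argument \<open>e\<close> of \<open>psi_rc\<close> stands for \<open>E(\<phi>\<^bsub>\<T>-1\<^esub>)\<close>.\<close>

definition psi_rc ::
  "nat \<Rightarrow> nat \<Rightarrow> (nat \<Rightarrow> 'x \<Rightarrow> real) \<Rightarrow> (nat \<Rightarrow> 'x \<Rightarrow> real) \<Rightarrow> (nat \<Rightarrow> 'x \<Rightarrow> real)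
    \<Rightarrow> real \<Rightarrow> (nat \<Rightarrow> real) \<Rightarrow> real \<Rightarrow> real \<Rightarrow> 'x obs \<Rightarrow> real" where
  "psi_rc NG \<T> \<mu> p w pi1 lam \<theta> e S = (case S of (y, g, t, x) \<Rightarrow>
     - (\<theta> / pi1) * of_bool (g = 1)
     - (of_bool (t = \<T>) - lam \<T>) / lam \<T> * (e / (pi1 * lam (\<T> - 1)) + \<theta>)
     + (of_bool (t = \<T> - 1) - lam (\<T> - 1)) / lam (\<T> - 1) * (e / (pi1 * lam (\<T> - 1)))
     + 1 / pi1 * group_contrast NG p w g x * scaled_residual \<T> \<mu> lam S)"

text \<open>The index set of a sample of size \<open>n\<close> is \<open>{1..n}\<close>. Folds have equal size whenever
  \<open>L\<close> divides \<open>n\<close>, and sizes differing by at most one otherwise.\<close>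

definition equal_folds :: "nat \<Rightarrow> (nat \<Rightarrow> nat \<Rightarrow> nat set) \<Rightarrow> bool" where
  "equal_folds L I \<longleftrightarrow>
     (\<forall>n. (\<Union>l\<in>{1..L}. I n l) = {1..n} \<and> disjoint_family_on (I n) {1..L} \<and>
          (\<forall>k\<in>{1..L}. \<forall>l\<in>{1..L}. card (I n k) \<le> card (I n l) + 1))"

text \<open>A nuisance estimator for fold \<open>l\<close> and sample size \<open>n\<close> is a measurable map from the
  observations with index outside \<open>I n l\<close> to functions of the covariates.\<close>

type_synonym 'x estimator = "(nat \<Rightarrow> 'x obs) \<Rightarrow> 'x \<Rightarrow> real"

definition off_fold :: "(nat \<Rightarrow> nat \<Rightarrow> nat set) \<Rightarrow> nat \<Rightarrow> nat \<Rightarrow> nat set" where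
  "off_fold I n l = {1..n} - I n l"

definition fold_estimator ::
  "(nat \<Rightarrow> nat \<Rightarrow> nat set) \<Rightarrow> nat \<Rightarrow> nat \<Rightarrow> 'x::euclidean_space estimator \<Rightarrow> bool" where
  "fold_estimator I n l f \<longleftrightarrow>
     (\<lambda>(d, x). f d x) \<in> borel_measurable ((\<Pi>\<^sub>M i\<in>off_fold I n l. obs_measure) \<Otimes>\<^sub>M borel)"

definition training ::
  "(nat \<Rightarrow> nat \<Rightarrow> nat set) \<Rightarrow> (nat \<Rightarrow> 's \<Rightarrow> 'x obs) \<Rightarrow> nat \<Rightarrow> nat \<Rightarrow> 's \<Rightarrow> nat \<Rightarrow> 'x obs" where
  "training I S n l \<xi> = restrict (\<lambda>i. S i \<xi>) (off_fold I n l)"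

definition pi1_hat :: "(nat \<Rightarrow> 's \<Rightarrow> 'x obs) \<Rightarrow> nat \<Rightarrow> 's \<Rightarrow> real" where
  "pi1_hat S n \<xi> = 1 / real n * (\<Sum>i = 1..n. case S i \<xi> of (y, g, t, x) \<Rightarrow> of_bool (g = 1))"

definition lam_hat :: "(nat \<Rightarrow> 's \<Rightarrow> 'x obs) \<Rightarrow> nat \<Rightarrow> 's \<Rightarrow> nat \<Rightarrow> real" where
  "lam_hat S n \<xi> s = 1 / real n * (\<Sum>i = 1..n. case S i \<xi> of (y, g, t, x) \<Rightarrow> of_bool (t = s))"

text \<open>The nuisance estimators are indexed by sample size, fold, and period or group.\<close>

definition theta_rc_hat ::
  "nat \<Rightarrow> nat \<Rightarrow> nat \<Rightarrow> (nat \<Rightarrow> nat \<Rightarrow> nat set) \<Rightarrow> (nat \<Rightarrow> 's \<Rightarrow> 'x obs)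
    \<Rightarrow> (nat \<Rightarrow> nat \<Rightarrow> nat \<Rightarrow> 'x estimator) \<Rightarrow> (nat \<Rightarrow> nat \<Rightarrow> nat \<Rightarrow> 'x estimator)
    \<Rightarrow> (nat \<Rightarrow> nat \<Rightarrow> nat \<Rightarrow> 'x estimator) \<Rightarrow> nat \<Rightarrow> 's \<Rightarrow> real" where
  "theta_rc_hat NG \<T> L I S \<mu>h ph wh n \<xi> =
     1 / real n * (\<Sum>l = 1..L. \<Sum>i\<in>I n l.
       phi_rc NG \<T> (S i \<xi>)
         (\<lambda>t. \<mu>h n l t (training I S n l \<xi>))
         (\<lambda>g. ph n l g (training I S n l \<xi>))
         (\<lambda>g. wh n l g (training I S n l \<xi>))
         (pi1_hat S n \<xi>) (lam_hat S n \<xi>))"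

end

theory Submission
  imports Defs
begin

text \<open>
  Write \<open>A\<close> for the group contrast and \<open>B\<close> for the scaled residual. Time invariance and parallel
  trends give \<open>E(B | X, G = h) = 0\<close> for every \<open>h \<ge> 2\<close> and \<open>E(1{G = 1} B) = \<pi>\<^sub>1 \<theta>\<close>. Let \<open>A'\<close> be the estimated
  contrast, \<open>A''\<close> the contrast with estimated weights but true propensities, and \<open>\<Delta>\<close> the scaled error of
  the outcome regression. Then
  \<open>A' (B - \<Delta>) - A B = (A' - A) B - A'' \<Delta> - (A' - A'') \<Delta>\<close>.
  Given the training folds, the first term is centred by identification and the second because the
  estimated weights sum to one, so that both are negligible by Chebyshev's inequality; the third is
  negligible by Markov's inequality and the product rate. Linearizing in the estimates of \<open>\<pi>\<^sub>1\<close> and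
  \<open>\<lambda>\<^sub>t\<close> leaves the normalized sum of the influence function, to which the central limit theorem applies.
\<close>

section \<open>Convergence in probability\<close>

text \<open>The outcome regressions pool all untreated groups, and parallel trends says nothing
  about levels. A single-period residual therefore need not be centred within an untreated group;
  only the difference \<open>B\<close>, scaled by the true sampling probabilities, is. The estimator
  divides by estimated probabilities instead, so its two period means also have to be studied one by
  one. For this their consistency without a rate is enough, since they get multiplied by the root-n
  error of \<open>lam_hat\<close>, which is bounded in probability. At the root-n scale the two
  uncentred pieces are recombined with the true probabilities and become the centred one. The
  contrast \<open>A''\<close> keeps the true propensities because exactly these cancel against the
  group probabilities and let the weights sum up. Conditioning on the training folds is integration
  over a product measure with the training sample held fixed. The conditions on the estimators hold
  only in probability, so moment bounds are applied on events of training samples. The limit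
  variance may be 0, so the central limit theorem is passed on through characteristic
  functions.\<close>

lemma outer_measure_of_union_le:
  "outer_measure_of M (A \<union> B) \<le> outer_measure_of M A + outer_measure_of M B"
proof (cases "A \<subseteq> space M \<and> B \<subseteq> space M")
  case True
  obtain E where E: "E \<in> sets M" "A \<subseteq> E" "outer_measure_of M A = emeasure M E"
    using outer_measure_of_attain[of A M] True by (elim conjE) auto
  obtain E' where E': "E' \<in> sets M" "B \<subseteq> E'" "outer_measure_of M B = emeasure M E'"
    using outer_measure_of_attain[of B M] True by (elim conjE) auto
  have "outer_measure_of M (A \<union> B) \<le> outer_measure_of M (E \<union> E')"
    using E E' by (intro outer_measure_of_mono) auto
  also have "\<dots> \<le> emeasure M E + emeasure M E'"
    using E E' by (simp add: emeasure_subadditive)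
  finally show ?thesis by (simp add: E E')
next
  \<comment> \<open>A set that leaves \<open>space M\<close> has no measurable cover, so its outer
    measure is an infimum over the empty set, namely \<open>\<top>\<close>.\<close>
  case False
  then have "{E \<in> sets M. A \<subseteq> E} = {} \<or> {E \<in> sets M. B \<subseteq> E} = {}"
    using sets.sets_into_space[of _ M] by blast
  then have "outer_measure_of M A = \<top> \<or> outer_measure_of M B = \<top>"
    unfolding outer_measure_of_def by (elim disjE) (simp_all only: image_empty Inf_empty simp_thms)
  then show ?thesis by (elim disjE) simp_all
qed

lemma tendsto_0_ennrealI:
  fixes f :: "'a \<Rightarrow> ennreal"
  assumes "\<And>\<epsilon>::real. \<epsilon> > 0 \<Longrightarrow> eventually (\<lambda>x. f x \<le> ennreal \<epsilon>) F"
  shows "(f \<longlongrightarrow> 0) F"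
proof (rule order_tendstoI)
  fix a :: ennreal assume "0 < a"
  then obtain b where b: "0 < b" "b < a" using dense by blast
  then have "b \<noteq> \<top>" by auto
  then obtain r where "b = ennreal r" "r \<ge> 0" by (cases b) auto
  with b have "r > 0" by auto
  from assms[OF this] show "eventually (\<lambda>x. f x < a) F"
    using b \<open>b = ennreal r\<close> by (auto elim!: eventually_mono)
qed auto

lemma tendsto_0_ennrealD:
  fixes f :: "'a \<Rightarrow> ennreal"
  assumes "(f \<longlongrightarrow> 0) F" "\<epsilon> > 0"
  shows "eventually (\<lambda>x. f x \<le> ennreal \<epsilon>) F"
  using order_tendstoD(2)[OF assms(1), of "ennreal \<epsilon>"] assms(2)
  by (auto elim!: eventually_mono simp: less_imp_le)

lemma tendsto_0_ennreal_le:
  fixes f g :: "'a \<Rightarrow> ennreal"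
  assumes "(g \<longlongrightarrow> 0) F" "eventually (\<lambda>x. f x \<le> g x) F"
  shows "(f \<longlongrightarrow> 0) F"
  by (rule tendsto_sandwich[of "\<lambda>_. 0", OF _ assms(2) _ assms(1)]) auto

text \<open>Convergence in probability is convergence along this filter, which makes the library's
  limit rules available for it.\<close>

definition in_prob :: "'s measure \<Rightarrow> (nat \<times> 's) filter" where
  "in_prob M = Abs_filter (\<lambda>Q. (\<lambda>n. outer_measure_of M {\<xi> \<in> space M. \<not> Q (n, \<xi>)}) \<longlonglongrightarrow> 0)"

text \<open>\<open>Abs_filter\<close> has this meaning only once the filter laws are checked.
  Closure under conjunction is the substantial one: the exceptional sets are united, and
  subadditivity of the outer measure bounds the union.\<close>

lemma eventually_in_prob:
  "eventually Q (in_prob M) \<longleftrightarrow>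
     (\<lambda>n. outer_measure_of M {\<xi> \<in> space M. \<not> Q (n, \<xi>)}) \<longlonglongrightarrow> 0"
  unfolding in_prob_def
proof (rule eventually_Abs_filter, rule is_filter.intro)
  show "(\<lambda>n. outer_measure_of M {\<xi> \<in> space M. \<not> True}) \<longlonglongrightarrow> 0" by simp
next
  fix P Q :: "nat \<times> 'a \<Rightarrow> bool"
  assume P: "(\<lambda>n. outer_measure_of M {\<xi> \<in> space M. \<not> P (n, \<xi>)}) \<longlonglongrightarrow> 0"
    and Q: "(\<lambda>n. outer_measure_of M {\<xi> \<in> space M. \<not> Q (n, \<xi>)}) \<longlonglongrightarrow> 0"
  have eq: "{\<xi> \<in> space M. \<not> (P (n, \<xi>) \<and> Q (n, \<xi>))} =
      {\<xi> \<in> space M. \<not> P (n, \<xi>)} \<union> {\<xi> \<in> space M. \<not> Q (n, \<xi>)}" for n by auto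
  show "(\<lambda>n. outer_measure_of M {\<xi> \<in> space M. \<not> (P (n, \<xi>) \<and> Q (n, \<xi>))}) \<longlonglongrightarrow> 0"
    unfolding eq
    by (rule tendsto_0_ennreal_le[OF tendsto_add[OF P Q, simplified]])
       (intro always_eventually allI outer_measure_of_union_le)
next
  fix P Q :: "nat \<times> 'a \<Rightarrow> bool"
  assume imp: "\<forall>x. P x \<longrightarrow> Q x"
    and P: "(\<lambda>n. outer_measure_of M {\<xi> \<in> space M. \<not> P (n, \<xi>)}) \<longlonglongrightarrow> 0"
  show "(\<lambda>n. outer_measure_of M {\<xi> \<in> space M. \<not> Q (n, \<xi>)}) \<longlonglongrightarrow> 0"
    using imp by (intro tendsto_0_ennreal_le[OF P] always_eventually allI outer_measure_of_mono) auto
qed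

text \<open>The exceptional set need not be measurable, but it lies in a null set, so its outer
  measure is exactly 0 for all large \<open>n\<close>.\<close>

lemma eventually_in_prob_AE:
  assumes "eventually (\<lambda>n. AE \<xi> in M. Q (n, \<xi>)) sequentially"
  shows "eventually Q (in_prob M)"
proof -
  have "outer_measure_of M {\<xi> \<in> space M. \<not> Q (n, \<xi>)} = 0" if "AE \<xi> in M. Q (n, \<xi>)" for n
  proof -
    obtain N where N: "{\<xi> \<in> space M. \<not> Q (n, \<xi>)} \<subseteq> N" "N \<in> null_sets M"
      using \<open>AE \<xi> in M. Q (n, \<xi>)\<close> by (auto elim!: AE_E simp: null_sets_def)
    have "outer_measure_of M {\<xi> \<in> space M. \<not> Q (n, \<xi>)} \<le> outer_measure_of M N"
      using N by (intro outer_measure_of_mono)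
    also have "\<dots> = 0" using N(2) by (simp add: null_sets_def)
    finally show ?thesis by simp
  qed
  then show ?thesis
    unfolding eventually_in_prob
    by (intro tendsto_eventually eventually_mono[OF assms])
qed

lemma eventually_in_prob_sequentially:
  assumes "eventually (\<lambda>n. \<forall>\<xi>\<in>space M. Q (n, \<xi>)) sequentially"
  shows "eventually Q (in_prob M)"
  by (rule eventually_in_prob_AE, rule eventually_mono[OF assms]) auto

lemma tendsto_in_prob_sequentially:
  assumes "f \<longlonglongrightarrow> c"
  shows "((\<lambda>(n, \<xi>). f n) \<longlongrightarrow> c) (in_prob M)"
  unfolding tendsto_def
  using assms[unfolded tendsto_def]
  by (auto intro!: eventually_in_prob_sequentially elim!: eventually_mono)

lemma smallo_pD:
  assumes "smallo_p M a Z" "\<epsilon> > 0"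
  shows "eventually (\<lambda>(n, \<xi>). Z n \<xi> \<le> ennreal (\<epsilon> * a n)) (in_prob M)"
  using assms unfolding smallo_p_def eventually_in_prob by (simp add: not_le)

lemma smallo_p_tendsto:
  assumes "smallo_p M (\<lambda>n. 1) Z"
  shows "((\<lambda>(n, \<xi>). Z n \<xi>) \<longlongrightarrow> 0) (in_prob M)"
  using smallo_pD[OF assms] by (intro tendsto_0_ennrealI) (simp add: case_prod_unfold)

lemma smallo_p_sqrt_tendsto:
  assumes "smallo_p M (\<lambda>n. 1 / sqrt (real n)) Z"
  shows "((\<lambda>(n, \<xi>). ennreal (sqrt (real n)) * Z n \<xi>) \<longlongrightarrow> 0) (in_prob M)"
proof (rule tendsto_0_ennrealI)
  fix \<epsilon> :: real assume \<epsilon>: "\<epsilon> > 0"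
  show "eventually (\<lambda>x. (case x of (n, \<xi>) \<Rightarrow> ennreal (sqrt (real n)) * Z n \<xi>) \<le> ennreal \<epsilon>) (in_prob M)"
  proof (rule eventually_mono[OF smallo_pD[OF assms \<epsilon>]], safe)
    fix n \<xi> assume *: "Z n \<xi> \<le> ennreal (\<epsilon> * (1 / sqrt (real n)))"
    have "ennreal (sqrt (real n)) * Z n \<xi> \<le> ennreal (sqrt (real n)) * ennreal (\<epsilon> * (1 / sqrt (real n)))"
      by (intro mult_left_mono *) auto
    also have "\<dots> = ennreal (sqrt (real n) * (\<epsilon> * (1 / sqrt (real n))))"
      by (rule ennreal_mult'[symmetric]) auto
    also have "\<dots> \<le> ennreal \<epsilon>"
      using \<epsilon> by (cases "n = 0") (auto intro!: ennreal_leI)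
    finally show "ennreal (sqrt (real n)) * Z n \<xi> \<le> ennreal \<epsilon>" .
  qed
qed

text \<open>Where \<open>Z\<close> stays below a constant and \<open>Y\<close> below
  \<open>\<epsilon>\<close> divided by that constant, the product is small; the two complementary
  events cost \<open>\<delta> / 2\<close> each.\<close>

lemma bigO_p_mult_tendsto_0:
  assumes Z: "bigO_p M (\<lambda>n. 1) Z" and Y: "((\<lambda>(n, \<xi>). Y n \<xi>) \<longlongrightarrow> 0) (in_prob M)"
  shows "((\<lambda>(n, \<xi>). Z n \<xi> * Y n \<xi> :: ennreal) \<longlongrightarrow> 0) (in_prob M)"
proof (rule tendsto_0_ennrealI)
  fix \<epsilon> :: real assume \<epsilon>: "\<epsilon> > 0"
  show "eventually (\<lambda>x. (case x of (n, \<xi>) \<Rightarrow> Z n \<xi> * Y n \<xi>) \<le> ennreal \<epsilon>) (in_prob M)"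
    unfolding eventually_in_prob
  proof (rule tendsto_0_ennrealI)
    fix \<delta> :: real assume \<delta>: "\<delta> > 0"
    from Z have "\<exists>C::real. \<forall>\<^sub>F n in sequentially.
        outer_measure_of M {\<xi> \<in> space M. Z n \<xi> > ennreal (C * 1)} \<le> ennreal (\<delta> / 2)"
      unfolding bigO_p_def using half_gt_zero[OF \<delta>] by blast
    then obtain C where C: "\<forall>\<^sub>F n in sequentially.
        outer_measure_of M {\<xi> \<in> space M. Z n \<xi> > ennreal (C * 1)} \<le> ennreal (\<delta> / 2)"
      ..
    \<comment> \<open>\<open>bigO_p\<close> admits any real \<open>C\<close>, also a non-positive
      one; the maximum with 1 makes it a legitimate divisor.\<close>
    define C' where "C' = max C 1"
    have "C' > 0" by (simp add: C'_def)
    have "eventually (\<lambda>(n, \<xi>). Y n \<xi> \<le> ennreal (\<epsilon> / C')) (in_prob M)"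
      using tendsto_0_ennrealD[OF Y, of "\<epsilon> / C'"] \<epsilon> \<open>C' > 0\<close> by (simp add: case_prod_unfold)
    then have "\<forall>\<^sub>F n in sequentially.
        outer_measure_of M {\<xi> \<in> space M. \<not> Y n \<xi> \<le> ennreal (\<epsilon> / C')} \<le> ennreal (\<delta> / 2)"
      unfolding eventually_in_prob using \<delta> by (intro tendsto_0_ennrealD) auto
    with C show "\<forall>\<^sub>F n in sequentially. outer_measure_of M
        {\<xi> \<in> space M. \<not> (case (n, \<xi>) of (n, \<xi>) \<Rightarrow> Z n \<xi> * Y n \<xi>) \<le> ennreal \<epsilon>} \<le> ennreal \<delta>"
    proof eventually_elim
      case (elim n)
      have bd: "Z n \<xi> * Y n \<xi> \<le> ennreal \<epsilon>"
        if "Z n \<xi> \<le> ennreal C" "Y n \<xi> \<le> ennreal (\<epsilon> / C')" for \<xi>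
      proof -
        have "Z n \<xi> * Y n \<xi> \<le> ennreal C' * ennreal (\<epsilon> / C')"
          using order_trans[OF that(1) ennreal_leI[of C C']] that(2)
          by (intro mult_mono) (simp_all add: C'_def)
        also have "\<dots> = ennreal \<epsilon>"
          using \<open>C' > 0\<close> by (subst ennreal_mult'[symmetric]) auto
        finally show ?thesis .
      qed
      have "{\<xi> \<in> space M. \<not> Z n \<xi> * Y n \<xi> \<le> ennreal \<epsilon>} \<subseteq>
        {\<xi> \<in> space M. Z n \<xi> > ennreal (C * 1)} \<union> {\<xi> \<in> space M. \<not> Y n \<xi> \<le> ennreal (\<epsilon> / C')}"
        using bd by (auto simp: not_le[symmetric])
      from outer_measure_of_mono[OF this, of M]
      have "outer_measure_of M {\<xi> \<in> space M. \<not> Z n \<xi> * Y n \<xi> \<le> ennreal \<epsilon>} \<le>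
        outer_measure_of M {\<xi> \<in> space M. Z n \<xi> > ennreal (C * 1)} +
        outer_measure_of M {\<xi> \<in> space M. \<not> Y n \<xi> \<le> ennreal (\<epsilon> / C')}"
        by (rule order_trans[OF _ outer_measure_of_union_le])
      also have "\<dots> \<le> ennreal (\<delta> / 2) + ennreal (\<delta> / 2)"
        using elim by (intro add_mono)
      also have "\<dots> = ennreal \<delta>"
        using \<delta> by (subst ennreal_plus[symmetric]) auto
      finally show ?case by simp
    qed
  qed
qed

lemma tendsto_0_ennreal_abs_iff:
  fixes f :: "'a \<Rightarrow> real"
  shows "((\<lambda>x. ennreal \<bar>f x\<bar>) \<longlongrightarrow> 0) F \<longleftrightarrow> (f \<longlongrightarrow> 0) F"
proof
  assume *: "((\<lambda>x. ennreal \<bar>f x\<bar>) \<longlongrightarrow> 0) F"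
  show "(f \<longlongrightarrow> 0) F"
  proof (rule tendstoI)
    fix e :: real assume "e > 0"
    from tendsto_0_ennrealD[OF *, of "e / 2"] \<open>e > 0\<close>
    have "\<forall>\<^sub>F x in F. ennreal \<bar>f x\<bar> \<le> ennreal (e / 2)" by simp
    then show "\<forall>\<^sub>F x in F. dist (f x) 0 < e"
    proof eventually_elim
      case (elim x)
      then have "\<bar>f x\<bar> \<le> e / 2" using \<open>e > 0\<close> by (subst (asm) ennreal_le_iff) auto
      then show ?case using \<open>e > 0\<close> by (simp add: dist_real_def)
    qed
  qed
next
  assume "(f \<longlongrightarrow> 0) F"
  then have "((\<lambda>x. \<bar>f x\<bar>) \<longlongrightarrow> 0) F" by (rule tendsto_rabs_zero)
  from tendsto_ennrealI[OF this] show "((\<lambda>x. ennreal \<bar>f x\<bar>) \<longlongrightarrow> 0) F" by simp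
qed

lemma bigO_p_mult_real_tendsto_0:
  fixes Z Y :: "nat \<Rightarrow> 's \<Rightarrow> real"
  assumes Z: "bigO_p M (\<lambda>n. 1) (\<lambda>n \<xi>. ennreal \<bar>Z n \<xi>\<bar>)"
    and Y: "((\<lambda>(n, \<xi>). Y n \<xi>) \<longlongrightarrow> 0) (in_prob M)"
  shows "((\<lambda>(n, \<xi>). Z n \<xi> * Y n \<xi>) \<longlongrightarrow> 0) (in_prob M)"
proof -
  have "((\<lambda>(n, \<xi>). ennreal \<bar>Y n \<xi>\<bar>) \<longlongrightarrow> 0) (in_prob M)"
    using Y by (subst (asm) tendsto_0_ennreal_abs_iff[symmetric]) (simp add: case_prod_unfold)
  from bigO_p_mult_tendsto_0[OF Z this]
  have "((\<lambda>x. ennreal \<bar>case x of (n, \<xi>) \<Rightarrow> Z n \<xi> * Y n \<xi>\<bar>) \<longlongrightarrow> 0) (in_prob M)"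
    by (simp add: case_prod_unfold abs_mult ennreal_mult')
  then show ?thesis by (simp only: tendsto_0_ennreal_abs_iff)
qed

lemma bigO_p_second_moment:
  fixes Z :: "nat \<Rightarrow> 's \<Rightarrow> real"
  assumes Z: "\<And>n. Z n \<in> borel_measurable M"
    and bd: "\<And>n. n \<ge> 1 \<Longrightarrow> (\<integral>\<^sup>+\<xi>. ennreal ((Z n \<xi>)\<^sup>2) \<partial>M) \<le> ennreal C"
  shows "bigO_p M (\<lambda>n. 1) (\<lambda>n \<xi>. ennreal \<bar>Z n \<xi>\<bar>)"
  unfolding bigO_p_def
proof (intro allI impI)
  fix \<epsilon> :: real assume \<epsilon>: "\<epsilon> > 0"
  \<comment> \<open>Chebyshev's bound is \<open>C / D\<^sup>2\<close>, and this \<open>D\<close>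
    makes it at most \<open>\<epsilon>\<close>. Using \<open>\<bar>C\<bar> + 1\<close> keeps
    \<open>D\<close> positive whatever the sign of \<open>C\<close>.\<close>
  define D where "D = sqrt ((\<bar>C\<bar> + 1) / \<epsilon>)"
  have D: "D > 0" "D\<^sup>2 = (\<bar>C\<bar> + 1) / \<epsilon>" using \<epsilon> by (auto simp: D_def)
  have "outer_measure_of M {\<xi> \<in> space M. ennreal (D * 1) < ennreal \<bar>Z n \<xi>\<bar>} \<le> ennreal \<epsilon>"
    if "n \<ge> 1" for n
  proof -
    note Z[of n, measurable]
    have "outer_measure_of M {\<xi> \<in> space M. ennreal (D * 1) < ennreal \<bar>Z n \<xi>\<bar>} =
      emeasure M {\<xi> \<in> space M. ennreal (D * 1) < ennreal \<bar>Z n \<xi>\<bar>}"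
      by (intro outer_measure_of_eq) measurable
    also have "\<dots> \<le> emeasure M {\<xi> \<in> space M. 1 \<le> ennreal (1 / D\<^sup>2) * ennreal ((Z n \<xi>)\<^sup>2)}"
    proof (rule emeasure_mono)
      show "{\<xi> \<in> space M. ennreal (D * 1) < ennreal \<bar>Z n \<xi>\<bar>}
        \<subseteq> {\<xi> \<in> space M. 1 \<le> ennreal (1 / D\<^sup>2) * ennreal ((Z n \<xi>)\<^sup>2)}"
      proof safe
        fix \<xi> assume "ennreal (D * 1) < ennreal \<bar>Z n \<xi>\<bar>"
        then have "D < \<bar>Z n \<xi>\<bar>" using D by (simp add: ennreal_less_iff)
        then have "D\<^sup>2 \<le> (Z n \<xi>)\<^sup>2" using D(1) abs_le_square_iff[of D "Z n \<xi>"] by simp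
        then have "1 \<le> 1 / D\<^sup>2 * (Z n \<xi>)\<^sup>2" using D(1) by (simp add: field_simps)
        then show "1 \<le> ennreal (1 / D\<^sup>2) * ennreal ((Z n \<xi>)\<^sup>2)"
          by (subst ennreal_mult'[symmetric]) (auto simp: ennreal_ge_1)
      qed
    qed measurable
    also have "\<dots> \<le> ennreal (1 / D\<^sup>2) * (\<integral>\<^sup>+\<xi>. ennreal ((Z n \<xi>)\<^sup>2) * indicator (space M) \<xi> \<partial>M)"
      by (rule order_trans[OF _ nn_integral_Markov_inequality]) (auto intro!: emeasure_mono)
    also have "\<dots> \<le> ennreal (1 / D\<^sup>2) * ennreal C"
      using bd[OF that]
      by (intro mult_left_mono) (auto simp: nn_integral_cong_AE cong: nn_integral_cong)
    also have "\<dots> = ennreal (1 / D\<^sup>2 * C)" by (rule ennreal_mult'[symmetric]) auto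
    also have "\<dots> \<le> ennreal \<epsilon>"
    proof (rule ennreal_leI)
      have "\<epsilon> * C \<le> \<epsilon> * (\<bar>C\<bar> + 1)" using \<epsilon> by (intro mult_left_mono) auto
      then show "1 / D\<^sup>2 * C \<le> \<epsilon>" unfolding D(2) using \<epsilon> by (simp add: field_simps)
    qed
    finally show ?thesis .
  qed
  then show "\<exists>C. \<forall>\<^sub>F n in sequentially.
      outer_measure_of M {\<xi> \<in> space M. ennreal (C * 1) < ennreal \<bar>Z n \<xi>\<bar>} \<le> ennreal \<epsilon>"
    by (intro exI[of _ D] eventually_sequentiallyI[of 1])
qed

section \<open>Characteristic functions and Slutsky's theorem\<close>

lemma norm_iexp_diff_le: "norm (iexp x - iexp y) \<le> \<bar>x - y\<bar>"
proof -
  have "iexp x - iexp y = iexp y * (iexp (x - y) - 1)"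
    by (simp add: algebra_simps exp_diff)
  then have "norm (iexp x - iexp y) = norm (iexp (x - y) - 1)"
    by (simp add: norm_mult)
  also have "\<dots> \<le> \<bar>x - y\<bar>"
    using iexp_approx1[of "x - y" 0] by (simp add: power2_eq_square)
  finally show ?thesis .
qed

text \<open>Where \<open>Z\<close> and \<open>W\<close> are \<open>\<epsilon>\<close>-close, their
  \<open>iexp\<close> values at \<open>t\<close> differ by at most
  \<open>\<bar>t\<bar> * \<epsilon>\<close>, and elsewhere by at most 2, so the characteristic
  functions have the same limit. The limit for \<open>W\<close> is assumed at the level of
  characteristic functions, so that Levy's continuity theorem is only invoked for
  \<open>Z\<close>.\<close>

lemma (in prob_space) weak_conv_m_slutsky:
  fixes Z W :: "nat \<Rightarrow> 'a \<Rightarrow> real"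
  assumes Z[measurable]: "\<And>n. Z n \<in> borel_measurable M" and W[measurable]: "\<And>n. W n \<in> borel_measurable M"
    and diff: "((\<lambda>(n, \<xi>). Z n \<xi> - W n \<xi>) \<longlongrightarrow> 0) (in_prob M)"
    and \<nu>: "real_distribution \<nu>" and conv: "\<And>t. (\<lambda>n. char (distr M borel (W n)) t) \<longlonglongrightarrow> char \<nu> t"
  shows "weak_conv_m (\<lambda>n. distr M borel (Z n)) \<nu>"
proof (rule levy_continuity)
  show "real_distribution (distr M borel (Z n))" for n
    by (rule real_distribution_distr) simp
  show "real_distribution \<nu>" by fact
  fix t
  have "(\<lambda>n. char (distr M borel (Z n)) t - char (distr M borel (W n)) t) \<longlonglongrightarrow> 0"
  proof (rule tendstoI)
    fix e :: real assume e: "e > 0"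
    \<comment> \<open>Chosen so that \<open>\<bar>t\<bar> * \<epsilon> + \<epsilon>\<close> is
      \<open>e / 2\<close>; the exceptional event adds at most \<open>2 * (e / 8)\<close>, which
      stays strictly below \<open>e\<close>. The added 1 covers \<open>t = 0\<close>.\<close>
    define \<epsilon> where "\<epsilon> = e / (2 * (\<bar>t\<bar> + 1))"
    have \<epsilon>: "\<epsilon> > 0" using e by (simp add: \<epsilon>_def)
    have "\<epsilon> * (2 * (\<bar>t\<bar> + 1)) = e" by (simp add: \<epsilon>_def)
    then have te: "\<bar>t\<bar> * \<epsilon> + \<epsilon> = e / 2" by (simp add: algebra_simps)
    have "eventually (\<lambda>(n, \<xi>). \<bar>Z n \<xi> - W n \<xi>\<bar> < \<epsilon>) (in_prob M)"
      using tendstoD[OF diff \<epsilon>] by (simp add: case_prod_unfold)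
    then have "(\<lambda>n. outer_measure_of M {\<xi> \<in> space M. \<not> \<bar>Z n \<xi> - W n \<xi>\<bar> < \<epsilon>}) \<longlonglongrightarrow> 0"
      by (simp add: eventually_in_prob)
    from tendsto_0_ennrealD[OF this, of "e / 8"] e
    have "\<forall>\<^sub>F n in sequentially. emeasure M {\<xi> \<in> space M. \<not> \<bar>Z n \<xi> - W n \<xi>\<bar> < \<epsilon>} \<le> ennreal (e / 8)"
      by simp
    then show "\<forall>\<^sub>F n in sequentially. dist (char (distr M borel (Z n)) t - char (distr M borel (W n)) t) 0 < e"
    proof eventually_elim
      case (elim n)
      let ?A = "{\<xi> \<in> space M. \<not> \<bar>Z n \<xi> - W n \<xi>\<bar> < \<epsilon>}"
      have A: "prob ?A \<le> e / 8" using elim e by (simp add: emeasure_eq_measure)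
      have int: "integrable M (\<lambda>\<xi>. iexp (t * Z n \<xi>))" "integrable M (\<lambda>\<xi>. iexp (t * W n \<xi>))"
        by (auto intro!: integrable_const_bound[where B=1])
      have "char (distr M borel (Z n)) t - char (distr M borel (W n)) t =
        (CLINT \<xi>|M. iexp (t * Z n \<xi>) - iexp (t * W n \<xi>))"
        using int by (simp add: char_def integral_distr)
      also have "norm \<dots> \<le> (LINT \<xi>|M. norm (iexp (t * Z n \<xi>) - iexp (t * W n \<xi>)))"
        by (rule integral_norm_bound)
      also have "\<dots> \<le> (LINT \<xi>|M. \<bar>t\<bar> * \<epsilon> + 2 * indicator ?A \<xi>)"
      proof (rule integral_mono)
        show "integrable M (\<lambda>\<xi>. norm (iexp (t * Z n \<xi>) - iexp (t * W n \<xi>)))"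
          using int by (intro integrable_norm Bochner_Integration.integrable_diff)
        show "integrable M (\<lambda>\<xi>. \<bar>t\<bar> * \<epsilon> + 2 * indicator ?A \<xi>)"
          by (auto intro!: Bochner_Integration.integrable_add integrable_real_indicator
              simp: less_top[symmetric])
        fix \<xi> assume \<xi>: "\<xi> \<in> space M"
        show "norm (iexp (t * Z n \<xi>) - iexp (t * W n \<xi>)) \<le> \<bar>t\<bar> * \<epsilon> + 2 * indicator ?A \<xi>"
        proof (cases "\<xi> \<in> ?A")
          case True
          have "norm (iexp (t * Z n \<xi>) - iexp (t * W n \<xi>)) \<le> 1 + 1"
            by (rule norm_triangle_le_diff) (simp add: norm_exp_i_times del: of_real_mult)
          moreover have "\<bar>t\<bar> * \<epsilon> \<ge> 0" using \<epsilon> by simp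
          ultimately show ?thesis using True by simp
        next
          case False
          then have "\<bar>Z n \<xi> - W n \<xi>\<bar> < \<epsilon>" using \<xi> by auto
          then have "\<bar>t\<bar> * \<bar>Z n \<xi> - W n \<xi>\<bar> \<le> \<bar>t\<bar> * \<epsilon>" by (intro mult_left_mono) auto
          then have "norm (iexp (t * Z n \<xi>) - iexp (t * W n \<xi>)) \<le> \<bar>t\<bar> * \<epsilon>"
            using norm_iexp_diff_le[of "t * Z n \<xi>" "t * W n \<xi>"]
            by (simp add: right_diff_distrib[symmetric] abs_mult)
          then show ?thesis using False by simp
        qed
      qed
      also have "\<dots> = \<bar>t\<bar> * \<epsilon> + 2 * prob ?A"
        by (subst Bochner_Integration.integral_add)
           (auto intro!: integrable_real_indicator simp: less_top[symmetric] prob_space)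
      also have "\<dots> < e" using A te \<epsilon> e by linarith
      finally show ?case by simp
    qed
  qed
  from tendsto_add[OF this conv[of t]]
  show "(\<lambda>n. char (distr M borel (Z n)) t) \<longlonglongrightarrow> char \<nu> t" by simp
qed

section \<open>Independent samples and cross-fitting\<close>

text \<open>\<open>N\<close> carries the sigma-algebra and \<open>Q\<close> the common law.
  Measurability is stated over \<open>N\<close>, so that one statement about an estimator serves
  both the sample on \<open>M\<close> and the products of \<open>Q\<close>.\<close>

locale iid_sample = prob_space M for M :: "'s measure" +
  fixes N Q :: "'b measure" and S :: "nat \<Rightarrow> 's \<Rightarrow> 'b"
  assumes indep: "indep_vars (\<lambda>_. N) S {1..}"
    and distr_S: "\<And>i. i \<ge> 1 \<Longrightarrow> distr M N (S i) = Q"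
begin

abbreviation "prodN K \<equiv> PiM K (\<lambda>_. N)"
abbreviation "prodQ K \<equiv> PiM K (\<lambda>_. Q)"
abbreviation "sample K \<xi> \<equiv> restrict (\<lambda>i. S i \<xi>) K"

lemma S_measurable: "i \<ge> 1 \<Longrightarrow> S i \<in> measurable M N"
  using indep unfolding indep_vars_def by auto

lemma sets_Q: "sets Q = sets N"
  using distr_S[of 1] by auto

lemma measurable_Q: "f \<in> measurable N L \<Longrightarrow> f \<in> measurable Q L"
  by (subst measurable_cong_sets[OF sets_Q refl])

lemma prob_space_Q: "prob_space Q"
  using prob_space_distr[OF S_measurable[of 1]] distr_S[of 1] by simp

lemma restrict_S_measurable:
  "K \<subseteq> {1..} \<Longrightarrow> (\<lambda>\<xi>. sample K \<xi>) \<in> measurable M (prodN K)"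
  by (intro measurable_restrict S_measurable) auto

lemma distr_restrict_S:
  assumes "K \<noteq> {}" "K \<subseteq> {1..}"
  shows "distr M (prodN K) (\<lambda>\<xi>. sample K \<xi>) = prodQ K"
proof -
  have "indep_vars (\<lambda>_. N) S K" using indep_vars_subset[OF indep] assms by auto
  then have "distr M (prodN K) (\<lambda>\<xi>. sample K \<xi>) = PiM K (\<lambda>i. distr M N (S i))"
    using assms S_measurable by (subst (asm) indep_vars_iff_distr_eq_PiM') auto
  also have "\<dots> = prodQ K"
    using assms distr_S by (intro PiM_cong) auto
  finally show ?thesis .
qed

lemma sets_PiM_Q: "sets (prodQ K) = sets (prodN K)"
  by (intro sets_PiM_cong) (auto simp: sets_Q)

text \<open>This is the form that conditioning on the training folds takes. With \<open>K\<close>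
  the training and \<open>J\<close> the evaluation indices, independence turns an expectation over
  the sample into an iterated integral in which the training sample \<open>d\<close> is a constant
  of the inner one. \<open>K\<close> may be empty, as it is with a single fold.\<close>

lemma nn_integral_split:
  assumes OJ: "K \<inter> J = {}" "finite K" "finite J" "K \<subseteq> {1..}" "J \<subseteq> {1..}" "J \<noteq> {}"
    and F: "F \<in> borel_measurable (prodN K \<Otimes>\<^sub>M prodN J)"
  shows "(\<integral>\<^sup>+\<xi>. F (sample K \<xi>, sample J \<xi>) \<partial>M) =
    (\<integral>\<^sup>+d. (\<integral>\<^sup>+y. F (d, y) \<partial>prodQ J) \<partial>prodQ K)"
proof -
  interpret Q: prob_space Q by (rule prob_space_Q)
  interpret product_sigma_finite "\<lambda>_::nat. Q" by standard
  define F' where "F' \<omega> = F (restrict \<omega> K, restrict \<omega> J)" for \<omega>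
  have F'[measurable]: "F' \<in> borel_measurable (prodN (K \<union> J))"
    unfolding F'_def by (intro measurable_compose[OF _ F] measurable_Pair measurable_restrict_subset) auto
  then have F'Q: "F' \<in> borel_measurable (prodQ (K \<union> J))"
    by (subst measurable_cong_sets[OF sets_PiM_Q refl])
  have "(\<integral>\<^sup>+\<xi>. F (sample K \<xi>, sample J \<xi>) \<partial>M) =
    (\<integral>\<^sup>+\<xi>. F' (sample (K \<union> J) \<xi>) \<partial>M)"
    by (simp add: F'_def Int_absorb1)
  also have "\<dots> = (\<integral>\<^sup>+\<omega>. F' \<omega> \<partial>prodQ (K \<union> J))"
    using OJ restrict_S_measurable[of "K \<union> J"]
    by (subst distr_restrict_S[symmetric]) (auto simp: nn_integral_distr)
  also have "\<dots> = (\<integral>\<^sup>+d. (\<integral>\<^sup>+y. F' (merge K J (d, y)) \<partial>prodQ J) \<partial>prodQ K)"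
    by (rule product_nn_integral_fold[OF OJ(1-3) F'Q])
  also have "\<dots> = (\<integral>\<^sup>+d. (\<integral>\<^sup>+y. F (d, y) \<partial>prodQ J) \<partial>prodQ K)"
    using OJ(1)
    by (intro nn_integral_cong) (simp add: F'_def space_PiM PiE_def extensional_restrict)
  finally show ?thesis .
qed

lemma nn_integral_abs_sum_le:
  fixes J :: "nat set"
  assumes J: "finite J" and g: "g \<in> borel_measurable N"
  shows "(\<integral>\<^sup>+y. ennreal \<bar>\<Sum>i\<in>J. g (y i)\<bar> \<partial>prodQ J) \<le>
    of_nat (card J) * (\<integral>\<^sup>+s. ennreal \<bar>g s\<bar> \<partial>Q)"
proof -
  interpret Q: prob_space Q by (rule prob_space_Q)
  interpret product_prob_space "\<lambda>_::nat. Q" J by standard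
  have gQ[measurable]: "g \<in> borel_measurable Q" using g by (rule measurable_Q)
  have "(\<integral>\<^sup>+y. ennreal \<bar>\<Sum>i\<in>J. g (y i)\<bar> \<partial>prodQ J) \<le>
    (\<integral>\<^sup>+y. (\<Sum>i\<in>J. ennreal \<bar>g (y i)\<bar>) \<partial>prodQ J)"
    by (intro nn_integral_mono) (simp add: sum_ennreal ennreal_leI sum_abs)
  also have "\<dots> = (\<Sum>i\<in>J. (\<integral>\<^sup>+y. ennreal \<bar>g (y i)\<bar> \<partial>prodQ J))"
    by (rule nn_integral_sum) measurable
  also have "\<dots> = (\<Sum>i\<in>J. (\<integral>\<^sup>+s. ennreal \<bar>g s\<bar> \<partial>Q))"
  proof (rule sum.cong[OF refl])
    fix i assume i: "i \<in> J"
    have "(\<integral>\<^sup>+y. ennreal \<bar>g (y i)\<bar> \<partial>prodQ J) =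
      (\<integral>\<^sup>+s. ennreal \<bar>g s\<bar> \<partial>distr (prodQ J) Q (\<lambda>y. y i))"
      using i by (subst nn_integral_distr) auto
    then show "(\<integral>\<^sup>+y. ennreal \<bar>g (y i)\<bar> \<partial>prodQ J) = (\<integral>\<^sup>+s. ennreal \<bar>g s\<bar> \<partial>Q)"
      using PiM_component[OF i] by simp
  qed
  finally show ?thesis by simp
qed

text \<open>Additivity of the variance, by integrating out one coordinate at a time: the cross term
  is a multiple of the mean of \<open>g\<close>. Non-negative integrals avoid integrability
  questions on the product space.\<close>

lemma nn_integral_sum_square:
  fixes J :: "nat set"
  assumes J: "finite J" and g: "g \<in> borel_measurable N"
    and fin: "(\<integral>\<^sup>+s. ennreal ((g s)\<^sup>2) \<partial>Q) < \<infinity>" and mean: "(\<integral>s. g s \<partial>Q) = 0"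
  shows "(\<integral>\<^sup>+y. ennreal ((\<Sum>i\<in>J. g (y i))\<^sup>2) \<partial>prodQ J) =
    of_nat (card J) * (\<integral>\<^sup>+s. ennreal ((g s)\<^sup>2) \<partial>Q)"
  using J
proof (induction J rule: finite_induct)
  case empty
  then show ?case by (simp add: nn_integral_0_iff_AE)
next
  case (insert j J)
  interpret Q: prob_space Q by (rule prob_space_Q)
  interpret product_prob_space "\<lambda>_::nat. Q" J by standard
  have gQ[measurable]: "g \<in> borel_measurable Q" using g by (rule measurable_Q)
  have int2: "integrable Q (\<lambda>s. (g s)\<^sup>2)"
    using fin by (intro integrableI_bounded) auto
  then have int1: "integrable Q g"
    by (rule Q.square_integrable_imp_integrable[OF gQ])
  define v where "v = (\<integral>s. (g s)\<^sup>2 \<partial>Q)"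
  have v: "(\<integral>\<^sup>+s. ennreal ((g s)\<^sup>2) \<partial>Q) = ennreal v" "v \<ge> 0"
    unfolding v_def by (auto intro!: nn_integral_eq_integral int2)
  have step: "(\<integral>\<^sup>+s. ennreal ((a + g s)\<^sup>2) \<partial>Q) = ennreal (a\<^sup>2) + ennreal v" for a
  proof -
    have "(\<integral>\<^sup>+s. ennreal ((a + g s)\<^sup>2) \<partial>Q) = ennreal (\<integral>s. (a + g s)\<^sup>2 \<partial>Q)"
    proof (rule nn_integral_eq_integral)
      show "integrable Q (\<lambda>s. (a + g s)\<^sup>2)" using int1 int2 by (simp add: power2_sum)
    qed simp
    also have "(\<integral>s. (a + g s)\<^sup>2 \<partial>Q) = a\<^sup>2 + v"
      using int1 int2 by (simp add: power2_sum v_def mean Q.prob_space)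
    finally show ?thesis using v by (simp add: ennreal_plus)
  qed
  have "(\<integral>\<^sup>+y. ennreal ((\<Sum>i\<in>insert j J. g (y i))\<^sup>2) \<partial>prodQ (insert j J)) =
    (\<integral>\<^sup>+x. (\<integral>\<^sup>+s. ennreal ((\<Sum>i\<in>insert j J. g ((x(j := s)) i))\<^sup>2) \<partial>Q) \<partial>prodQ J)"
    by (rule product_nn_integral_insert[OF insert(1,2)]) measurable
  also have "\<dots> = (\<integral>\<^sup>+x. ennreal ((\<Sum>i\<in>J. g (x i))\<^sup>2) + ennreal v \<partial>prodQ J)"
  proof (rule nn_integral_cong)
    fix x
    have "(\<Sum>i\<in>insert j J. g ((x(j := s)) i)) = (\<Sum>i\<in>J. g (x i)) + g s" for s
    proof -
      have "(\<Sum>i\<in>J. g ((x(j := s)) i)) = (\<Sum>i\<in>J. g (x i))"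
        using insert(2) by (intro sum.cong) auto
      then show ?thesis using insert(1,2) by simp
    qed
    then show "(\<integral>\<^sup>+s. ennreal ((\<Sum>i\<in>insert j J. g ((x(j := s)) i))\<^sup>2) \<partial>Q) =
        ennreal ((\<Sum>i\<in>J. g (x i))\<^sup>2) + ennreal v"
      by (simp only: step)
  qed
  also have "\<dots> = (\<integral>\<^sup>+x. ennreal ((\<Sum>i\<in>J. g (x i))\<^sup>2) \<partial>prodQ J) + ennreal v"
    by (subst nn_integral_add) (auto simp: P.emeasure_space_1)
  also have "\<dots> = of_nat (card (insert j J)) * (\<integral>\<^sup>+s. ennreal ((g s)\<^sup>2) \<partial>Q)"
    using insert by (simp add: v(1) distrib_right add.commute)
  finally show ?case .
qed

text \<open>The bound is demanded only for training samples in \<open>E\<close>; for the others the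
  inner integral may be infinite.\<close>

lemma crossfit_moment_le:
  assumes OJ: "K \<inter> J = {}" "finite K" "finite J" "K \<subseteq> {1..}" "J \<subseteq> {1..}" "J \<noteq> {}"
    and f: "(\<lambda>(d, y). f d y) \<in> borel_measurable (prodN K \<Otimes>\<^sub>M prodN J)"
    and E: "E \<in> sets (prodN K)"
    and bd: "\<And>d. d \<in> E \<Longrightarrow> (\<integral>\<^sup>+y. f d y \<partial>prodQ J) \<le> c"
  shows "(\<integral>\<^sup>+\<xi>. indicator E (sample K \<xi>) *
    f (sample K \<xi>) (sample J \<xi>) \<partial>M) \<le> c"
proof -
  interpret Q: prob_space Q by (rule prob_space_Q)
  interpret product_prob_space "\<lambda>_::nat. Q" K by standard
  note E[measurable]
  have "(\<integral>\<^sup>+\<xi>. indicator E (sample K \<xi>) *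
    f (sample K \<xi>) (sample J \<xi>) \<partial>M) =
    (\<integral>\<^sup>+\<xi>. (\<lambda>(d, y). indicator E d * f d y) (sample K \<xi>, sample J \<xi>) \<partial>M)"
    by simp
  also have "\<dots> = (\<integral>\<^sup>+d. (\<integral>\<^sup>+y. (\<lambda>(d, y). indicator E d * f d y) (d, y) \<partial>prodQ J) \<partial>prodQ K)"
    using f by (intro nn_integral_split[OF OJ]) (simp add: case_prod_unfold)
  also have "\<dots> \<le> (\<integral>\<^sup>+d. c \<partial>prodQ K)"
    using bd by (intro nn_integral_mono) (auto split: split_indicator)
  also have "\<dots> = c" by (simp add: P.emeasure_space_1)
  finally show ?thesis .
qed

text \<open>Markov's inequality for the \<open>q\<close>-th moment, conditionally on the training
  sample. The moment bound holds on events \<open>E n \<epsilon>\<close> whose probability tends to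
  one, so the inequality is applied to the sum cut off by that event.\<close>

lemma crossfit_tendsto:
  fixes h :: "nat \<Rightarrow> (nat \<Rightarrow> 'b) \<Rightarrow> 'b \<Rightarrow> real" and q :: nat
  assumes OJ: "\<And>n. K n \<inter> J n = {}" "\<And>n. finite (K n)" "\<And>n. K n \<subseteq> {1..}" "\<And>n. J n \<subseteq> {1..n}"
    and h: "\<And>n. (\<lambda>(d, s). h n d s) \<in> borel_measurable (prodN (K n) \<Otimes>\<^sub>M N)"
    and E: "\<And>n \<epsilon>. \<epsilon> > 0 \<Longrightarrow> E n \<epsilon> \<in> sets (prodN (K n))"
    and evE: "\<And>\<epsilon>. \<epsilon> > 0 \<Longrightarrow> eventually (\<lambda>(n, \<xi>). sample (K n) \<xi> \<in> E n \<epsilon>) (in_prob M)"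
    and bd: "\<And>n \<epsilon> d. n \<ge> 1 \<Longrightarrow> \<epsilon> > 0 \<Longrightarrow> J n \<noteq> {} \<Longrightarrow> d \<in> E n \<epsilon> \<Longrightarrow>
      (\<integral>\<^sup>+y. ennreal (\<bar>\<Sum>i\<in>J n. h n d (y i)\<bar> ^ q) \<partial>prodQ (J n)) \<le> ennreal (\<epsilon> * b n ^ q)"
    and b: "\<And>n. n \<ge> 1 \<Longrightarrow> b n > 0" and q: "q > 0"
  shows "((\<lambda>(n, \<xi>). (\<Sum>i\<in>J n. h n (sample (K n) \<xi>) (S i \<xi>)) / b n) \<longlongrightarrow> 0) (in_prob M)"
proof (rule tendstoI)
  fix e :: real assume e: "e > 0"
  let ?tr = "\<lambda>n \<xi>. sample (K n) \<xi>"
  let ?s = "\<lambda>n \<xi>. \<Sum>i\<in>J n. h n (?tr n \<xi>) (S i \<xi>)"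
  show "\<forall>\<^sub>F x in in_prob M. dist (case x of (n, \<xi>) \<Rightarrow> ?s n \<xi> / b n) 0 < e"
    unfolding eventually_in_prob
  proof (rule tendsto_0_ennrealI)
    fix \<delta> :: real assume \<delta>: "\<delta> > 0"
    \<comment> \<open>With this value Markov's bound \<open>\<eta> * b n ^ q / (e * b n) ^ q\<close>
      is \<open>\<delta> / 2\<close>; the other half of \<open>\<delta>\<close> pays for training
      samples outside the event.\<close>
    define \<eta> where "\<eta> = \<delta> / 2 * e ^ q"
    have \<eta>: "\<eta> > 0" using \<delta> e by (simp add: \<eta>_def)
    from tendsto_0_ennrealD[OF evE[OF \<eta>, unfolded eventually_in_prob], of "\<delta> / 2"] \<delta>
    have "\<forall>\<^sub>F n in sequentially. outer_measure_of M {\<xi> \<in> space M. ?tr n \<xi> \<notin> E n \<eta>} \<le> ennreal (\<delta> / 2)"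
      by simp
    then show "\<forall>\<^sub>F n in sequentially. outer_measure_of M
      {\<xi> \<in> space M. \<not> dist (case (n, \<xi>) of (n, \<xi>) \<Rightarrow> ?s n \<xi> / b n) 0 < e} \<le> ennreal \<delta>"
      using eventually_ge_at_top[of "1::nat"]
    proof eventually_elim
      case (elim n)
      have bn: "b n > 0" using b elim by simp
      \<comment> \<open>An empty evaluation fold is treated apart, because the law of an empty block
        is not covered by \<open>nn_integral_split\<close>; the sum is then 0.\<close>
      show ?case
      proof (cases "J n = {}")
        case True
        then show ?thesis using e by simp
      next
        case False
        note E[OF \<eta>, of n, measurable] h[of n, measurable]
        have J: "finite (J n)" "J n \<subseteq> {1..}" using OJ(4)[of n] by (auto intro: finite_subset)
        have tr[measurable]: "?tr n \<in> measurable M (prodN (K n))"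
          using OJ(3) by (rule restrict_S_measurable)
        have s[measurable]: "?s n \<in> borel_measurable M"
        proof (rule borel_measurable_sum)
          fix i assume "i \<in> J n"
          then have [measurable]: "S i \<in> measurable M N" using J by (intro S_measurable) auto
          have "(\<lambda>\<xi>. (\<lambda>(d, s). h n d s) (?tr n \<xi>, S i \<xi>)) \<in> borel_measurable M"
            by measurable
          then show "(\<lambda>\<xi>. h n (?tr n \<xi>) (S i \<xi>)) \<in> borel_measurable M" by simp
        qed
        have fm: "(\<lambda>(d, y). ennreal (\<bar>\<Sum>i\<in>J n. h n d (y i)\<bar> ^ q)) \<in>
            borel_measurable (prodN (K n) \<Otimes>\<^sub>M prodN (J n))"
        proof -
          have "(\<lambda>x. h n (fst x) (snd x i)) \<in>
            borel_measurable (prodN (K n) \<Otimes>\<^sub>M prodN (J n))" if "i \<in> J n" for i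
          proof -
            have "(\<lambda>x. (\<lambda>(d, s). h n d s) (fst x, snd x i)) \<in>
              borel_measurable (prodN (K n) \<Otimes>\<^sub>M prodN (J n))"
              using that by (intro measurable_compose[OF _ h]) measurable
            then show ?thesis by simp
          qed
          then show ?thesis unfolding case_prod_unfold by measurable
        qed
        let ?A = "{\<xi> \<in> space M. ?tr n \<xi> \<in> E n \<eta> \<and> e \<le> \<bar>?s n \<xi> / b n\<bar>}"
        let ?c = "ennreal (1 / (e * b n) ^ q)"
        have "emeasure M ?A \<le> emeasure M ({\<xi> \<in> space M. 1 \<le> ?c *
            (indicator (E n \<eta>) (?tr n \<xi>) * ennreal (\<bar>?s n \<xi>\<bar> ^ q))})"
        proof (rule emeasure_mono)
          show "?A \<subseteq> {\<xi> \<in> space M. 1 \<le> ?c * (indicator (E n \<eta>) (?tr n \<xi>) * ennreal (\<bar>?s n \<xi>\<bar> ^ q))}"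
          proof safe
            fix \<xi> assume \<xi>: "?tr n \<xi> \<in> E n \<eta>" "e \<le> \<bar>?s n \<xi> / b n\<bar>"
            then have "e * b n \<le> \<bar>?s n \<xi>\<bar>" using bn by (simp add: field_simps)
            then have "(e * b n) ^ q \<le> \<bar>?s n \<xi>\<bar> ^ q" using e bn by (intro power_mono) auto
            then have "1 \<le> 1 / (e * b n) ^ q * \<bar>?s n \<xi>\<bar> ^ q" using e bn by (simp add: field_simps)
            then have "1 \<le> ?c * ennreal (\<bar>?s n \<xi>\<bar> ^ q)"
              using e bn by (subst ennreal_mult'[symmetric]) (auto simp: ennreal_ge_1)
            then show "1 \<le> ?c * (indicator (E n \<eta>) (?tr n \<xi>) * ennreal (\<bar>?s n \<xi>\<bar> ^ q))"
              using \<xi>(1) by simp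
          qed
        qed measurable
        also have "\<dots> \<le> ?c * (\<integral>\<^sup>+\<xi>. (indicator (E n \<eta>) (?tr n \<xi>) * ennreal (\<bar>?s n \<xi>\<bar> ^ q)) *
            indicator (space M) \<xi> \<partial>M)"
          by (rule order_trans[OF _ nn_integral_Markov_inequality]) (auto intro!: emeasure_mono)
        also have "\<dots> \<le> ?c * ennreal (\<eta> * b n ^ q)"
        proof (rule mult_left_mono)
          have "(\<integral>\<^sup>+\<xi>. (indicator (E n \<eta>) (?tr n \<xi>) * ennreal (\<bar>?s n \<xi>\<bar> ^ q)) *
            indicator (space M) \<xi> \<partial>M) =
          (\<integral>\<^sup>+\<xi>. indicator (E n \<eta>) (?tr n \<xi>) *
            ennreal (\<bar>\<Sum>i\<in>J n. h n (?tr n \<xi>) (sample (J n) \<xi> i)\<bar> ^ q) \<partial>M)"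
          by (intro nn_integral_cong) simp
        also have "\<dots> \<le> ennreal (\<eta> * b n ^ q)"
          using bd[OF _ \<eta> False] elim
          by (intro crossfit_moment_le[OF OJ(1,2) J(1) OJ(3) J(2) False fm]) auto
          finally show "(\<integral>\<^sup>+\<xi>. (indicator (E n \<eta>) (?tr n \<xi>) * ennreal (\<bar>?s n \<xi>\<bar> ^ q)) *
            indicator (space M) \<xi> \<partial>M) \<le> ennreal (\<eta> * b n ^ q)" .
        qed simp
        also have "?c * ennreal (\<eta> * b n ^ q) = ennreal (1 / (e * b n) ^ q * (\<eta> * b n ^ q))"
          using e bn by (intro ennreal_mult'[symmetric]) auto
        also have "1 / (e * b n) ^ q * (\<eta> * b n ^ q) = \<delta> / 2"
          using e bn by (simp add: \<eta>_def power_mult_distrib)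
        finally have A: "emeasure M ?A \<le> ennreal (\<delta> / 2)" .
        have "{\<xi> \<in> space M. \<not> dist (case (n, \<xi>) of (n, \<xi>) \<Rightarrow> ?s n \<xi> / b n) 0 < e} \<subseteq>
          ?A \<union> {\<xi> \<in> space M. ?tr n \<xi> \<notin> E n \<eta>}"
          by (auto simp: dist_real_def)
        from outer_measure_of_mono[OF this, of M]
        have "outer_measure_of M {\<xi> \<in> space M. \<not> dist (case (n, \<xi>) of (n, \<xi>) \<Rightarrow> ?s n \<xi> / b n) 0 < e} \<le>
          outer_measure_of M ?A + outer_measure_of M {\<xi> \<in> space M. ?tr n \<xi> \<notin> E n \<eta>}"
          by (rule order_trans[OF _ outer_measure_of_union_le])
        also have "outer_measure_of M ?A = emeasure M ?A"
          by (intro outer_measure_of_eq) measurable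
        also have "emeasure M ?A + outer_measure_of M {\<xi> \<in> space M. ?tr n \<xi> \<notin> E n \<eta>} \<le>
            ennreal (\<delta> / 2) + ennreal (\<delta> / 2)"
          using A elim by (intro add_mono) auto
        also have "\<dots> = ennreal \<delta>" using \<delta> by (subst ennreal_plus[symmetric]) auto
        finally show ?thesis .
      qed
    qed
  qed
qed

section \<open>Conditional first and second moment criteria\<close>

lemma nn_integral_measurable_Q:
  assumes "(\<lambda>(d, s). f d s) \<in> borel_measurable (L \<Otimes>\<^sub>M N)"
  shows "(\<lambda>d. \<integral>\<^sup>+s. f d s \<partial>Q) \<in> borel_measurable L"
proof -
  interpret Q: prob_space Q by (rule prob_space_Q)
  have "sets (L \<Otimes>\<^sub>M Q) = sets (L \<Otimes>\<^sub>M N)" by (rule sets_pair_measure_cong) (simp_all add: sets_Q)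
  then have "(\<lambda>(d, s). f d s) \<in> borel_measurable (L \<Otimes>\<^sub>M Q)"
    using assms by (simp cong: measurable_cong_sets)
  then show ?thesis by (rule Q.borel_measurable_nn_integral)
qed

lemma integral_measurable_Q:
  fixes f :: "'c \<Rightarrow> 'b \<Rightarrow> real"
  assumes "(\<lambda>(d, s). f d s) \<in> borel_measurable (L \<Otimes>\<^sub>M N)"
  shows "(\<lambda>d. \<integral>s. f d s \<partial>Q) \<in> borel_measurable L"
proof -
  interpret Q: prob_space Q by (rule prob_space_Q)
  have "sets (L \<Otimes>\<^sub>M Q) = sets (L \<Otimes>\<^sub>M N)" by (rule sets_pair_measure_cong) (simp_all add: sets_Q)
  then have "(\<lambda>(d, s). f d s) \<in> borel_measurable (L \<Otimes>\<^sub>M Q)"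
    using assms by (simp cong: measurable_cong_sets)
  then show ?thesis by (rule Q.borel_measurable_lebesgue_integral)
qed

lemma measurable_section_N:
  "(\<lambda>(d, s). f d s) \<in> measurable (L \<Otimes>\<^sub>M N) R \<Longrightarrow> d \<in> space L \<Longrightarrow> f d \<in> measurable N R"
  using measurable_Pair2[of "\<lambda>(d, s). f d s"] by simp

text \<open>The triangle inequality asks for no centring but loses a factor \<open>n\<close>. It
  serves with \<open>b n\<close> equal to \<open>sqrt n\<close> for products of two errors, and with
  \<open>b n = n\<close> where consistency is enough.\<close>

lemma crossfit_first_moment:
  fixes h :: "nat \<Rightarrow> (nat \<Rightarrow> 'b) \<Rightarrow> 'b \<Rightarrow> real"
  assumes KJ: "\<And>n. K n \<inter> J n = {}" "\<And>n. finite (K n)" "\<And>n. K n \<subseteq> {1..}" "\<And>n. J n \<subseteq> {1..n}"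
    and h: "\<And>n. (\<lambda>(d, s). h n d s) \<in> borel_measurable (prodN (K n) \<Otimes>\<^sub>M N)"
    and b: "\<And>n. n \<ge> 1 \<Longrightarrow> b n > 0"
    and lim: "((\<lambda>(n, \<xi>). ennreal (real n / b n) *
      (\<integral>\<^sup>+s. ennreal \<bar>h n (sample (K n) \<xi>) s\<bar> \<partial>Q)) \<longlongrightarrow> 0) (in_prob M)"
  shows "((\<lambda>(n, \<xi>). (\<Sum>i\<in>J n. h n (sample (K n) \<xi>) (S i \<xi>)) / b n) \<longlongrightarrow> 0) (in_prob M)"
proof (rule crossfit_tendsto[where q = 1, OF KJ h])
  define E where "E n \<epsilon> = {d \<in> space (prodN (K n)).
    ennreal (real n / b n) * (\<integral>\<^sup>+s. ennreal \<bar>h n d s\<bar> \<partial>Q) \<le> ennreal \<epsilon>}" for n and \<epsilon> :: real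
  have [measurable]: "(\<lambda>d. \<integral>\<^sup>+s. ennreal \<bar>h n d s\<bar> \<partial>Q) \<in> borel_measurable (prodN (K n))" for n
    using h[of n] by (intro nn_integral_measurable_Q) (simp add: case_prod_unfold)
  show "E n \<epsilon> \<in> sets (prodN (K n))" for n \<epsilon>
    unfolding E_def by measurable
  show "eventually (\<lambda>(n, \<xi>). sample (K n) \<xi> \<in> E n \<epsilon>) (in_prob M)" if "\<epsilon> > 0" for \<epsilon>
  proof -
    have sp: "eventually (\<lambda>(n, \<xi>). sample (K n) \<xi> \<in> space (prodN (K n))) (in_prob M)"
      using measurable_space[OF restrict_S_measurable[OF KJ(3)]]
      by (intro eventually_in_prob_sequentially always_eventually) auto
    from tendsto_0_ennrealD[OF lim that] sp show ?thesis
      by eventually_elim (auto simp: E_def)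
  qed
  fix n :: nat and \<epsilon> :: real and d
  assume n: "n \<ge> 1" and \<epsilon>: "\<epsilon> > 0" and d: "d \<in> E n \<epsilon>"
  have J: "finite (J n)" using KJ(4)[of n] by (rule finite_subset) simp
  have cJ: "card (J n) \<le> n" using card_mono[OF _ KJ(4)[of n]] by simp
  have bn: "b n > 0" using b n by simp
  have dh: "h n d \<in> borel_measurable N"
    using d h by (intro measurable_section_N) (auto simp: E_def)
  have "(\<integral>\<^sup>+y. ennreal (\<bar>\<Sum>i\<in>J n. h n d (y i)\<bar> ^ 1) \<partial>prodQ (J n)) \<le>
    of_nat (card (J n)) * (\<integral>\<^sup>+s. ennreal \<bar>h n d s\<bar> \<partial>Q)"
    using nn_integral_abs_sum_le[OF J dh] by simp
  also have "\<dots> \<le> of_nat n * (\<integral>\<^sup>+s. ennreal \<bar>h n d s\<bar> \<partial>Q)"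
    using cJ by (intro mult_right_mono of_nat_mono) auto
  also have "\<dots> = ennreal (b n) * (ennreal (real n / b n) * (\<integral>\<^sup>+s. ennreal \<bar>h n d s\<bar> \<partial>Q))"
    using bn by (simp add: mult.assoc[symmetric] ennreal_mult'[symmetric] ennreal_of_nat_eq_real_of_nat)
  also have "\<dots> \<le> ennreal (b n) * ennreal \<epsilon>"
    using d by (intro mult_left_mono) (auto simp: E_def)
  also have "\<dots> = ennreal (\<epsilon> * b n ^ 1)"
    using bn \<epsilon> by (simp add: ennreal_mult'[symmetric] mult.commute)
  finally show "(\<integral>\<^sup>+y. ennreal (\<bar>\<Sum>i\<in>J n. h n d (y i)\<bar> ^ 1) \<partial>prodQ (J n)) \<le>
    ennreal (\<epsilon> * b n ^ 1)" .
qed (use b in auto)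

text \<open>Centring saves a factor \<open>sqrt n\<close> over the triangle inequality, so a
  vanishing conditional second moment suffices without a rate. The mean has to vanish only with
  probability tending to one, since centring can depend on properties of the training
  sample.\<close>

lemma crossfit_second_moment:
  fixes h :: "nat \<Rightarrow> (nat \<Rightarrow> 'b) \<Rightarrow> 'b \<Rightarrow> real"
  assumes KJ: "\<And>n. K n \<inter> J n = {}" "\<And>n. finite (K n)" "\<And>n. K n \<subseteq> {1..}" "\<And>n. J n \<subseteq> {1..n}"
    and h: "\<And>n. (\<lambda>(d, s). h n d s) \<in> borel_measurable (prodN (K n) \<Otimes>\<^sub>M N)"
    and lim: "((\<lambda>(n, \<xi>). \<integral>\<^sup>+s. ennreal ((h n (sample (K n) \<xi>) s)\<^sup>2) \<partial>Q) \<longlongrightarrow> 0) (in_prob M)"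
    and mean: "eventually (\<lambda>(n, \<xi>). (\<integral>s. h n (sample (K n) \<xi>) s \<partial>Q) = 0) (in_prob M)"
  shows "((\<lambda>(n, \<xi>). (\<Sum>i\<in>J n. h n (sample (K n) \<xi>) (S i \<xi>)) / sqrt (real n)) \<longlongrightarrow> 0)
    (in_prob M)"
proof (rule crossfit_tendsto[where q = 2, OF KJ h])
  define E where "E n \<epsilon> = {d \<in> space (prodN (K n)).
    (\<integral>\<^sup>+s. ennreal ((h n d s)\<^sup>2) \<partial>Q) \<le> ennreal \<epsilon> \<and> (\<integral>s. h n d s \<partial>Q) = 0}" for n and \<epsilon> :: real
  have [measurable]: "(\<lambda>d. \<integral>\<^sup>+s. ennreal ((h n d s)\<^sup>2) \<partial>Q) \<in> borel_measurable (prodN (K n))" for n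
    using h[of n] by (intro nn_integral_measurable_Q) (simp add: case_prod_unfold)
  have [measurable]: "(\<lambda>d. \<integral>s. h n d s \<partial>Q) \<in> borel_measurable (prodN (K n))" for n
    using h[of n] by (intro integral_measurable_Q) (simp add: case_prod_unfold)
  show "E n \<epsilon> \<in> sets (prodN (K n))" for n \<epsilon>
    unfolding E_def by measurable
  show "eventually (\<lambda>(n, \<xi>). sample (K n) \<xi> \<in> E n \<epsilon>) (in_prob M)" if "\<epsilon> > 0" for \<epsilon>
  proof -
    have sp: "eventually (\<lambda>(n, \<xi>). sample (K n) \<xi> \<in> space (prodN (K n))) (in_prob M)"
      using measurable_space[OF restrict_S_measurable[OF KJ(3)]]
      by (intro eventually_in_prob_sequentially always_eventually) auto
    from tendsto_0_ennrealD[OF lim that] mean sp show ?thesis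
      by eventually_elim (auto simp: E_def)
  qed
  fix n :: nat and \<epsilon> :: real and d
  assume n: "n \<ge> 1" and \<epsilon>: "\<epsilon> > 0" and d: "d \<in> E n \<epsilon>"
  have J: "finite (J n)" using KJ(4)[of n] by (rule finite_subset) simp
  have cJ: "card (J n) \<le> n" using card_mono[OF _ KJ(4)[of n]] by simp
  have dh: "h n d \<in> borel_measurable N"
    using d h by (intro measurable_section_N) (auto simp: E_def)
  have "(\<integral>\<^sup>+y. ennreal (\<bar>\<Sum>i\<in>J n. h n d (y i)\<bar>\<^sup>2) \<partial>prodQ (J n)) =
    of_nat (card (J n)) * (\<integral>\<^sup>+s. ennreal ((h n d s)\<^sup>2) \<partial>Q)"
    unfolding power2_abs
  proof (rule nn_integral_sum_square[OF J dh])
    show "(\<integral>\<^sup>+s. ennreal ((h n d s)\<^sup>2) \<partial>Q) < \<infinity>"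
      using d le_less_trans[OF _ ennreal_less_top] by (auto simp: E_def)
    show "(\<integral>s. h n d s \<partial>Q) = 0" using d by (simp add: E_def)
  qed
  also have "\<dots> \<le> of_nat n * ennreal \<epsilon>"
    using cJ d by (intro mult_mono of_nat_mono) (auto simp: E_def)
  also have "\<dots> = ennreal (\<epsilon> * (sqrt (real n))\<^sup>2)"
    using \<epsilon> by (simp add: ennreal_mult'[symmetric] mult.commute ennreal_of_nat_eq_real_of_nat)
  finally show "(\<integral>\<^sup>+y. ennreal (\<bar>\<Sum>i\<in>J n. h n d (y i)\<bar>\<^sup>2) \<partial>prodQ (J n)) \<le>
    ennreal (\<epsilon> * (sqrt (real n))\<^sup>2)" .
qed auto

section \<open>Normalized sums, sample means and the central limit theorem\<close>

lemma bigO_p_normalized_sum: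
  assumes f: "f \<in> borel_measurable N"
    and fin: "integrable Q (\<lambda>s. (f s)\<^sup>2)" and mean: "(\<integral>s. f s \<partial>Q) = 0"
  shows "bigO_p M (\<lambda>n. 1) (\<lambda>n \<xi>. ennreal \<bar>(\<Sum>i=1..n. f (S i \<xi>)) / sqrt (real n)\<bar>)"
proof (rule bigO_p_second_moment)
  have fS[measurable]: "(\<lambda>\<xi>. f (S i \<xi>)) \<in> borel_measurable M" if "i \<ge> 1" for i
    using f S_measurable[OF that] by measurable
  show meas: "(\<lambda>\<xi>. (\<Sum>i=1..n. f (S i \<xi>)) / sqrt (real n)) \<in> borel_measurable M" for n
    by (intro borel_measurable_divide borel_measurable_sum fS) auto
  have fin2: "(\<integral>\<^sup>+s. ennreal ((f s)\<^sup>2) \<partial>Q) = ennreal (\<integral>s. (f s)\<^sup>2 \<partial>Q)"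
    using fin by (intro nn_integral_eq_integral) auto
  fix n :: nat assume n: "n \<ge> 1"
  have "(\<integral>\<^sup>+\<xi>. ennreal ((\<Sum>i=1..n. f (S i \<xi>))\<^sup>2) \<partial>M) =
    (\<integral>\<^sup>+\<xi>. ennreal ((\<Sum>i=1..n. f (sample {1..n} \<xi> i))\<^sup>2) \<partial>M)"
    by (intro nn_integral_cong) simp
  also have "\<dots> = (\<integral>\<^sup>+y. ennreal ((\<Sum>i=1..n. f (y i))\<^sup>2) \<partial>prodQ {1..n})"
  proof (subst distr_restrict_S[symmetric])
    have "(\<lambda>y. ennreal ((\<Sum>i=1..n. f (y i))\<^sup>2)) \<in> borel_measurable (prodN {1..n})"
      using f by measurable
    then show "(\<integral>\<^sup>+\<xi>. ennreal ((\<Sum>i=1..n. f (sample {1..n} \<xi> i))\<^sup>2) \<partial>M) =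
      (\<integral>\<^sup>+y. ennreal ((\<Sum>i=1..n. f (y i))\<^sup>2)
        \<partial>distr M (prodN {1..n}) (\<lambda>\<xi>. sample {1..n} \<xi>))"
      by (subst nn_integral_distr[OF restrict_S_measurable]) auto
  qed (use n in auto)
  also have "\<dots> = of_nat n * ennreal (\<integral>s. (f s)\<^sup>2 \<partial>Q)"
    using nn_integral_sum_square[of "{1..n}", OF _ f _ mean] by (simp add: fin2)
  finally have *: "(\<integral>\<^sup>+\<xi>. ennreal ((\<Sum>i=1..n. f (S i \<xi>))\<^sup>2) \<partial>M) = of_nat n * ennreal (\<integral>s. (f s)\<^sup>2 \<partial>Q)" .
  have "(\<integral>\<^sup>+\<xi>. ennreal (((\<Sum>i=1..n. f (S i \<xi>)) / sqrt (real n))\<^sup>2) \<partial>M) =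
    (\<integral>\<^sup>+\<xi>. ennreal (1 / real n) * ennreal ((\<Sum>i=1..n. f (S i \<xi>))\<^sup>2) \<partial>M)"
    by (intro nn_integral_cong) (simp add: power_divide ennreal_mult'[symmetric])
  also have "\<dots> = ennreal (1 / real n) * (of_nat n * ennreal (\<integral>s. (f s)\<^sup>2 \<partial>Q))"
    unfolding *[symmetric]
    by (rule nn_integral_cmult)
       (intro measurable_compose[OF _ measurable_ennreal] borel_measurable_power borel_measurable_sum fS, auto)
  also have "\<dots> = ennreal (\<integral>s. (f s)\<^sup>2 \<partial>Q)"
    using n by (simp add: mult.assoc[symmetric] ennreal_mult'[symmetric] ennreal_of_nat_eq_real_of_nat)
  finally show "(\<integral>\<^sup>+\<xi>. ennreal (((\<Sum>i=1..n. f (S i \<xi>)) / sqrt (real n))\<^sup>2) \<partial>M) \<le>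
    ennreal (\<integral>s. (f s)\<^sup>2 \<partial>Q)" by simp
qed

text \<open>A weak law read off from root-n boundedness: the centred mean is the normalized sum
  times \<open>1 / sqrt n\<close>.\<close>

lemma tendsto_mean:
  assumes f: "f \<in> borel_measurable N" and fin: "integrable Q (\<lambda>s. (f s)\<^sup>2)"
  shows "((\<lambda>(n, \<xi>). (\<Sum>i=1..n. f (S i \<xi>)) / real n) \<longlongrightarrow> (\<integral>s. f s \<partial>Q)) (in_prob M)"
proof -
  interpret Q: prob_space Q by (rule prob_space_Q)
  define c where "c = (\<integral>s. f s \<partial>Q)"
  have fQ: "f \<in> borel_measurable Q" using f by (rule measurable_Q)
  have int1: "integrable Q f" by (rule Q.square_integrable_imp_integrable[OF fQ fin])
  have int2: "integrable Q (\<lambda>s. (f s - c)\<^sup>2)" using int1 fin by (simp add: power2_diff)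
  have mean: "(\<integral>s. f s - c \<partial>Q) = 0" using int1 by (simp add: c_def Q.prob_space)
  have "bigO_p M (\<lambda>n. 1) (\<lambda>n \<xi>. ennreal \<bar>(\<Sum>i=1..n. f (S i \<xi>) - c) / sqrt (real n)\<bar>)"
    using f int2 mean by (intro bigO_p_normalized_sum) auto
  moreover have "((\<lambda>(n, \<xi>). 1 / sqrt (real n)) \<longlongrightarrow> 0) (in_prob M)"
    by (rule tendsto_in_prob_sequentially, rule tendsto_divide_0[OF tendsto_const], rule filterlim_at_top_imp_at_infinity, rule filterlim_compose[OF sqrt_at_top filterlim_real_sequentially])
  ultimately have "((\<lambda>(n, \<xi>). (\<Sum>i=1..n. f (S i \<xi>) - c) / sqrt (real n) * (1 / sqrt (real n))) \<longlongrightarrow> 0)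
    (in_prob M)"
    by (rule bigO_p_mult_real_tendsto_0)
  then have "((\<lambda>x. (case x of (n, \<xi>) \<Rightarrow> (\<Sum>i=1..n. f (S i \<xi>) - c) / sqrt (real n) * (1 / sqrt (real n))) + c)
      \<longlongrightarrow> 0 + c) (in_prob M)"
    by (intro tendsto_add tendsto_const)
  then have "((\<lambda>(n, \<xi>). (\<Sum>i=1..n. f (S i \<xi>)) / real n) \<longlongrightarrow> 0 + c) (in_prob M)"
  proof (rule Lim_transform_eventually)
    show "eventually (\<lambda>x. (case x of (n, \<xi>) \<Rightarrow> (\<Sum>i=1..n. f (S i \<xi>) - c) / sqrt (real n) *
        (1 / sqrt (real n))) + c = (case x of (n, \<xi>) \<Rightarrow> (\<Sum>i=1..n. f (S i \<xi>)) / real n)) (in_prob M)"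
      by (intro eventually_in_prob_sequentially eventually_sequentiallyI[of 1])
         (auto simp: sum_subtractf field_simps)
  qed
  then show ?thesis by (simp add: c_def)
qed

text \<open>Stating the limit through \<open>normal_law\<close> includes the degenerate one. If
  \<open>V = 0\<close>, the summands vanish almost surely; otherwise the central limit theorem for
  standardized sums is rescaled by evaluating it at \<open>sqrt V * t\<close>.\<close>

lemma char_normalized_sum:
  assumes f: "f \<in> borel_measurable N"
    and fin: "integrable Q (\<lambda>s. (f s)\<^sup>2)" and mean: "(\<integral>s. f s \<partial>Q) = 0"
  shows "(\<lambda>n. char (distr M borel (\<lambda>\<xi>. (\<Sum>i=1..n. f (S i \<xi>)) / sqrt (real n))) t)
    \<longlonglongrightarrow> char (normal_law 0 (\<integral>s. (f s)\<^sup>2 \<partial>Q)) t"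
proof -
  interpret Q: prob_space Q by (rule prob_space_Q)
  define V where "V = (\<integral>s. (f s)\<^sup>2 \<partial>Q)"
  have V0: "V \<ge> 0" by (simp add: V_def)
  \<comment> \<open>The central limit theorem sums over indices starting at 0, whereas the sample
    starts at 1.\<close>
  define X where "X i \<xi> = f (S (Suc i) \<xi>)" for i \<xi>
  have fS[measurable]: "(\<lambda>\<xi>. f (S i \<xi>)) \<in> borel_measurable M" if "i \<ge> 1" for i
    using f S_measurable[OF that] by measurable
  have X[measurable]: "X i \<in> borel_measurable M" for i
    unfolding X_def by (rule fS) simp
  have sumX: "(\<Sum>i=1..n. f (S i \<xi>)) = (\<Sum>i<n. X i \<xi>)" for n \<xi>
    unfolding X_def by (rule sum.reindex_bij_witness[of _ Suc "\<lambda>i. i - 1"]) auto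
  have fQ: "f \<in> borel_measurable Q" using f by (rule measurable_Q)
  have EX: "(\<integral>\<xi>. g (X i \<xi>) \<partial>M) = (\<integral>s. g (f s) \<partial>Q)" if [measurable]: "g \<in> borel_measurable borel"
    for g :: "real \<Rightarrow> real" and i
    unfolding X_def using f S_measurable[of "Suc i"]
    by (subst distr_S[of "Suc i", symmetric]) (auto simp: integral_distr)
  have IX: "integrable M (\<lambda>\<xi>. g (X i \<xi>)) \<longleftrightarrow> integrable Q (\<lambda>s. g (f s))" if [measurable]: "g \<in> borel_measurable borel"
    for g :: "real \<Rightarrow> real" and i
    unfolding X_def using f S_measurable[of "Suc i"]
    by (subst distr_S[of "Suc i", symmetric]) (auto simp: integrable_distr_eq)
  have char_law: "char (normal_law 0 V) t = char std_normal_distribution (sqrt V * t)"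
    unfolding normal_law_def char_def by (subst integral_distr) (auto simp: mult_ac)
  show ?thesis
  proof (cases "V = 0")
    case True
    have "AE s in Q. (f s)\<^sup>2 = 0"
      using integral_nonneg_eq_0_iff_AE[OF fin] True by (auto simp: V_def)
    then have f0: "AE s in Q. f s = 0" by simp
    have "AE \<xi> in M. X i \<xi> = 0" for i
    proof -
      have "AE s in distr M N (S (Suc i)). f s = 0" unfolding distr_S[of "Suc i", simplified] by (rule f0)
      then show ?thesis
        unfolding X_def using f S_measurable[of "Suc i"] by (subst (asm) AE_distr_iff) auto
    qed
    then have X0: "AE \<xi> in M. \<forall>i. X i \<xi> = 0" by (simp add: AE_all_countable)
    have "char (distr M borel (\<lambda>\<xi>. (\<Sum>i=1..n. f (S i \<xi>)) / sqrt (real n))) t = 1" for n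
    proof -
      have "char (distr M borel (\<lambda>\<xi>. (\<Sum>i=1..n. f (S i \<xi>)) / sqrt (real n))) t =
        (CLINT \<xi>|M. iexp (t * ((\<Sum>i<n. X i \<xi>) / sqrt (real n))))"
        unfolding char_def sumX by (subst integral_distr) auto
      also have "\<dots> = (CLINT \<xi>|M. 1)"
        using X0 by (intro integral_cong_AE) (auto elim!: AE_mp)
      finally show ?thesis by (simp add: prob_space)
    qed
    moreover have "char (normal_law 0 V) t = 1"
      using char_law True real_distribution.char_zero[OF real_dist_normal_dist] by simp
    ultimately show ?thesis by (simp add: V_def[symmetric])
  next
    case False
    with V0 have Vpos: "V > 0" by simp
    have "indep_vars (\<lambda>_. borel) X UNIV"
    proof -
      have "indep_vars (\<lambda>_. borel) (\<lambda>i \<xi>. f (S i \<xi>)) {1..}"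
        using indep f by (rule indep_vars_compose2)
      then have ind: "indep_sets (\<lambda>i. {(\<lambda>\<xi>. f (S i \<xi>)) -` A \<inter> space M |A. A \<in> sets borel}) {1..}"
        unfolding indep_vars_def2 by auto
      have "indep_sets (\<lambda>i. {X i -` A \<inter> space M |A. A \<in> sets borel}) UNIV"
      proof (rule indep_setsI)
        fix A :: "nat \<Rightarrow> 's set" and J :: "nat set"
        assume J: "J \<noteq> {}" "finite J" and A: "\<forall>j\<in>J. A j \<in> {X j -` B \<inter> space M |B. B \<in> sets borel}"
        have "prob (\<Inter>i\<in>Suc ` J. A (i - 1)) = (\<Prod>i\<in>Suc ` J. prob (A (i - 1)))"
          using J A by (intro indep_setsD[OF ind]) (auto simp: X_def[abs_def])
        then show "prob (\<Inter>j\<in>J. A j) = (\<Prod>j\<in>J. prob (A j))"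
          by (simp add: prod.reindex)
      qed auto
      then show ?thesis unfolding indep_vars_def2 by auto
    qed
    then have "weak_conv_m (\<lambda>n. distr M borel (\<lambda>\<xi>. (\<Sum>i<n. X i \<xi>) / sqrt (n * (sqrt V)\<^sup>2)))
      std_normal_distribution"
    proof (rule central_limit_theorem_zero_mean)
      show EX0: "expectation (X n) = 0" for n using EX[of "\<lambda>x. x"] mean by simp
      show "sqrt V > 0" using Vpos by simp
      show "integrable M (\<lambda>\<xi>. (X n \<xi>)\<^sup>2)" for n using IX[of "\<lambda>x. x\<^sup>2"] fin by simp
      show "variance (X n) = (sqrt V)\<^sup>2" for n
        using EX[of "\<lambda>x. x\<^sup>2" n] Vpos by (simp add: EX0 V_def)
      show "distr M borel (X n) = distr Q borel f" for n
        unfolding X_def using f S_measurable[of "Suc n"]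
        by (subst distr_S[of "Suc n", symmetric]) (auto simp: distr_distr comp_def)
    qed
    from levy_continuity1[OF _ _ this, of "sqrt V * t"]
    have "(\<lambda>n. char (distr M borel (\<lambda>\<xi>. (\<Sum>i<n. X i \<xi>) / sqrt (n * (sqrt V)\<^sup>2))) (sqrt V * t))
      \<longlonglongrightarrow> char std_normal_distribution (sqrt V * t)"
      by (auto intro!: real_distribution_distr real_dist_normal_dist)
    moreover have "char (distr M borel (\<lambda>\<xi>. (\<Sum>i<n. X i \<xi>) / sqrt (n * (sqrt V)\<^sup>2))) (sqrt V * t) =
      char (distr M borel (\<lambda>\<xi>. (\<Sum>i=1..n. f (S i \<xi>)) / sqrt (real n))) t" for n
      unfolding char_def sumX using Vpos
      by (subst (1 2) integral_distr) (auto simp: real_sqrt_mult field_simps intro!: Bochner_Integration.integral_cong)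
    ultimately show ?thesis by (simp add: V_def[symmetric] char_law)
  qed
qed

end

section \<open>Norms on the covariate space\<close>

text \<open>The case distinction in the norm fits: a square that is not integrable has an infinite
  non-negative integral. Squared norms can thus be manipulated without finiteness
  conditions.\<close>

lemma L2_norm_square:
  assumes [measurable]: "f \<in> borel_measurable F"
  shows "(L2_norm F f)\<^sup>2 = (\<integral>\<^sup>+x. ennreal ((f x)\<^sup>2) \<partial>F)"
proof (cases "integrable F (\<lambda>x. (f x)\<^sup>2)")
  case True
  have "(L2_norm F f)\<^sup>2 = ennreal (\<integral>x. (f x)\<^sup>2 \<partial>F)"
    using True by (simp add: L2_norm_def ennreal_power)
  then show ?thesis using True by (simp add: nn_integral_eq_integral)
next
  case False
  then have "(\<integral>\<^sup>+x. ennreal ((f x)\<^sup>2) \<partial>F) = \<infinity>"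
    by (rule contrapos_np) (intro integrableI_bounded, auto simp: less_top)
  with False show ?thesis by (simp add: L2_norm_def power2_eq_square ennreal_top_mult)
qed

lemma power2_le_power2_ennrealD:
  fixes a b :: ennreal
  assumes "a\<^sup>2 \<le> b\<^sup>2"
  shows "a \<le> b"
proof (rule ccontr)
  assume "\<not> a \<le> b"
  then have ba: "b < a" by simp
  have "b * b < a * a"
  proof (cases "a = \<top>")
    case True
    then show ?thesis using ba by (cases b) (auto simp: ennreal_mult_top ennreal_mult_less_top)
  next
    case False
    with ba obtain x y where "a = ennreal x" "b = ennreal y" "0 \<le> x" "0 \<le> y"
      by (cases a; cases b) auto
    with ba show ?thesis
      by (simp add: ennreal_mult[symmetric] ennreal_less_iff mult_strict_mono')
  qed
  with assms show False by (simp add: power2_eq_square)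
qed

lemma nn_integral_mult_le_L2:
  assumes [measurable]: "f \<in> borel_measurable F" "g \<in> borel_measurable F"
  shows "(\<integral>\<^sup>+x. ennreal \<bar>f x * g x\<bar> \<partial>F) \<le> L2_norm F f * L2_norm F g"
proof (rule power2_le_power2_ennrealD)
  have "(\<integral>\<^sup>+x. ennreal \<bar>f x\<bar> * ennreal \<bar>g x\<bar> \<partial>F)\<^sup>2 \<le>
    (\<integral>\<^sup>+x. (ennreal \<bar>f x\<bar>)\<^sup>2 \<partial>F) * (\<integral>\<^sup>+x. (ennreal \<bar>g x\<bar>)\<^sup>2 \<partial>F)"
    by (rule Cauchy_Schwarz_nn_integral) auto
  then show "(\<integral>\<^sup>+x. ennreal \<bar>f x * g x\<bar> \<partial>F)\<^sup>2 \<le> (L2_norm F f * L2_norm F g)\<^sup>2"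
    by (simp add: power_mult_distrib L2_norm_square abs_mult ennreal_mult ennreal_power)
qed

text \<open>A point outside the support has a null open neighbourhood, hence a null basic one, and
  there are only countably many basic sets.\<close>

lemma AE_in_msupport:
  fixes F :: "'a::second_countable_topology measure"
  assumes F: "sets F = sets borel"
  shows "AE x in F. x \<in> msupport F"
proof -
  obtain B :: "'a set set" where B: "countable B" "topological_basis B"
    using ex_countable_basis by auto
  let ?B = "{b \<in> B. emeasure F b = 0}"
  have open_sets: "b \<in> sets F" if "b \<in> B" for b
    using topological_basis_open[OF B(2) that] F by auto
  have "(\<Union>b\<in>?B. b) \<in> null_sets F"
    using B(1) open_sets by (intro null_sets_UN') (auto intro: countable_subset[of ?B B])
  then have "AE x in F. x \<notin> (\<Union>b\<in>?B. b)" by (rule AE_not_in)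
  then show ?thesis
  proof eventually_elim
    case (elim x)
    show ?case
      unfolding msupport_def
    proof safe
      fix U :: "'a set" assume U: "open U" "x \<in> U"
      then obtain b where b: "b \<in> B" "x \<in> b" "b \<subseteq> U"
        using topological_basisE[OF B(2)] by metis
      have "emeasure F b \<noteq> 0" using b elim by auto
      moreover have "emeasure F b \<le> emeasure F U"
        using b U F by (intro emeasure_mono) auto
      ultimately show "0 < emeasure F U" by (metis not_gr_zero le_zero_eq)
    qed
  qed
qed

lemma AE_le_sup_norm:
  fixes F :: "'a::second_countable_topology measure"
  assumes "sets F = sets borel"
  shows "AE x in F. ennreal \<bar>f x\<bar> \<le> sup_norm (msupport F) f"
  using AE_in_msupport[OF assms] by eventually_elim (auto simp: sup_norm_def intro: SUP_upper)

section \<open>Conditioning\<close>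

text \<open>As a density, conditioning on an event is multiplication by an indicator and a constant,
  which reduces integrals under the conditional law of any group to integrals under
  \<open>M\<close>.\<close>

lemma (in prob_space) given_eq_density:
  assumes [measurable]: "Measurable.pred M A" and pos: "prob {u \<in> space M. A u} > 0"
  shows "given M A = density M (\<lambda>u. ennreal (of_bool (A u) / prob {u \<in> space M. A u}))"
  unfolding given_def uniform_measure_def
proof (rule density_cong)
  show "AE u in M. indicator {u \<in> space M. A u} u / emeasure M {u \<in> space M. A u} =
    ennreal (of_bool (A u) / prob {u \<in> space M. A u})"
    using pos by (intro AE_I2) (auto simp: emeasure_eq_measure divide_ennreal[symmetric] split: split_indicator)
qed measurable

lemma (in prob_space)
  fixes f :: "'a \<Rightarrow> real"
  assumes A[measurable]: "Measurable.pred M A" and pos: "prob {u \<in> space M. A u} > 0"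
    and f[measurable]: "f \<in> borel_measurable M"
  shows integrable_given: "integrable (given M A) f \<longleftrightarrow> integrable M (\<lambda>u. of_bool (A u) * f u)"
    and integral_given: "(\<integral>u. f u \<partial>given M A) = (\<integral>u. of_bool (A u) * f u \<partial>M) / prob {u \<in> space M. A u}"
proof -
  let ?p = "prob {u \<in> space M. A u}"
  have eq: "(\<lambda>u. (of_bool (A u) / ?p) *\<^sub>R f u) = (\<lambda>u. (1 / ?p) * (of_bool (A u) * f u))" by auto
  show "integrable (given M A) f \<longleftrightarrow> integrable M (\<lambda>u. of_bool (A u) * f u)"
  proof -
    have "integrable (given M A) f \<longleftrightarrow> integrable M (\<lambda>u. (of_bool (A u) / ?p) *\<^sub>R f u)"
      unfolding given_eq_density[OF A pos] by (rule integrable_density) auto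
    also have "\<dots> \<longleftrightarrow> integrable M (\<lambda>u. of_bool (A u) * f u)"
      unfolding eq integrable_mult_left_iff using pos by simp
    finally show ?thesis .
  qed
  show "(\<integral>u. f u \<partial>given M A) = (\<integral>u. of_bool (A u) * f u \<partial>M) / ?p"
    unfolding given_eq_density[OF A pos] using pos
    by (subst integral_density) (simp_all only: eq integral_mult_right_zero, auto)
qed

lemma (in prob_space) nn_integral_given:
  assumes A[measurable]: "Measurable.pred M A" and pos: "prob {u \<in> space M. A u} > 0"
    and f[measurable]: "f \<in> borel_measurable M"
  shows "(\<integral>\<^sup>+u. of_bool (A u) * f u \<partial>M) = ennreal (prob {u \<in> space M. A u}) * (\<integral>\<^sup>+u. f u \<partial>given M A)"
proof -
  let ?p = "prob {u \<in> space M. A u}"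
  have "ennreal ?p * (\<integral>\<^sup>+u. f u \<partial>given M A) =
    (\<integral>\<^sup>+u. ennreal ?p * (ennreal (of_bool (A u) / ?p) * f u) \<partial>M)"
    unfolding given_eq_density[OF A pos]
    by (simp add: nn_integral_density nn_integral_cmult)
  also have "\<dots> = (\<integral>\<^sup>+u. of_bool (A u) * f u \<partial>M)"
    using pos by (intro nn_integral_cong) (simp add: mult.assoc[symmetric] ennreal_mult'[symmetric])
  finally show ?thesis by simp
qed

lemma (in prob_space) AE_given:
  assumes A[measurable]: "Measurable.pred M A" and pos: "prob {u \<in> space M. A u} > 0"
  shows "(AE u in given M A. Q u) \<longleftrightarrow> (AE u in M. A u \<longrightarrow> Q u)"
  unfolding given_eq_density[OF A pos] using pos
  by (subst AE_density) (auto simp: zero_less_divide_iff)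

lemma (in prob_space) prob_space_given:
  assumes A[measurable]: "Measurable.pred M A" and pos: "prob {u \<in> space M. A u} > 0"
  shows "prob_space (given M A)"
  unfolding given_def using pos by (intro prob_space_uniform_measure) (auto simp: emeasure_eq_measure)

lemma sets_given[measurable_cong, simp]: "sets (given M A) = sets M"
  and space_given[simp]: "space (given M A) = space M"
  by (simp_all add: given_def)

lemma gen_by_given[simp]: "gen_by (given M A) X = gen_by M X"
  by (simp add: gen_by_def)

lemma sets_gen_by: "sets (gen_by M X) = {X -` C \<inter> space M | C. C \<in> sets borel}"
  unfolding gen_by_def by (rule sets_vimage_algebra2) simp

lemma space_gen_by[simp]: "space (gen_by M X) = space M"
  by (simp add: gen_by_def)

lemma subalgebra_gen_by: "X \<in> borel_measurable M \<Longrightarrow> subalgebra M (gen_by M X)"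
  unfolding subalgebra_def by (auto simp: sets_gen_by)

lemma measurable_gen_by: "X \<in> measurable (gen_by M X) borel"
  unfolding gen_by_def by (rule measurable_vimage_algebra1) simp

lemma finite_measure_subalgebra_gen_by:
  "prob_space M \<Longrightarrow> X \<in> borel_measurable M \<Longrightarrow> finite_measure_subalgebra M (gen_by M X)"
  unfolding finite_measure_subalgebra_def finite_measure_subalgebra_axioms_def
  by (auto intro: subalgebra_gen_by prob_space.finite_measure)

text \<open>The characterization of a conditional expectation by integrals over events of
  \<open>X\<close>, moved from \<open>given M A\<close> back to \<open>M\<close>. In this form
  different groups can be summed and compared.\<close>

lemma (in prob_space) given_cond_exp:
  fixes Z :: "'a \<Rightarrow> real"
  assumes A[measurable]: "Measurable.pred M A" and pos: "prob {u \<in> space M. A u} > 0"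
    and X[measurable]: "X \<in> borel_measurable M"
    and Z[measurable]: "Z \<in> borel_measurable M" and int: "integrable M (\<lambda>u. of_bool (A u) * Z u)"
  defines "R \<equiv> real_cond_exp (given M A) (gen_by M X) Z"
  shows "integrable M (\<lambda>u. of_bool (A u) * R u)"
    and "C \<in> sets (gen_by M X) \<Longrightarrow>
      (\<integral>u. indicator C u * (of_bool (A u) * R u) \<partial>M) = (\<integral>u. indicator C u * (of_bool (A u) * Z u) \<partial>M)"
proof -
  interpret g: prob_space "given M A" by (rule prob_space_given[OF A pos])
  interpret finite_measure_subalgebra "given M A" "gen_by M X"
    using finite_measure_subalgebra_gen_by[OF g.prob_space_axioms, of X] by simp
  have intg: "integrable (given M A) Z" using int by (simp add: integrable_given[OF A pos])
  have R[measurable]: "R \<in> borel_measurable M"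
    unfolding R_def using borel_measurable_cond_exp2[of "given M A" "gen_by M X" Z] by simp
  show "integrable M (\<lambda>u. of_bool (A u) * R u)"
    using real_cond_exp_int(1)[OF intg] integrable_given[OF A pos R] unfolding R_def by simp
  assume C: "C \<in> sets (gen_by M X)"
  then have [measurable]: "C \<in> sets M" using subalgebra_gen_by[OF X] by (auto simp: subalgebra_def)
  from real_cond_exp_intA[OF intg C]
  have "(\<integral>u. indicator C u * R u \<partial>given M A) = (\<integral>u. indicator C u * Z u \<partial>given M A)"
    unfolding set_lebesgue_integral_def R_def by simp
  then show "(\<integral>u. indicator C u * (of_bool (A u) * R u) \<partial>M) = (\<integral>u. indicator C u * (of_bool (A u) * Z u) \<partial>M)"
    using pos by (simp add: integral_given[OF A pos] mult.left_commute)
qed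

text \<open>Composing \<open>U\<close> with \<open>f\<close> and \<open>T\<close> with an indicator
  gives two real random variables whose generated sigma-algebras are contained in the independent
  ones, so the product rule for expectations applies.\<close>

lemma (in prob_space) integral_indep_rv:
  fixes f :: "'b \<Rightarrow> real"
  assumes ind: "indep_rv M N U (count_space UNIV) T"
    and f[measurable]: "f \<in> borel_measurable N" and int: "integrable M (\<lambda>u. f (U u))"
  shows "integrable M (\<lambda>u. f (U u) * of_bool (T u = s))"
    and "(\<integral>u. f (U u) * of_bool (T u = s) \<partial>M) = (\<integral>u. f (U u) \<partial>M) * prob {u \<in> space M. T u = s}"
proof -
  have U[measurable]: "U \<in> measurable M N" and T[measurable]: "T \<in> measurable M (count_space UNIV)"
    using ind by (auto simp: indep_rv_def)
  have iv: "indep_var borel (\<lambda>u. f (U u)) borel (\<lambda>u. of_bool (T u = s) :: real)"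
    unfolding indep_var_eq
  proof (intro conjI)
    have "sets (vimage_algebra (space M) (\<lambda>u. f (U u)) borel) \<subseteq> sets (vimage_algebra (space M) U N)"
      using measurable_space[OF U]
      by (intro sets_image_in_sets measurable_compose[OF measurable_vimage_algebra1 f]) auto
    moreover have "sets (vimage_algebra (space M) (\<lambda>u. of_bool (T u = s) :: real) borel) \<subseteq>
        sets (vimage_algebra (space M) T (count_space UNIV))"
      by (intro sets_image_in_sets measurable_compose[OF measurable_vimage_algebra1[of T]]) auto
    ultimately have "indep_set (sets (vimage_algebra (space M) (\<lambda>u. f (U u)) borel))
        (sets (vimage_algebra (space M) (\<lambda>u. of_bool (T u = s) :: real) borel))"
      using ind unfolding indep_rv_def indep_set_def
      by (elim conjE indep_sets_mono_sets) (auto split: bool.split)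
    then show "indep_set (sigma_sets (space M) {(\<lambda>u. f (U u)) -` A \<inter> space M |A. A \<in> sets borel})
        (sigma_sets (space M) {(\<lambda>u. of_bool (T u = s) :: real) -` A \<inter> space M |A. A \<in> sets borel})"
      by (simp only: sets_vimage_algebra)
  qed auto
  have int2: "integrable M (\<lambda>u. of_bool (T u = s) :: real)"
    by (rule integrable_const_bound[where B=1]) auto
  show "integrable M (\<lambda>u. f (U u) * of_bool (T u = s))"
    using indep_var_integrable[OF iv int int2] .
  have "(\<integral>u. of_bool (T u = s) \<partial>M) = (\<integral>u. (indicator {u \<in> space M. T u = s} u :: real) \<partial>M)"
    by (intro Bochner_Integration.integral_cong) auto
  then have "(\<integral>u. of_bool (T u = s) \<partial>M) = prob {u \<in> space M. T u = s}"
    by simp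
  then show "(\<integral>u. f (U u) * of_bool (T u = s) \<partial>M) = (\<integral>u. f (U u) \<partial>M) * prob {u \<in> space M. T u = s}"
    using indep_var_lebesgue_integral[OF iv int int2] by simp
qed

section \<open>Identification\<close>

text \<open>The derived quantities \<open>FX\<close>, \<open>lam\<close>, \<open>pi1\<close>,
  \<open>\<theta>\<close> and \<open>Q\<close> are parameters pinned down by equations, which lets
  the constants of the final statement be passed in directly.\<close>

locale rc_population = prob_space P for P :: "'p measure" +
  fixes NG \<T> :: nat
    and Y1 Y0 :: "nat \<Rightarrow> 'p \<Rightarrow> real" and G T :: "'p \<Rightarrow> nat"
    and X :: "'p \<Rightarrow> 'x::euclidean_space"
    and p \<mu> \<omega> :: "nat \<Rightarrow> 'x \<Rightarrow> real"
    and FX :: "'x measure" and lam :: "nat \<Rightarrow> real" and pi1 \<theta> :: real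
    and Q :: "'x obs measure"
  assumes FX_def: "FX = distr P borel X"
    and lam_def: "lam = (\<lambda>t. measure P {u \<in> space P. T u = t})"
    and pi1_def: "pi1 = measure P {u \<in> space P. G u = 1}"
    and \<theta>_def: "\<theta> = (\<integral>u. (Y1 \<T> u - Y0 \<T> u) \<partial>(given P (\<lambda>u. G u = 1)))"
    and Q_def: "Q = distr P obs_measure (rc_obs \<T> Y1 Y0 G T X)"
    and dims: "NG \<ge> 1" "\<T> \<ge> 2"
    and outcomes: "\<And>t. t \<in> {1..\<T>} \<Longrightarrow> Y1 t \<in> borel_measurable P \<and> Y0 t \<in> borel_measurable P"
    and groups: "G \<in> P \<rightarrow>\<^sub>M count_space UNIV" "\<And>u. u \<in> space P \<Longrightarrow> G u \<in> {1..NG + 1}"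
    and periods: "T \<in> P \<rightarrow>\<^sub>M count_space UNIV"
    and covariates: "X \<in> borel_measurable P"
    and moments: "integrable P (Y0 \<T>)" "integrable P (Y0 (\<T> - 1))"
      "integrable P (\<lambda>u. of_bool (G u = 1) * Y1 \<T> u)"
    and propensity: "\<And>g. g \<in> {1..NG + 1} \<Longrightarrow> regression_fun P X (\<lambda>u. of_bool (G u = g)) (p g)"
    and mu: "\<And>t. t \<in> {\<T> - 1, \<T>} \<Longrightarrow>
      regression_fun (given P (\<lambda>u. G u \<noteq> 1)) X
        (\<lambda>u. of_bool (T u = t) * observed_outcome \<T> Y1 Y0 G T u) (\<mu> t)"
    and mu_L2: "\<And>t. t \<in> {\<T> - 1, \<T>} \<Longrightarrow> L2_norm FX (\<mu> t) < \<infinity>"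
    and no_anticipation: "\<And>t. t \<in> {1..\<T> - 1} \<Longrightarrow> AE u in P. Y1 t u = Y0 t u"
    and overlap: "\<And>g. g \<in> {1..NG + 1} \<Longrightarrow> AE u in P. p g (X u) > 0"
    and parallel_trends: "\<And>g. g \<in> {2..NG + 1} \<Longrightarrow> AE u in P.
      real_cond_exp (given P (\<lambda>v. G v = 1)) (gen_by P X) (\<lambda>v. Y0 \<T> v - Y0 (\<T> - 1) v) u =
      real_cond_exp (given P (\<lambda>v. G v = g)) (gen_by P X) (\<lambda>v. Y0 \<T> v - Y0 (\<T> - 1) v) u"
    and time_invariance: "indep_rv P
      ((\<Pi>\<^sub>M t\<in>{1..\<T>}. borel) \<Otimes>\<^sub>M borel \<Otimes>\<^sub>M count_space UNIV)
      (\<lambda>u. (\<lambda>t\<in>{1..\<T>}. period_outcome Y1 Y0 G t u, X u, G u))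
      (count_space UNIV) T"
    and lam_pos: "\<And>t. t \<in> {1..\<T>} \<Longrightarrow> lam t > 0"
    and omega: "\<And>g. g \<in> {2..NG + 1} \<Longrightarrow> \<omega> g \<in> borel_measurable borel"
    and bounded_residual: "\<And>g. g \<in> {1..NG + 1} \<Longrightarrow> \<exists>C::real. AE u in P.
      nn_cond_exp (given P (\<lambda>v. G v = g)) (gen_by P X)
        (\<lambda>v. ennreal ((scaled_residual \<T> \<mu> lam (rc_obs \<T> Y1 Y0 G T X v))\<^sup>2)) u \<le> ennreal C"
    and bounded_inverse_p: "\<And>g. g \<in> {1..NG + 1} \<Longrightarrow> \<exists>C. AE x in FX. \<bar>1 / p g x\<bar> \<le> C"
    and bounded_omega: "\<And>g. g \<in> {1..NG + 1} \<Longrightarrow> \<exists>C. AE x in FX. \<bar>\<omega> g x\<bar> \<le> C"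
begin

abbreviation "S \<equiv> rc_obs \<T> Y1 Y0 G T X"
abbreviation "F \<equiv> gen_by P X"
abbreviation "B \<equiv> scaled_residual \<T> \<mu> lam"
abbreviation "Yobs \<equiv> observed_outcome \<T> Y1 Y0 G T"
abbreviation "Yper \<equiv> period_outcome Y1 Y0 G"

declare One_nat_def[simp del]

lemma periods_in: "\<T> \<in> {1..\<T>}" "\<T> - 1 \<in> {1..\<T>}" "\<T> - 1 \<in> {1..\<T> - 1}" "\<T> \<noteq> \<T> - 1"
  using dims by auto

lemma Y_measurable[measurable]: "t \<in> {1..\<T>} \<Longrightarrow> Y1 t \<in> borel_measurable P" "t \<in> {1..\<T>} \<Longrightarrow> Y0 t \<in> borel_measurable P"
  using outcomes by auto

declare groups(1)[measurable] periods[measurable] covariates[measurable] omega[measurable]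

lemma Y_T_measurable[measurable]:
  "Y1 \<T> \<in> borel_measurable P" "Y0 \<T> \<in> borel_measurable P"
  "Y1 (\<T> - 1) \<in> borel_measurable P" "Y0 (\<T> - 1) \<in> borel_measurable P"
  using periods_in by (auto intro: Y_measurable)

lemma p_measurable[measurable]: "g \<in> {1..NG + 1} \<Longrightarrow> p g \<in> borel_measurable borel"
  using propensity by (auto simp: regression_fun_def)

lemma mu_measurable: "t \<in> {\<T> - 1, \<T>} \<Longrightarrow> \<mu> t \<in> borel_measurable borel"
  using mu by (auto simp: regression_fun_def)

lemma mu_T_measurable[measurable]: "\<mu> \<T> \<in> borel_measurable borel" "\<mu> (\<T> - 1) \<in> borel_measurable borel"
  by (simp_all add: mu_measurable)

lemma period_outcome_measurable[measurable]:
  "t \<in> {1..\<T>} \<Longrightarrow> Yper t \<in> borel_measurable P"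
  unfolding period_outcome_def by measurable

lemma observed_outcome_measurable[measurable]: "Yobs \<in> borel_measurable P"
  unfolding observed_outcome_def by (intro borel_measurable_sum) measurable

lemma S_measurable[measurable]: "S \<in> P \<rightarrow>\<^sub>M obs_measure"
  unfolding rc_obs_def obs_measure_def by measurable

lemma B_measurable[measurable]: "B \<in> borel_measurable obs_measure"
  unfolding scaled_residual_def obs_measure_def by measurable

lemma sets_FX[measurable_cong, simp]: "sets FX = sets borel"
  by (simp add: FX_def)

lemma space_FX[simp]: "space FX = UNIV"
  by (simp add: FX_def)

lemma prob_space_FX: "prob_space FX"
  unfolding FX_def by (rule prob_space_distr) simp

lemma AE_FX: "{x. R x} \<in> sets borel \<Longrightarrow> (AE x in FX. R x) \<longleftrightarrow> (AE u in P. R (X u))"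
  unfolding FX_def by (subst AE_distr_iff) auto

lemma AE_FX_D: "AE x in FX. R x \<Longrightarrow> AE u in P. R (X u)"
  unfolding FX_def by (rule AE_distrD[OF covariates])

lemma integral_Q: "f \<in> borel_measurable obs_measure \<Longrightarrow> (\<integral>s. f s \<partial>Q) = (\<integral>u. f (S u) \<partial>P)" for f :: "'x obs \<Rightarrow> real"
  unfolding Q_def by (rule integral_distr) auto

lemma nn_integral_Q: "f \<in> borel_measurable obs_measure \<Longrightarrow> (\<integral>\<^sup>+s. f s \<partial>Q) = (\<integral>\<^sup>+u. f (S u) \<partial>P)"
  unfolding Q_def by (rule nn_integral_distr) auto

lemma integrable_Q: "f \<in> borel_measurable obs_measure \<Longrightarrow> integrable Q f \<longleftrightarrow> integrable P (\<lambda>u. f (S u))" for f :: "'x obs \<Rightarrow> real"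
  unfolding Q_def by (rule integrable_distr_eq) auto

sublocale sub: finite_measure_subalgebra P F
  using finite_measure_subalgebra_gen_by[OF prob_space_axioms covariates] .

lemma X_F[measurable]: "X \<in> measurable F borel"
  by (rule measurable_gen_by)

lemma set_F_measurable: "C \<in> sets F \<Longrightarrow> C \<in> sets P"
  using sub.subalg by (auto simp: subalgebra_def)

section \<open>Propensity scores and group probabilities\<close>

lemma integral_group:
  assumes g: "g \<in> {1..NG + 1}" and f[measurable]: "f \<in> borel_measurable borel"
    and int: "integrable FX f"
  shows "(\<integral>u. of_bool (G u = g) * f (X u) \<partial>P) = (\<integral>x. p g x * f x \<partial>FX)"
proof -
  have intP: "integrable P (\<lambda>u. f (X u))" using int by (simp add: FX_def integrable_distr_eq)
  have "(\<integral>u. of_bool (G u = g) * f (X u) \<partial>P) = (\<integral>u. f (X u) * of_bool (G u = g) \<partial>P)"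
    by (simp add: mult.commute)
  also have "\<dots> = (\<integral>u. f (X u) * real_cond_exp P F (\<lambda>u. of_bool (G u = g)) u \<partial>P)"
  proof (rule sub.real_cond_exp_intg(2)[symmetric])
    show "integrable P (\<lambda>u. f (X u) * of_bool (G u = g))"
      using intP by (rule Bochner_Integration.integrable_bound) (auto intro!: AE_I2)
  qed measurable
  also have "\<dots> = (\<integral>u. p g (X u) * f (X u) \<partial>P)"
    using propensity[OF g] g unfolding regression_fun_def
    by (intro integral_cong_AE) (auto elim!: AE_mp simp: mult.commute)
  also have "\<dots> = (\<integral>x. p g x * f x \<partial>FX)"
    unfolding FX_def using g by (subst integral_distr) auto
  finally show ?thesis .
qed

lemma p_bounds:
  assumes g: "g \<in> {1..NG + 1}"
  shows "AE x in FX. 0 < p g x \<and> p g x \<le> 1"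
proof -
  have "AE u in P. real_cond_exp P F (\<lambda>u. of_bool (G u = g)) u \<le> 1"
    by (rule sub.real_cond_exp_le_c) (auto intro!: integrable_const_bound[where B=1])
  then have "AE u in P. p g (X u) \<le> 1"
    using propensity[OF g] unfolding regression_fun_def by auto
  then have "AE u in P. 0 < p g (X u) \<and> p g (X u) \<le> 1" using overlap[OF g] by auto
  then show ?thesis using g by (subst AE_FX) (auto intro!: pred_intros_logic)
qed

text \<open>The integral of \<open>p g\<close> is the probability of the group; were it 0,
  \<open>p g\<close> would vanish almost everywhere, against overlap. Positivity makes each
  conditional law of a group a probability measure.\<close>

lemma group_prob_pos:
  assumes g: "g \<in> {1..NG + 1}"
  shows "prob {u \<in> space P. G u = g} > 0"
proof (rule ccontr)
  assume "\<not> prob {u \<in> space P. G u = g} > 0"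
  then have 0: "prob {u \<in> space P. G u = g} = 0" by (simp add: not_less measure_le_0_iff)
  interpret FX: prob_space FX by (rule prob_space_FX)
  have p1: "integrable FX (p g)"
    using p_bounds[OF g] g by (intro FX.integrable_const_bound[where B=1]) auto
  have "(\<integral>x. p g x \<partial>FX) = (\<integral>u. of_bool (G u = g) \<partial>P)"
    using integral_group[OF g, of "\<lambda>_. 1"] by simp
  also have "\<dots> = (\<integral>u. indicator {u \<in> space P. G u = g} u \<partial>P)"
    by (intro Bochner_Integration.integral_cong) auto
  also have "\<dots> = 0" using 0 by simp
  finally have "(\<integral>x. p g x \<partial>FX) = 0" .
  moreover have "AE x in FX. 0 \<le> p g x" using p_bounds[OF g] by auto
  ultimately have "AE x in FX. p g x = 0"
    using integral_nonneg_eq_0_iff_AE[OF p1] by simp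
  with p_bounds[OF g] have "AE x in FX. False" by eventually_elim simp
  then show False using FX.AE_False by simp
qed

lemma pi1_pos: "pi1 > 0"
  using group_prob_pos[of 1] by (simp add: pi1_def)

lemma not_treated_prob_pos: "prob {u \<in> space P. G u \<noteq> 1} > 0"
proof -
  have "0 < prob {u \<in> space P. G u = 2}" using group_prob_pos[of 2] dims by simp
  also have "\<dots> \<le> prob {u \<in> space P. G u \<noteq> 1}" by (intro finite_measure_mono) auto
  finally show ?thesis .
qed

lemma uniform_bound:
  assumes "\<And>h. h \<in> {2..NG + 1} \<Longrightarrow> \<exists>C. AE x in FX. \<bar>f h x\<bar> \<le> C"
  shows "\<exists>C\<ge>0::real. \<forall>h\<in>{2..NG + 1}. AE x in FX. \<bar>f h x\<bar> \<le> C"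
proof -
  obtain c where c: "\<And>h. h \<in> {2..NG + 1} \<Longrightarrow> AE x in FX. \<bar>f h x\<bar> \<le> c h" using assms by metis
  define C where "C = (\<Sum>h=2..NG+1. \<bar>c h\<bar>)"
  have "AE x in FX. \<bar>f h x\<bar> \<le> C" if h: "h \<in> {2..NG + 1}" for h
    using c[OF h]
  proof eventually_elim
    case (elim x)
    also have "c h \<le> \<bar>c h\<bar>" by simp
    also have "\<dots> \<le> C" unfolding C_def using h by (intro member_le_sum) auto
    finally show ?case .
  qed
  moreover have "C \<ge> 0" unfolding C_def by (intro sum_nonneg) auto
  ultimately show ?thesis by blast
qed

lemma ratio_bounded: "\<exists>C\<ge>0. \<forall>h\<in>{2..NG + 1}. AE x in FX. \<bar>p 1 x / p h x\<bar> \<le> C"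
proof (rule uniform_bound)
  fix h assume "h \<in> {2..NG + 1}"
  then have "h \<in> {1..NG + 1}" by auto
  from bounded_inverse_p[OF this] obtain c where c: "AE x in FX. \<bar>1 / p h x\<bar> \<le> c" by blast
  have "AE x in FX. 0 < p 1 x \<and> p 1 x \<le> 1" by (rule p_bounds) simp
  with c have "AE x in FX. \<bar>p 1 x / p h x\<bar> \<le> \<bar>c\<bar>"
  proof eventually_elim
    case (elim x)
    have "\<bar>p 1 x / p h x\<bar> = \<bar>p 1 x\<bar> * \<bar>1 / p h x\<bar>" by (simp add: abs_mult)
    also have "\<dots> \<le> 1 * \<bar>c\<bar>" using elim by (intro mult_mono) auto
    finally show ?case by simp
  qed
  then show "\<exists>C. AE x in FX. \<bar>p 1 x / p h x\<bar> \<le> C" by blast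
qed

lemma omega_bounded: "\<exists>C\<ge>0. \<forall>h\<in>{2..NG + 1}. AE x in FX. \<bar>\<omega> h x\<bar> \<le> C"
  by (intro uniform_bound bounded_omega) auto

section \<open>Observed outcomes under random sampling periods\<close>

lemma period_times_outcome:
  "s \<in> {1..\<T>} \<Longrightarrow> of_bool (T u = s) * Yobs u = of_bool (T u = s) * Yper s u"
  unfolding observed_outcome_def
  by (cases "T u = s") (auto simp: of_bool_def if_distrib[of "\<lambda>x. x * _"] sum.delta cong: if_cong)

text \<open>In period \<open>\<T>\<close> the treated and the untreated part are integrable
  separately. In period \<open>\<T> - 1\<close> no anticipation replaces \<open>Y1\<close> by
  \<open>Y0\<close> up to a null set, so only the moment of \<open>Y0\<close> enters.\<close>

lemma integrable_period_outcome:
  assumes "s \<in> {\<T> - 1, \<T>}"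
  shows "integrable P (Yper s)"
proof (cases "s = \<T>")
  case True
  have "integrable P (\<lambda>u. of_bool (G u = 1) * Y0 \<T> u)"
    using moments(1) by (rule Bochner_Integration.integrable_bound) (auto intro!: AE_I2)
  then have "integrable P (\<lambda>u. of_bool (G u = 1) * Y1 \<T> u + (Y0 \<T> u - of_bool (G u = 1) * Y0 \<T> u))"
    using moments by (intro Bochner_Integration.integrable_add Bochner_Integration.integrable_diff)
  then show ?thesis
    unfolding True by (rule Bochner_Integration.integrable_cong[THEN iffD1, rotated 2])
      (auto simp: period_outcome_def algebra_simps)
next
  case False
  then have s: "s = \<T> - 1" using assms by simp
  have "AE u in P. Y0 (\<T> - 1) u = Yper s u"
    using no_anticipation[OF periods_in(3)] by (auto simp: period_outcome_def s algebra_simps)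
  then show ?thesis
    using moments(2) periods_in by (subst integrable_cong_AE[symmetric]) (auto simp: s)
qed

text \<open>An event of \<open>X\<close> is a preimage under \<open>X\<close>, so the integrand
  apart from the period indicator is a function of the vector that time invariance makes independent
  of \<open>T\<close>. The indicator of the period splits off as the factor
  \<open>lam s\<close>.\<close>

lemma time_average:
  assumes s: "s \<in> {\<T> - 1, \<T>}" and C: "C \<in> sets F" and [measurable]: "Measurable.pred (count_space UNIV) A"
  shows "integrable P (\<lambda>u. indicator C u * (of_bool (A (G u)) * (of_bool (T u = s) * Yobs u)))"
    and "(\<integral>u. indicator C u * (of_bool (A (G u)) * (of_bool (T u = s) * Yobs u)) \<partial>P) =
      lam s * (\<integral>u. indicator C u * (of_bool (A (G u)) * Yper s u) \<partial>P)"
proof -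
  have s': "s \<in> {1..\<T>}" using s periods_in by auto
  obtain D where D[measurable]: "D \<in> sets borel" and CD: "C = X -` D \<inter> space P"
    using C by (auto simp: sets_gen_by)
  let ?N = "(\<Pi>\<^sub>M t\<in>{1..\<T>}. borel) \<Otimes>\<^sub>M borel \<Otimes>\<^sub>M count_space UNIV :: ((nat \<Rightarrow> real) \<times> 'x \<times> nat) measure"
  let ?U = "\<lambda>u. (\<lambda>t\<in>{1..\<T>}. Yper t u, X u, G u)"
  define f :: "(nat \<Rightarrow> real) \<times> 'x \<times> nat \<Rightarrow> real"
    where "f = (\<lambda>(y, x, g). indicator D x * (of_bool (A g) * y s))"
  have fm: "f \<in> borel_measurable ?N"
    unfolding f_def case_prod_unfold using s' by measurable
  have fU: "f (?U u) = indicator C u * (of_bool (A (G u)) * Yper s u)" if "u \<in> space P" for u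
    using that s' by (auto simp: f_def CD split: split_indicator)
  have int: "integrable P (\<lambda>u. f (?U u))"
  proof -
    have "integrable P (\<lambda>u. indicator C u * (of_bool (A (G u)) * Yper s u))"
      using integrable_period_outcome[OF s] set_F_measurable[OF C] s'
      by (rule_tac Bochner_Integration.integrable_bound[OF integrable_period_outcome[OF s]])
         (auto intro!: AE_I2 split: split_indicator)
    then show ?thesis by (rule Bochner_Integration.integrable_cong[THEN iffD1, rotated 2]) (simp_all only: fU)
  qed
  have eq: "f (?U u) * of_bool (T u = s) =
    indicator C u * (of_bool (A (G u)) * (of_bool (T u = s) * Yobs u))" if "u \<in> space P" for u
    using fU[OF that] period_times_outcome[OF s'] by (simp add: ac_simps)
  note * = integral_indep_rv[OF time_invariance fm int, of s]
  show "integrable P (\<lambda>u. indicator C u * (of_bool (A (G u)) * (of_bool (T u = s) * Yobs u)))"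
    using *(1) by (rule Bochner_Integration.integrable_cong[THEN iffD1, rotated 2]) (use eq in auto)
  have "(\<integral>u. indicator C u * (of_bool (A (G u)) * (of_bool (T u = s) * Yobs u)) \<partial>P) =
    (\<integral>u. f (?U u) * of_bool (T u = s) \<partial>P)"
    using eq by (intro Bochner_Integration.integral_cong) auto
  also have "\<dots> = (\<integral>u. f (?U u) \<partial>P) * lam s" using *(2) by (simp add: lam_def)
  also have "(\<integral>u. f (?U u) \<partial>P) = (\<integral>u. indicator C u * (of_bool (A (G u)) * Yper s u) \<partial>P)"
    using fU by (intro Bochner_Integration.integral_cong) auto
  finally show "(\<integral>u. indicator C u * (of_bool (A (G u)) * (of_bool (T u = s) * Yobs u)) \<partial>P) =
      lam s * (\<integral>u. indicator C u * (of_bool (A (G u)) * Yper s u) \<partial>P)"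
    by simp
qed

section \<open>The common trend of untreated outcomes\<close>

lemma integrable_FX: "f \<in> borel_measurable borel \<Longrightarrow> integrable FX f \<longleftrightarrow> integrable P (\<lambda>u. f (X u))" for f :: "'x \<Rightarrow> real"
  unfolding FX_def by (rule integrable_distr_eq) auto

lemma mu_square_integrable:
  assumes "t \<in> {\<T> - 1, \<T>}"
  shows "integrable P (\<lambda>u. (\<mu> t (X u))\<^sup>2)"
proof -
  have "integrable FX (\<lambda>x. (\<mu> t x)\<^sup>2)"
    using mu_L2[OF assms] by (auto simp: L2_norm_def split: if_splits)
  then show ?thesis using mu_measurable[OF assms] by (subst (asm) integrable_FX) auto
qed

lemma mu_integrable:
  assumes "t \<in> {\<T> - 1, \<T>}"
  shows "integrable P (\<lambda>u. \<mu> t (X u))"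
proof -
  note mu_measurable[OF assms, measurable]
  show ?thesis by (rule square_integrable_imp_integrable[OF _ mu_square_integrable[OF assms]]) measurable
qed

text \<open>By \<open>trend_eq_cond_trend\<close> this is the conditional trend of untreated
  outcomes shared by all groups. Division by \<open>lam\<close> is needed because
  \<open>\<mu> t\<close> regresses the outcome multiplied by the period indicator.\<close>

definition trend :: "'x \<Rightarrow> real" where
  "trend x = \<mu> \<T> x / lam \<T> - \<mu> (\<T> - 1) x / lam (\<T> - 1)"

lemma trend_measurable[measurable]: "trend \<in> borel_measurable borel"
  unfolding trend_def by measurable

lemma trend_integrable: "integrable P (\<lambda>u. trend (X u))"
  unfolding trend_def by (intro Bochner_Integration.integrable_diff integrable_divide mu_integrable) auto

abbreviation "D0 u \<equiv> Y0 \<T> u - Y0 (\<T> - 1) u"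

lemma D0_integrable: "integrable P (\<lambda>u. D0 u)"
  using moments by (intro Bochner_Integration.integrable_diff)

abbreviation "cond_trend \<equiv> real_cond_exp (given P (\<lambda>v. G v = 1)) F (\<lambda>v. D0 v)"

lemma integrable_of_bool_mult: "integrable P f \<Longrightarrow> Measurable.pred P A \<Longrightarrow> integrable P (\<lambda>u. of_bool (A u) * f u)"
  for f :: "'p \<Rightarrow> real"
  by (rule Bochner_Integration.integrable_bound) (auto intro!: AE_I2)

lemma integrable_indicator_mult: "integrable P f \<Longrightarrow> C \<in> sets F \<Longrightarrow> integrable P (\<lambda>u. indicator C u * f u)"
  for f :: "'p \<Rightarrow> real"
  using integrable_mult_indicator[OF set_F_measurable, of C f] by simp

lemma cond_trend_measurable[measurable]: "cond_trend \<in> borel_measurable F" "cond_trend \<in> borel_measurable P"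
  using borel_measurable_cond_exp measurable_from_subalg[OF sub.subalg] by blast+

text \<open>Parallel trends holds almost surely under \<open>P\<close>, not merely under the
  conditional law of one group, so the conditional trend of the treated can stand in for that of
  every group.\<close>

lemma cond_trend_group:
  assumes g: "g \<in> {1..NG + 1}"
  shows "integrable P (\<lambda>u. of_bool (G u = g) * cond_trend u)"
    and "C \<in> sets F \<Longrightarrow> (\<integral>u. indicator C u * (of_bool (G u = g) * cond_trend u) \<partial>P) =
      (\<integral>u. indicator C u * (of_bool (G u = g) * D0 u) \<partial>P)"
proof -
  let ?R = "real_cond_exp (given P (\<lambda>v. G v = g)) F (\<lambda>v. D0 v)"
  have ae: "AE u in P. cond_trend u = ?R u"
    using parallel_trends[of g] g by (cases "g = 1") auto
  have R[measurable]: "?R \<in> borel_measurable P"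
    using measurable_from_subalg[OF sub.subalg borel_measurable_cond_exp] .
  have int: "integrable P (\<lambda>u. of_bool (G u = g) * D0 u)"
    by (rule integrable_of_bool_mult[OF D0_integrable]) measurable
  note * = given_cond_exp[of "\<lambda>u. G u = g" X "\<lambda>u. D0 u", OF _ group_prob_pos[OF g] covariates _ int]
  have "integrable P (\<lambda>u. of_bool (G u = g) * ?R u)" by (rule *(1)) measurable
  then show "integrable P (\<lambda>u. of_bool (G u = g) * cond_trend u)"
    by (rule integrable_cong_AE_imp) (use ae in auto)
  assume C: "C \<in> sets F"
  note set_F_measurable[OF C, measurable]
  have "(\<integral>u. indicator C u * (of_bool (G u = g) * ?R u) \<partial>P) = (\<integral>u. indicator C u * (of_bool (G u = g) * D0 u) \<partial>P)"
    by (rule *(2)[OF _ _ C]) measurable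
  moreover have "(\<integral>u. indicator C u * (of_bool (G u = g) * ?R u) \<partial>P) =
    (\<integral>u. indicator C u * (of_bool (G u = g) * cond_trend u) \<partial>P)"
    by (rule integral_cong_AE) (use ae in auto)
  ultimately show "(\<integral>u. indicator C u * (of_bool (G u = g) * cond_trend u) \<partial>P) =
      (\<integral>u. indicator C u * (of_bool (G u = g) * D0 u) \<partial>P)" by simp
qed

lemma not_treated_sum:
  assumes "u \<in> space P"
  shows "(of_bool (G u \<noteq> 1) :: real) = (\<Sum>g=2..NG+1. of_bool (G u = g))"
proof -
  have "(\<Sum>g=2..NG+1. of_bool (G u = g)) = (\<Sum>g=2..NG+1. if g = G u then 1 else 0 :: real)"
    by (intro sum.cong) auto
  also have "\<dots> = of_bool (G u \<noteq> 1)" using groups(2)[OF assms] by (subst sum.delta) auto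
  finally show ?thesis by simp
qed

text \<open>The pooled untreated are the disjoint union of groups 2 to \<open>NG + 1\<close>, and
  one function serves all of them. If it differed between groups, pooling would bring in the group
  shares.\<close>

lemma cond_trend_not_treated:
  shows "integrable P (\<lambda>u. of_bool (G u \<noteq> 1) * cond_trend u)"
    and "C \<in> sets F \<Longrightarrow> (\<integral>u. indicator C u * (of_bool (G u \<noteq> 1) * cond_trend u) \<partial>P) =
      (\<integral>u. indicator C u * (of_bool (G u \<noteq> 1) * D0 u) \<partial>P)"
proof -
  have "integrable P (\<lambda>u. \<Sum>g=2..NG+1. of_bool (G u = g) * cond_trend u)"
    by (intro Bochner_Integration.integrable_sum cond_trend_group(1)) auto
  then show "integrable P (\<lambda>u. of_bool (G u \<noteq> 1) * cond_trend u)"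
    by (rule Bochner_Integration.integrable_cong[THEN iffD1, rotated 2])
       (simp_all only: not_treated_sum sum_distrib_right)
  assume C: "C \<in> sets F"
  have split: "(\<integral>u. indicator C u * (of_bool (G u \<noteq> 1) * f u) \<partial>P) =
    (\<Sum>g=2..NG+1. \<integral>u. indicator C u * (of_bool (G u = g) * f u) \<partial>P)"
    if "\<And>g. g \<in> {2..NG+1} \<Longrightarrow> integrable P (\<lambda>u. of_bool (G u = g) * f u)" for f :: "'p \<Rightarrow> real"
  proof -
    have "(\<integral>u. indicator C u * (of_bool (G u \<noteq> 1) * f u) \<partial>P) =
      (\<integral>u. (\<Sum>g=2..NG+1. indicator C u * (of_bool (G u = g) * f u)) \<partial>P)"
      by (intro Bochner_Integration.integral_cong) (simp_all only: not_treated_sum sum_distrib_right sum_distrib_left)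
    also have "\<dots> = (\<Sum>g=2..NG+1. \<integral>u. indicator C u * (of_bool (G u = g) * f u) \<partial>P)"
      by (intro Bochner_Integration.integral_sum integrable_indicator_mult that C)
    finally show ?thesis .
  qed
  have D0g: "integrable P (\<lambda>u. of_bool (G u = g) * D0 u)" for g
    by (rule integrable_of_bool_mult[OF D0_integrable]) measurable
  have "(\<integral>u. indicator C u * (of_bool (G u \<noteq> 1) * cond_trend u) \<partial>P) =
    (\<Sum>g=2..NG+1. \<integral>u. indicator C u * (of_bool (G u = g) * cond_trend u) \<partial>P)"
    by (intro split cond_trend_group(1)) auto
  also have "\<dots> = (\<Sum>g=2..NG+1. \<integral>u. indicator C u * (of_bool (G u = g) * D0 u) \<partial>P)"
    by (intro sum.cong cond_trend_group(2) C) auto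
  also have "\<dots> = (\<integral>u. indicator C u * (of_bool (G u \<noteq> 1) * D0 u) \<partial>P)"
    by (intro split[symmetric] D0g)
  finally show "(\<integral>u. indicator C u * (of_bool (G u \<noteq> 1) * cond_trend u) \<partial>P) =
      (\<integral>u. indicator C u * (of_bool (G u \<noteq> 1) * D0 u) \<partial>P)" .
qed

text \<open>The regression is unfolded under the law given \<open>G u \<noteq> 1\<close>, and
  sampling then averages out to the factor \<open>lam s\<close>. Only a pooled level is obtained,
  not that of a single group.\<close>

lemma not_treated_mu:
  assumes s: "s \<in> {\<T> - 1, \<T>}" and C: "C \<in> sets F"
  shows "(\<integral>u. indicator C u * (of_bool (G u \<noteq> 1) * \<mu> s (X u)) \<partial>P) =
    lam s * (\<integral>u. indicator C u * (of_bool (G u \<noteq> 1) * Y0 s u) \<partial>P)"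
proof -
  let ?Z = "\<lambda>u. of_bool (T u = s) * Yobs u"
  let ?R = "real_cond_exp (given P (\<lambda>v. G v \<noteq> 1)) F ?Z"
  have s': "s \<in> {1..\<T>}" using s periods_in by auto
  have A: "Measurable.pred P (\<lambda>u. G u \<noteq> 1)" by measurable
  note set_F_measurable[OF C, measurable] mu_measurable[OF s, measurable]
  have R[measurable]: "?R \<in> borel_measurable P"
    using measurable_from_subalg[OF sub.subalg borel_measurable_cond_exp] .
  have UF: "space P \<in> sets F" using sets.top[of F] by simp
  have "integrable P (\<lambda>u. indicator (space P) u * (of_bool (G u \<noteq> 1) * ?Z u))"
    by (rule time_average(1)[OF s UF]) simp
  then have int: "integrable P (\<lambda>u. of_bool (G u \<noteq> 1) * ?Z u)"
    by (rule Bochner_Integration.integrable_cong[THEN iffD1, rotated 2]) auto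
  have "AE u in given P (\<lambda>u. G u \<noteq> 1). \<mu> s (X u) = ?R u"
    using mu[OF s] by (simp add: regression_fun_def)
  then have ae: "AE u in P. G u \<noteq> 1 \<longrightarrow> \<mu> s (X u) = ?R u"
    by (subst (asm) AE_given[OF A not_treated_prob_pos])
  have "(\<integral>u. indicator C u * (of_bool (G u \<noteq> 1) * \<mu> s (X u)) \<partial>P) =
    (\<integral>u. indicator C u * (of_bool (G u \<noteq> 1) * ?R u) \<partial>P)"
    by (rule integral_cong_AE) (use ae in auto)
  also have "\<dots> = (\<integral>u. indicator C u * (of_bool (G u \<noteq> 1) * ?Z u) \<partial>P)"
    by (rule given_cond_exp(2)[OF A not_treated_prob_pos covariates _ int C]) measurable
  also have "\<dots> = lam s * (\<integral>u. indicator C u * (of_bool (G u \<noteq> 1) * Yper s u) \<partial>P)"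
    by (rule time_average(2)[OF s C]) simp
  also have "(\<integral>u. indicator C u * (of_bool (G u \<noteq> 1) * Yper s u) \<partial>P) =
    (\<integral>u. indicator C u * (of_bool (G u \<noteq> 1) * Y0 s u) \<partial>P)"
    by (intro Bochner_Integration.integral_cong) (auto simp: period_outcome_def)
  finally show ?thesis .
qed

lemma lam_T_pos: "lam \<T> > 0" "lam (\<T> - 1) > 0"
  using lam_pos periods_in by auto

lemma not_treated_trend:
  assumes C: "C \<in> sets F"
  shows "(\<integral>u. indicator C u * (of_bool (G u \<noteq> 1) * trend (X u)) \<partial>P) =
    (\<integral>u. indicator C u * (of_bool (G u \<noteq> 1) * D0 u) \<partial>P)"
proof -
  have i: "integrable P (\<lambda>u. indicator C u * (of_bool (G u \<noteq> 1) * f u))" if "integrable P f" for f :: "'p \<Rightarrow> real"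
    using C by (intro integrable_indicator_mult integrable_of_bool_mult that) auto
  have "(\<integral>u. indicator C u * (of_bool (G u \<noteq> 1) * trend (X u)) \<partial>P) =
    (\<integral>u. indicator C u * (of_bool (G u \<noteq> 1) * \<mu> \<T> (X u)) / lam \<T> -
      indicator C u * (of_bool (G u \<noteq> 1) * \<mu> (\<T> - 1) (X u)) / lam (\<T> - 1) \<partial>P)"
    by (intro Bochner_Integration.integral_cong) (auto simp: trend_def algebra_simps)
  also have "\<dots> = (\<integral>u. indicator C u * (of_bool (G u \<noteq> 1) * \<mu> \<T> (X u)) \<partial>P) / lam \<T> -
      (\<integral>u. indicator C u * (of_bool (G u \<noteq> 1) * \<mu> (\<T> - 1) (X u)) \<partial>P) / lam (\<T> - 1)"
    by (subst Bochner_Integration.integral_diff) (auto intro!: integrable_divide i mu_integrable)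
  also have "\<dots> = (\<integral>u. indicator C u * (of_bool (G u \<noteq> 1) * Y0 \<T> u) \<partial>P) -
      (\<integral>u. indicator C u * (of_bool (G u \<noteq> 1) * Y0 (\<T> - 1) u) \<partial>P)"
    using lam_T_pos by (simp add: not_treated_mu C del: One_nat_def)
  also have "\<dots> = (\<integral>u. indicator C u * (of_bool (G u \<noteq> 1) * D0 u) \<partial>P)"
    by (subst Bochner_Integration.integral_diff[OF i[OF moments(1)] i[OF moments(2)], symmetric])
       (simp only: right_diff_distrib)
  finally show ?thesis .
qed

text \<open>The exceptional set has the form \<open>X u \<in> D\<close>. If it is null among the
  untreated, \<open>p 2\<close> integrates to 0 over \<open>D\<close> although it is positive, so
  \<open>D\<close> itself is null. This is how overlap carries knowledge about the untreated over to
  the treated.\<close>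

lemma AE_not_treated_imp_AE:
  assumes [measurable]: "{u \<in> space P. R u} \<in> sets F" and ae: "AE u in P. G u \<noteq> 1 \<longrightarrow> R u"
  shows "AE u in P. R u"
proof -
  let ?N = "{u \<in> space P. \<not> R u}"
  have N: "?N \<in> sets F"
  proof -
    have "?N = space F - {u \<in> space P. R u}" by auto
    also have "\<dots> \<in> sets F" using assms(1) by (rule sets.compl_sets)
    finally show ?thesis .
  qed
  then obtain D where D[measurable]: "D \<in> sets borel" and ND: "?N = X -` D \<inter> space P"
    by (auto simp: sets_gen_by)
  \<comment> \<open>Any one untreated group would do; group 2 exists because
    \<open>NG \<ge> 1\<close>.\<close>
  have two: "2 \<in> {1..NG + 1}" using dims by simp
  interpret FX: prob_space FX by (rule prob_space_FX)
  have p2: "integrable FX (\<lambda>x. p 2 x * indicator D x)"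
    using p_bounds[OF two] p_measurable[OF two]
    by (intro FX.integrable_const_bound[where B=1]) (auto split: split_indicator elim!: AE_mp)
  have "(\<integral>x. p 2 x * indicator D x \<partial>FX) = (\<integral>u. of_bool (G u = 2) * indicator D (X u) \<partial>P)"
    by (rule integral_group[OF two, symmetric]) (auto simp: less_top[symmetric])
  also have "\<dots> = (\<integral>u. 0 \<partial>P)"
  proof (rule integral_cong_AE)
    show "AE u in P. of_bool (G u = 2) * indicator D (X u) = (0::real)"
      using ae AE_space
    proof eventually_elim
      case (elim u)
      then have "X u \<in> D \<longrightarrow> u \<in> ?N" unfolding ND by auto
      with elim show ?case by auto
    qed
  qed auto
  finally have "(\<integral>x. p 2 x * indicator D x \<partial>FX) = 0" by simp
  moreover have "AE x in FX. 0 \<le> p 2 x * indicator D x"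
    using p_bounds[OF two] by (auto elim!: AE_mp)
  ultimately have "AE x in FX. p 2 x * indicator D x = 0"
    using integral_nonneg_eq_0_iff_AE[OF p2] by simp
  then have "AE x in FX. x \<notin> D"
    using p_bounds[OF two] by eventually_elim (auto split: split_indicator_asm)
  then have "AE u in P. X u \<notin> D" by (rule AE_FX_D)
  then show ?thesis using AE_space
  proof eventually_elim
    case (elim u)
    then have "u \<notin> ?N" unfolding ND by auto
    with elim show ?case by auto
  qed
qed

text \<open>Both sides are versions of the conditional expectation of \<open>D0\<close> given
  \<open>X\<close> among the untreated, hence agree there almost surely. The equality is an event of
  \<open>X\<close>, so it extends to the whole population.\<close>

lemma trend_eq_cond_trend: "AE u in P. trend (X u) = cond_trend u"
proof (rule AE_not_treated_imp_AE)
  have [measurable]: "(\<lambda>u. trend (X u)) \<in> borel_measurable F" by measurable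
  have "{u \<in> space F. trend (X u) = cond_trend u} \<in> sets F" by measurable
  then show "{u \<in> space P. trend (X u) = cond_trend u} \<in> sets F" by simp
  have A: "Measurable.pred P (\<lambda>u. G u \<noteq> 1)" by measurable
  let ?g = "given P (\<lambda>u. G u \<noteq> 1)"
  interpret g: prob_space ?g by (rule prob_space_given[OF A not_treated_prob_pos])
  interpret g: finite_measure_subalgebra ?g F
    using finite_measure_subalgebra_gen_by[OF g.prob_space_axioms, of X] by simp
  have iD: "integrable ?g (\<lambda>u. D0 u)"
    by (subst integrable_given[OF A not_treated_prob_pos]) (auto intro!: integrable_of_bool_mult D0_integrable)
  have it: "integrable ?g (\<lambda>u. trend (X u))"
    by (subst integrable_given[OF A not_treated_prob_pos]) (auto intro!: integrable_of_bool_mult trend_integrable)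
  have ic: "integrable ?g cond_trend"
    using cond_trend_not_treated(1) by (subst integrable_given[OF A not_treated_prob_pos]) auto
  have 1: "AE u in ?g. real_cond_exp ?g F (\<lambda>u. D0 u) u = trend (X u)"
  proof (rule g.real_cond_exp_charact[OF _ iD it])
    fix C assume C: "C \<in> sets F"
    note set_F_measurable[OF C, measurable]
    show "(\<integral>u\<in>C. D0 u \<partial>?g) = (\<integral>u\<in>C. trend (X u) \<partial>?g)"
      unfolding set_lebesgue_integral_def
      using not_treated_trend[OF C]
      by (simp add: integral_given[OF A not_treated_prob_pos] mult.left_commute)
  qed measurable
  have 2: "AE u in ?g. real_cond_exp ?g F (\<lambda>u. D0 u) u = cond_trend u"
  proof (rule g.real_cond_exp_charact[OF _ iD ic])
    fix C assume C: "C \<in> sets F"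
    note set_F_measurable[OF C, measurable]
    show "(\<integral>u\<in>C. D0 u \<partial>?g) = (\<integral>u\<in>C. cond_trend u \<partial>?g)"
      unfolding set_lebesgue_integral_def
      using cond_trend_not_treated(2)[OF C]
      by (simp add: integral_given[OF A not_treated_prob_pos] mult.left_commute)
  qed measurable
  from 1 2 have "AE u in ?g. trend (X u) = cond_trend u" by eventually_elim simp
  then show "AE u in P. G u \<noteq> 1 \<longrightarrow> trend (X u) = cond_trend u"
    by (subst (asm) AE_given[OF A not_treated_prob_pos])
qed

lemma group_trend:
  assumes g: "g \<in> {1..NG + 1}" and C: "C \<in> sets F"
  shows "(\<integral>u. indicator C u * (of_bool (G u = g) * trend (X u)) \<partial>P) =
    (\<integral>u. indicator C u * (of_bool (G u = g) * D0 u) \<partial>P)"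
proof -
  note set_F_measurable[OF C, measurable]
  have "(\<integral>u. indicator C u * (of_bool (G u = g) * trend (X u)) \<partial>P) =
    (\<integral>u. indicator C u * (of_bool (G u = g) * cond_trend u) \<partial>P)"
    by (rule integral_cong_AE) (use trend_eq_cond_trend in auto)
  then show ?thesis using cond_trend_group(2)[OF g C] by simp
qed

section \<open>Conditional mean and second moment of the scaled residual\<close>

lemma B_S: "B (S u) = (of_bool (T u = \<T>) * Yobs u) / lam \<T> -
    (of_bool (T u = \<T> - 1) * Yobs u) / lam (\<T> - 1) - trend (X u)"
  unfolding scaled_residual_def rc_obs_def trend_def by (simp add: diff_divide_distrib)

text \<open>Against an event of \<open>X\<close> the sampling indicators average out and the trend
  may be replaced by \<open>D0\<close>. What is left is zero for an untreated group and, by no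
  anticipation, the treatment effect for group 1.\<close>

lemma group_residual:
  assumes g: "g \<in> {1..NG + 1}" and C: "C \<in> sets F"
  shows "integrable P (\<lambda>u. indicator C u * (of_bool (G u = g) * B (S u)))"
    and "(\<integral>u. indicator C u * (of_bool (G u = g) * B (S u)) \<partial>P) =
      (\<integral>u. indicator C u * (of_bool (G u = g) *
        (Yper \<T> u - Yper (\<T> - 1) u - D0 u)) \<partial>P)"
proof -
  let ?i = "\<lambda>f u. indicator C u * (of_bool (G u = g) * f u) :: real"
  let ?Z = "\<lambda>s u. of_bool (T u = s) * Yobs u"
  have i: "integrable P (?i f)" if "integrable P f" for f
    using C by (intro integrable_indicator_mult integrable_of_bool_mult that) auto
  have iZ: "integrable P (?i (?Z \<T>))" "integrable P (?i (?Z (\<T> - 1)))"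
    by (rule time_average(1)[OF _ C]; simp)+
  have eZ: "(\<integral>u. ?i (?Z s) u \<partial>P) = lam s * (\<integral>u. ?i (Yper s) u \<partial>P)" if "s \<in> {\<T> - 1, \<T>}" for s
    by (rule time_average(2)[OF that C]) simp
  have eq: "?i (\<lambda>u. B (S u)) = (\<lambda>u. ?i (?Z \<T>) u / lam \<T> - ?i (?Z (\<T> - 1)) u / lam (\<T> - 1) - ?i (\<lambda>u. trend (X u)) u)"
    by (simp add: B_S algebra_simps)
  show "integrable P (?i (\<lambda>u. B (S u)))"
    unfolding eq by (intro Bochner_Integration.integrable_diff integrable_divide iZ i trend_integrable)
  have "(\<integral>u. ?i (\<lambda>u. B (S u)) u \<partial>P) =
    (\<integral>u. ?i (?Z \<T>) u \<partial>P) / lam \<T> - (\<integral>u. ?i (?Z (\<T> - 1)) u \<partial>P) / lam (\<T> - 1) - (\<integral>u. ?i (\<lambda>u. trend (X u)) u \<partial>P)"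
    unfolding eq
    by (simp only: Bochner_Integration.integral_diff Bochner_Integration.integrable_diff integrable_divide
      iZ i trend_integrable integral_divide_zero)
  also have "\<dots> = (\<integral>u. ?i (Yper \<T>) u \<partial>P) - (\<integral>u. ?i (Yper (\<T> - 1)) u \<partial>P) -
      (\<integral>u. ?i (\<lambda>u. D0 u) u \<partial>P)"
    using lam_T_pos eZ[of \<T>] eZ[of "\<T> - 1"] group_trend[OF g C] by simp
  also have "\<dots> = (\<integral>u. ?i (Yper \<T>) u - ?i (Yper (\<T> - 1)) u - ?i (\<lambda>u. D0 u) u \<partial>P)"
    using i[OF integrable_period_outcome] i[OF D0_integrable] by simp
  also have "\<dots> = (\<integral>u. ?i (\<lambda>u. Yper \<T> u - Yper (\<T> - 1) u - D0 u) u \<partial>P)"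
    by (intro Bochner_Integration.integral_cong) (auto simp: algebra_simps)
  finally show "(\<integral>u. ?i (\<lambda>u. B (S u)) u \<partial>P) =
    (\<integral>u. ?i (\<lambda>u. Yper \<T> u - Yper (\<T> - 1) u - D0 u) u \<partial>P)" .
qed

lemma space_P_F: "space P \<in> sets F"
  using sets.top[of F] by simp

lemma group_residual_integrable:
  assumes g: "g \<in> {1..NG + 1}"
  shows "integrable P (\<lambda>u. of_bool (G u = g) * B (S u))"
  using group_residual(1)[OF g space_P_F]
  by (rule Bochner_Integration.integrable_cong[THEN iffD1, rotated 2]) auto

lemma untreated_residual_cond_exp:
  assumes h: "h \<in> {2..NG + 1}"
  shows "AE u in P. real_cond_exp P F (\<lambda>u. of_bool (G u = h) * B (S u)) u = 0"
proof (rule sub.real_cond_exp_charact)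
  have h': "h \<in> {1..NG + 1}" using h by auto
  show "integrable P (\<lambda>u. of_bool (G u = h) * B (S u))" by (rule group_residual_integrable[OF h'])
  fix C assume C: "C \<in> sets F"
  have "(\<integral>u. indicator C u * (of_bool (G u = h) * B (S u)) \<partial>P) =
    (\<integral>u. indicator C u * (of_bool (G u = h) *
      (Yper \<T> u - Yper (\<T> - 1) u - D0 u)) \<partial>P)"
    by (rule group_residual(2)[OF h' C])
  also have "\<dots> = (\<integral>u. 0 \<partial>P)"
    using h by (intro Bochner_Integration.integral_cong) (auto simp: period_outcome_def)
  finally show "(\<integral>u\<in>C. of_bool (G u = h) * B (S u) \<partial>P) = (\<integral>u\<in>C. 0 \<partial>P)"
    unfolding set_lebesgue_integral_def by simp
qed auto

lemma untreated_residual_mean: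
  assumes h: "h \<in> {2..NG + 1}" and f[measurable]: "f \<in> borel_measurable borel"
  shows "(\<integral>u. of_bool (G u = h) * f (X u) * B (S u) \<partial>P) = 0"
proof (cases "integrable P (\<lambda>u. of_bool (G u = h) * f (X u) * B (S u))")
  case True
  have [measurable]: "(\<lambda>u. real_cond_exp P F (\<lambda>u. of_bool (G u = h) * B (S u)) u) \<in> borel_measurable P"
    using borel_measurable_cond_exp2 .
  have eq: "of_bool (G u = h) * f (X u) * B (S u) = f (X u) * (of_bool (G u = h) * B (S u))" for u
    by simp
  have "(\<integral>u. f (X u) * (of_bool (G u = h) * B (S u)) \<partial>P) =
    (\<integral>u. f (X u) * real_cond_exp P F (\<lambda>u. of_bool (G u = h) * B (S u)) u \<partial>P)"
    using True unfolding eq by (intro sub.real_cond_exp_intg(2)[symmetric]) measurable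
  also have "\<dots> = (\<integral>u. 0 \<partial>P)"
    by (rule integral_cong_AE) (use untreated_residual_cond_exp[OF h] in auto)
  finally show ?thesis unfolding eq by simp
\<comment> \<open>Without integrability the Bochner integral is 0 by convention, which is the
  claimed value.\<close>
qed (rule not_integrable_integral_eq)

lemma treated_residual_mean: "(\<integral>u. of_bool (G u = 1) * B (S u) \<partial>P) = pi1 * \<theta>"
proof -
  have A: "Measurable.pred P (\<lambda>u. G u = 1)" by measurable
  have pos: "prob {u \<in> space P. G u = 1} > 0" using pi1_pos by (simp add: pi1_def)
  have "(\<integral>u. of_bool (G u = 1) * B (S u) \<partial>P) = (\<integral>u. indicator (space P) u * (of_bool (G u = 1) * B (S u)) \<partial>P)"
    by (intro Bochner_Integration.integral_cong) auto
  also have "\<dots> = (\<integral>u. indicator (space P) u * (of_bool (G u = 1) *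
      (Yper \<T> u - Yper (\<T> - 1) u - D0 u)) \<partial>P)"
    by (rule group_residual(2)[OF _ space_P_F]) simp
  also have "\<dots> = (\<integral>u. of_bool (G u = 1) * (Y1 \<T> u - Y0 \<T> u) \<partial>P)"
    using no_anticipation[OF periods_in(3)] AE_space
    by (intro integral_cong_AE) (auto simp: period_outcome_def)
  also have "\<dots> = pi1 * \<theta>"
    unfolding \<theta>_def using pos by (subst integral_given[OF A pos]) (auto simp: pi1_def)
  finally show ?thesis .
qed

text \<open>The factor \<open>f (X u)\<close> is pulled out of the conditional expectation given
  \<open>X\<close>, and the conditional second moment is replaced by its bound. The sum of the
  bounds is one constant for all groups.\<close>

lemma residual_second_moment:
  "\<exists>C::real. C \<ge> 0 \<and> (\<forall>h\<in>{1..NG + 1}. \<forall>f\<in>borel_measurable borel.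
    (\<integral>\<^sup>+u. of_bool (G u = h) * (f (X u) * ennreal ((B (S u))\<^sup>2)) \<partial>P) \<le> ennreal C * (\<integral>\<^sup>+x. f x \<partial>FX))"
proof -
  have "\<forall>g\<in>{1..NG + 1}. \<exists>C::real. AE u in P.
      nn_cond_exp (given P (\<lambda>v. G v = g)) F (\<lambda>v. ennreal ((B (S v))\<^sup>2)) u \<le> ennreal C"
    using bounded_residual by auto
  then obtain c where c: "\<And>g. g \<in> {1..NG + 1} \<Longrightarrow> AE u in P.
      nn_cond_exp (given P (\<lambda>v. G v = g)) F (\<lambda>v. ennreal ((B (S v))\<^sup>2)) u \<le> ennreal (c g)"
    by metis
  define C where "C = (\<Sum>g=1..NG+1. \<bar>c g\<bar>)"
  have C0: "C \<ge> 0" unfolding C_def by (intro sum_nonneg) auto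
  have "(\<integral>\<^sup>+u. of_bool (G u = h) * (f (X u) * ennreal ((B (S u))\<^sup>2)) \<partial>P) \<le> ennreal C * (\<integral>\<^sup>+x. f x \<partial>FX)"
    if h: "h \<in> {1..NG + 1}" and f[measurable]: "f \<in> borel_measurable borel" for h f
  proof -
    have A: "Measurable.pred P (\<lambda>u. G u = h)" by measurable
    note pos = group_prob_pos[OF h]
    let ?g = "given P (\<lambda>v. G v = h)"
    interpret g: prob_space ?g by (rule prob_space_given[OF A pos])
    interpret g: finite_measure_subalgebra ?g F
      using finite_measure_subalgebra_gen_by[OF g.prob_space_axioms, of X] by simp
    let ?N = "nn_cond_exp ?g F (\<lambda>v. ennreal ((B (S v))\<^sup>2))"
    have "c h \<le> \<bar>c h\<bar>" by simp
    also have "\<dots> \<le> C" unfolding C_def using h by (intro member_le_sum) auto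
    finally have "AE u in P. ?N u \<le> ennreal C"
      using c[OF h] by (auto elim!: AE_mp intro: order_trans[OF _ ennreal_leI])
    then have ae: "AE u in ?g. ?N u \<le> ennreal C" by (subst AE_given[OF A pos]) auto
    have "(\<integral>\<^sup>+u. f (X u) * ennreal ((B (S u))\<^sup>2) \<partial>?g) = (\<integral>\<^sup>+u. f (X u) * ?N u \<partial>?g)"
      by (rule g.nn_cond_exp_intg[symmetric]) measurable
    also have "\<dots> \<le> (\<integral>\<^sup>+u. ennreal C * f (X u) \<partial>?g)"
    proof (rule nn_integral_mono_AE)
      show "AE u in ?g. f (X u) * ?N u \<le> ennreal C * f (X u)"
        using ae by eventually_elim (subst mult.commute, rule mult_right_mono, auto)
    qed
    finally have le: "(\<integral>\<^sup>+u. f (X u) * ennreal ((B (S u))\<^sup>2) \<partial>?g) \<le> (\<integral>\<^sup>+u. ennreal C * f (X u) \<partial>?g)" .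
    have "(\<integral>\<^sup>+u. of_bool (G u = h) * (f (X u) * ennreal ((B (S u))\<^sup>2)) \<partial>P) \<le>
      (\<integral>\<^sup>+u. of_bool (G u = h) * (ennreal C * f (X u)) \<partial>P)"
      by (subst (1 2) nn_integral_given[OF A pos]) (auto intro!: mult_left_mono le)
    \<comment> \<open>Dropping the group indicator leaves a bound under \<open>FX\<close>, the law
      in which the rates of the estimators are stated.\<close>
    also have "\<dots> \<le> (\<integral>\<^sup>+u. ennreal C * f (X u) \<partial>P)"
      by (intro nn_integral_mono) auto
    also have "\<dots> = ennreal C * (\<integral>\<^sup>+u. f (X u) \<partial>P)"
      by (rule nn_integral_cmult) measurable
    also have "(\<integral>\<^sup>+u. f (X u) \<partial>P) = (\<integral>\<^sup>+x. f x \<partial>FX)"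
      unfolding FX_def by (rule nn_integral_distr[symmetric]) measurable
    finally show ?thesis .
  qed
  then show ?thesis using C0 by blast
qed

lemma residual_square_integrable: "integrable P (\<lambda>u. (B (S u))\<^sup>2)"
proof -
  interpret FX: prob_space FX by (rule prob_space_FX)
  obtain C where C: "C \<ge> 0" "\<And>h f. h \<in> {1..NG + 1} \<Longrightarrow> f \<in> borel_measurable borel \<Longrightarrow>
    (\<integral>\<^sup>+u. of_bool (G u = h) * (f (X u) * ennreal ((B (S u))\<^sup>2)) \<partial>P) \<le> ennreal C * (\<integral>\<^sup>+x. f x \<partial>FX)"
    using residual_second_moment by blast
  have "(\<integral>\<^sup>+u. ennreal ((B (S u))\<^sup>2) \<partial>P) = (\<integral>\<^sup>+u. (\<Sum>h=1..NG+1. of_bool (G u = h) * (1 * ennreal ((B (S u))\<^sup>2))) \<partial>P)"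
  proof (rule nn_integral_cong)
    fix u assume "u \<in> space P"
    from groups(2)[OF this] have "(\<Sum>h=1..NG+1. of_bool (G u = h) * ennreal ((B (S u))\<^sup>2)) =
      (\<Sum>h=1..NG+1. if h = G u then ennreal ((B (S u))\<^sup>2) else 0)"
      by (intro sum.cong) auto
    also have "\<dots> = ennreal ((B (S u))\<^sup>2)"
      using groups(2)[OF \<open>u \<in> space P\<close>] by (subst sum.delta) auto
    finally show "ennreal ((B (S u))\<^sup>2) = (\<Sum>h=1..NG+1. of_bool (G u = h) * (1 * ennreal ((B (S u))\<^sup>2)))"
      by simp
  qed
  also have "\<dots> = (\<Sum>h=1..NG+1. \<integral>\<^sup>+u. of_bool (G u = h) * (1 * ennreal ((B (S u))\<^sup>2)) \<partial>P)"
    by (rule nn_integral_sum) measurable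
  also have "\<dots> \<le> (\<Sum>h=1..NG+1. ennreal C)"
    using C(2)[of _ "\<lambda>_. 1"] FX.emeasure_space_1 by (intro sum_mono) auto
  also have "\<dots> < \<infinity>" by (simp add: ennreal_mult_less_top of_nat_less_top)
  finally show ?thesis by (intro integrableI_bounded) auto
qed

text \<open>The periods \<open>\<T>\<close> and \<open>\<T> - 1\<close> exclude each other, so the second moment of the scaled
  residual controls that of each of its two summands.\<close>

lemma outcome_square_integrable:
  assumes s: "s \<in> {\<T> - 1, \<T>}"
  shows "integrable P (\<lambda>u. (of_bool (T u = s) * Yobs u)\<^sup>2)"
proof -
  let ?b = "\<lambda>u. 4 * (lam s)\<^sup>2 * ((B (S u))\<^sup>2 + (\<mu> \<T> (X u) / lam \<T>)\<^sup>2 + (\<mu> (\<T> - 1) (X u) / lam (\<T> - 1))\<^sup>2)"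
  have "integrable P ?b"
    using mu_square_integrable by (intro integrable_mult_right Bochner_Integration.integrable_add
      residual_square_integrable) (auto simp: power_divide)
  then show ?thesis
  proof (rule Bochner_Integration.integrable_bound)
    have ls: "lam s > 0" using s lam_T_pos by auto
    show "AE u in P. norm ((of_bool (T u = s) * Yobs u)\<^sup>2) \<le> norm (?b u)"
    proof (rule AE_I2)
      fix u
      let ?Z = "of_bool (T u = s) * Yobs u"
      define a where "a = B (S u)"
      define m where "m = \<mu> \<T> (X u) / lam \<T>"
      define m' where "m' = \<mu> (\<T> - 1) (X u) / lam (\<T> - 1)"
      \<comment> \<open>With the constant 4 the difference of the two sides is a sum of
        squares.\<close>
      have sq: "(a + m - m')\<^sup>2 \<le> 4 * (a\<^sup>2 + m\<^sup>2 + m'\<^sup>2)" for a m m' :: real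
      proof -
        have "4 * (a\<^sup>2 + m\<^sup>2 + m'\<^sup>2) - (a + m - m')\<^sup>2 = (a - m)\<^sup>2 + (a + m')\<^sup>2 + (m + m')\<^sup>2 + a\<^sup>2 + m\<^sup>2 + m'\<^sup>2"
          by (simp add: power2_eq_square algebra_simps)
        then show ?thesis by (smt (verit) zero_le_power2)
      qed
      have "(?Z / lam s)\<^sup>2 \<le> (a + m - m')\<^sup>2"
        using s periods_in(4) unfolding a_def m_def m'_def B_S trend_def
        by (cases "T u = s") (auto simp: power2_commute power_divide)
      also note sq
      finally have "?Z\<^sup>2 \<le> 4 * (lam s)\<^sup>2 * (a\<^sup>2 + m\<^sup>2 + m'\<^sup>2)"
        using ls by (simp add: power_divide field_simps)
      then show "norm (?Z\<^sup>2) \<le> norm (?b u)" by (simp add: a_def m_def m'_def)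
    qed
  qed measurable
qed

end

section \<open>Moment bounds for the error terms\<close>

definition obs_outcome :: "'x obs \<Rightarrow> real" where "obs_outcome s = fst s"
definition obs_group :: "'x obs \<Rightarrow> nat" where "obs_group s = fst (snd s)"
definition obs_period :: "'x obs \<Rightarrow> nat" where "obs_period s = fst (snd (snd s))"
definition obs_cov :: "'x obs \<Rightarrow> 'x" where "obs_cov s = snd (snd (snd s))"

lemma obs_proj_measurable[measurable]:
  "obs_outcome \<in> borel_measurable obs_measure"
  "obs_group \<in> obs_measure \<rightarrow>\<^sub>M count_space UNIV"
  "obs_period \<in> obs_measure \<rightarrow>\<^sub>M count_space UNIV"
  "obs_cov \<in> obs_measure \<rightarrow>\<^sub>M borel"
  unfolding obs_outcome_def obs_group_def obs_period_def obs_cov_def obs_measure_def by measurable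

lemma obs_proj_rc_obs[simp]:
  "obs_outcome (rc_obs \<T> Y1 Y0 G T X u) = observed_outcome \<T> Y1 Y0 G T u"
  "obs_group (rc_obs \<T> Y1 Y0 G T X u) = G u"
  "obs_period (rc_obs \<T> Y1 Y0 G T X u) = T u"
  "obs_cov (rc_obs \<T> Y1 Y0 G T X u) = X u"
  by (simp_all add: obs_outcome_def obs_group_def obs_period_def obs_cov_def rc_obs_def)

lemma group_contrast_treated: "group_contrast NG p w 1 x = 1"
  by (simp add: group_contrast_def)

lemma group_contrast_untreated:
  assumes "g \<in> {2..NG + 1}"
  shows "group_contrast NG p w g x = - (w g x * (p 1 x / p g x))"
proof -
  have "(\<Sum>h = 2..NG + 1. of_bool (g = h) * w h x * (p 1 x / p h x)) =
    (\<Sum>h = 2..NG + 1. if h = g then w g x * (p 1 x / p g x) else 0)"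
    by (intro sum.cong) auto
  also have "\<dots> = w g x * (p 1 x / p g x)" using assms by (subst sum.delta) auto
  finally show ?thesis using assms by (simp add: group_contrast_def)
qed

lemma group_contrast_other:
  assumes "g \<notin> {1..NG + 1}"
  shows "group_contrast NG p w g x = 0"
proof -
  have "(\<Sum>h = 2..NG + 1. of_bool (g = h) * w h x * (p 1 x / p h x)) = 0"
    using assms by (intro sum.neutral) auto
  moreover have "g \<noteq> 1" using assms by auto
  ultimately show ?thesis by (simp add: group_contrast_def)
qed

text \<open>The group indicators are disjoint, so at most one summand survives. Summing over all
  groups gives a bound free of \<open>g\<close>, which turns integrals over observations into
  integrals over covariates.\<close>

lemma group_contrast_square_le:
  "(group_contrast NG p w g x)\<^sup>2 \<le> 1 + (\<Sum>h = 2..NG + 1. (w h x * (p 1 x / p h x))\<^sup>2)"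
proof -
  consider "g = 1" | "g \<in> {2..NG + 1}" | "g \<notin> {1..NG + 1}" by force
  then show ?thesis
  proof cases
    case 1
    then show ?thesis by (simp only: group_contrast_treated) (simp add: sum_nonneg)
  next
    case 2
    have "(w g x * (p 1 x / p g x))\<^sup>2 \<le> (\<Sum>h = 2..NG + 1. (w h x * (p 1 x / p h x))\<^sup>2)"
      using 2 by (intro member_le_sum) auto
    then show ?thesis using group_contrast_untreated[OF 2, of p w x] by simp
  next
    case 3
    then show ?thesis by (simp add: group_contrast_other sum_nonneg)
  qed
qed

text \<open>Eventually \<open>f x \<le> 1\<close>, and then the square lies below \<open>f x\<close>
  itself.\<close>

lemma tendsto_0_ennreal_square:
  fixes f :: "'a \<Rightarrow> ennreal"
  assumes "(f \<longlongrightarrow> 0) F"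
  shows "((\<lambda>x. (f x)\<^sup>2) \<longlongrightarrow> 0) F"
proof (rule tendsto_0_ennreal_le[OF assms])
  show "eventually (\<lambda>x. (f x)\<^sup>2 \<le> f x) F"
  proof -
    have "eventually (\<lambda>x. f x \<le> ennreal 1) F" by (rule tendsto_0_ennrealD[OF assms]) simp
    then show ?thesis
    proof eventually_elim
      case (elim x)
      then have "f x * f x \<le> 1 * f x" by (intro mult_right_mono) auto
      then show ?case by (simp add: power2_eq_square)
    qed
  qed
qed

lemma tendsto_0_ennreal_cmult:
  fixes f :: "'a \<Rightarrow> ennreal"
  assumes "(f \<longlongrightarrow> 0) F" "c < \<top>"
  shows "((\<lambda>x. c * f x) \<longlongrightarrow> 0) F"
  using ennreal_tendsto_cmult[OF assms(2,1)] by simp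

lemma ennreal_mult_square: "ennreal ((a * b)\<^sup>2) = (ennreal \<bar>a\<bar>)\<^sup>2 * ennreal (b\<^sup>2)"
  by (simp add: power_mult_distrib ennreal_mult' ennreal_power)

lemma ennreal_one_plus_sum_mult:
  fixes y :: "'a \<Rightarrow> real"
  shows "ennreal ((1 + (\<Sum>h\<in>H. (y h)\<^sup>2)) * m\<^sup>2) = ennreal (m\<^sup>2) + (\<Sum>h\<in>H. ennreal ((y h)\<^sup>2) * ennreal (m\<^sup>2))"
proof -
  have "ennreal ((1 + (\<Sum>h\<in>H. (y h)\<^sup>2)) * m\<^sup>2) = ennreal (m\<^sup>2 + (\<Sum>h\<in>H. (y h)\<^sup>2 * m\<^sup>2))"
    by (simp add: distrib_right sum_distrib_right)
  also have "\<dots> = ennreal (m\<^sup>2) + ennreal (\<Sum>h\<in>H. (y h)\<^sup>2 * m\<^sup>2)"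
    by (rule ennreal_plus) (auto intro: sum_nonneg)
  also have "ennreal (\<Sum>h\<in>H. (y h)\<^sup>2 * m\<^sup>2) = (\<Sum>h\<in>H. ennreal ((y h)\<^sup>2) * ennreal (m\<^sup>2))"
    by (subst sum_ennreal[symmetric]) (auto simp: ennreal_mult')
  finally show ?thesis .
qed

lemma power2_sum_le_ennreal: "ennreal ((a + b)\<^sup>2) \<le> 2 * ennreal (a\<^sup>2) + 2 * ennreal (b\<^sup>2)"
proof -
  have "(a + b)\<^sup>2 \<le> 2 * a\<^sup>2 + 2 * b\<^sup>2"
    using zero_le_power2[of "a - b"] by (simp add: power2_eq_square algebra_simps)
  then have "ennreal ((a + b)\<^sup>2) \<le> ennreal (2 * a\<^sup>2 + 2 * b\<^sup>2)" by (rule ennreal_leI)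
  also have "\<dots> = 2 * ennreal (a\<^sup>2) + 2 * ennreal (b\<^sup>2)"
    by (simp add: ennreal_mult')
  finally show ?thesis .
qed

context rc_population
begin

lemma Q_facts:
  "prob_space Q" "sets Q = sets obs_measure"
  unfolding Q_def by (auto intro!: prob_space_distr)

lemma measurable_Q: "f \<in> measurable obs_measure R \<Longrightarrow> f \<in> measurable Q R"
  by (subst measurable_cong_sets[OF Q_facts(2) refl])

lemma nn_integral_cov:
  "f \<in> borel_measurable borel \<Longrightarrow> (\<integral>\<^sup>+s. f (obs_cov s) \<partial>Q) = (\<integral>\<^sup>+x. f x \<partial>FX)"
  unfolding FX_def by (subst nn_integral_Q) (auto simp: nn_integral_distr)

text \<open>Unlike the combination \<open>B\<close>, this is in general not centred given
  \<open>X\<close> within an untreated group: parallel trends restricts differences over time, while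
  \<open>\<mu> t\<close> is a level pooled over groups.\<close>

definition residual :: "nat \<Rightarrow> 'x obs \<Rightarrow> real" where
  "residual t s = of_bool (obs_period s = t) * obs_outcome s - \<mu> t (obs_cov s)"

abbreviation "contrast \<equiv> group_contrast NG p \<omega>"
abbreviation "ratio h x \<equiv> p 1 x / p h x"

lemma ratio_measurable: "h \<in> {2..NG + 1} \<Longrightarrow> (\<lambda>x. ratio h x) \<in> borel_measurable borel"
  by (intro borel_measurable_divide p_measurable) auto

lemma residual_measurable: "t \<in> {\<T> - 1, \<T>} \<Longrightarrow> residual t \<in> borel_measurable obs_measure"
  using mu_measurable[of t] unfolding residual_def by measurable

lemma B_residual: "B s = residual \<T> s / lam \<T> - residual (\<T> - 1) s / lam (\<T> - 1)"
  by (simp add: scaled_residual_def residual_def obs_outcome_def obs_period_def obs_cov_def split_beta)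

lemma residual_square: "t \<in> {\<T> - 1, \<T>} \<Longrightarrow> integrable Q (\<lambda>s. (residual t s)\<^sup>2)"
proof -
  assume t: "t \<in> {\<T> - 1, \<T>}"
  note mu_measurable[OF t, measurable] residual_measurable[OF t, measurable]
  have "integrable P (\<lambda>u. 2 * (of_bool (T u = t) * Yobs u)\<^sup>2 + 2 * (\<mu> t (X u))\<^sup>2)"
    using outcome_square_integrable[OF t] mu_square_integrable[OF t] by simp
  then have "integrable P (\<lambda>u. (residual t (S u))\<^sup>2)"
  proof (rule Bochner_Integration.integrable_bound)
    show "AE u in P. norm ((residual t (S u))\<^sup>2) \<le>
        norm (2 * (of_bool (T u = t) * Yobs u)\<^sup>2 + 2 * (\<mu> t (X u))\<^sup>2)"
    proof (rule AE_I2)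
      fix u
      have "(a - b)\<^sup>2 \<le> 2 * a\<^sup>2 + 2 * b\<^sup>2" for a b :: real
        using zero_le_power2[of "a + b"] by (simp add: power2_eq_square algebra_simps)
      from this[of "of_bool (T u = t) * Yobs u" "\<mu> t (X u)"]
      show "norm ((residual t (S u))\<^sup>2) \<le>
        norm (2 * (of_bool (T u = t) * Yobs u)\<^sup>2 + 2 * (\<mu> t (X u))\<^sup>2)"
        unfolding residual_def obs_proj_rc_obs by simp
    qed
  qed measurable
  then show ?thesis by (subst integrable_Q) measurable
qed

lemma group_residual_second_moment:
  "\<exists>C::real. C \<ge> 0 \<and> (\<forall>h\<in>{1..NG + 1}. \<forall>f\<in>borel_measurable borel.
    (\<integral>\<^sup>+s. ennreal ((of_bool (obs_group s = h) * f (obs_cov s) * B s)\<^sup>2) \<partial>Q) \<le>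
      ennreal C * (\<integral>\<^sup>+x. ennreal ((f x)\<^sup>2) \<partial>FX))"
proof -
  obtain C where C: "C \<ge> 0" "\<And>h f. h \<in> {1..NG + 1} \<Longrightarrow> f \<in> borel_measurable borel \<Longrightarrow>
    (\<integral>\<^sup>+u. of_bool (G u = h) * (f (X u) * ennreal ((B (S u))\<^sup>2)) \<partial>P) \<le> ennreal C * (\<integral>\<^sup>+x. f x \<partial>FX)"
    using residual_second_moment by blast
  have "(\<integral>\<^sup>+s. ennreal ((of_bool (obs_group s = h) * f (obs_cov s) * B s)\<^sup>2) \<partial>Q) \<le>
      ennreal C * (\<integral>\<^sup>+x. ennreal ((f x)\<^sup>2) \<partial>FX)"
    if h: "h \<in> {1..NG + 1}" and f[measurable]: "f \<in> borel_measurable borel" for h f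
  proof -
    have "(\<integral>\<^sup>+s. ennreal ((of_bool (obs_group s = h) * f (obs_cov s) * B s)\<^sup>2) \<partial>Q) =
      (\<integral>\<^sup>+u. of_bool (G u = h) * (ennreal ((f (X u))\<^sup>2) * ennreal ((B (S u))\<^sup>2)) \<partial>P)"
      by (subst nn_integral_Q, measurable)
         (auto intro!: nn_integral_cong simp: power_mult_distrib ennreal_mult')
    also have "\<dots> \<le> ennreal C * (\<integral>\<^sup>+x. ennreal ((f x)\<^sup>2) \<partial>FX)"
      by (rule C(2)[OF h]) measurable
    finally show ?thesis .
  qed
  then show ?thesis using C(1) by blast
qed

lemma group_residual_mean:
  assumes h: "h \<in> {2..NG + 1}" and f[measurable]: "f \<in> borel_measurable borel"
  shows "(\<integral>s. of_bool (obs_group s = h) * f (obs_cov s) * B s \<partial>Q) = 0"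
  using untreated_residual_mean[OF h f] by (subst integral_Q) auto

text \<open>The error of the product splits as
  \<open>w * (r - ratio) + ratio * (w - \<omega>)\<close>. In this order the estimated weight is
  bounded by its sup norm and the true ratio by overlap; no bound on the estimated ratio is
  assumed.\<close>

lemma weighted_ratio_L2:
  assumes h: "h \<in> {2..NG + 1}" and [measurable]: "w \<in> borel_measurable borel" "r \<in> borel_measurable borel"
    and c: "c \<ge> 0" "AE x in FX. \<bar>ratio h x\<bar> \<le> c"
  shows "(\<integral>\<^sup>+x. ennreal ((w x * r x - \<omega> h x * ratio h x)\<^sup>2) \<partial>FX) \<le>
    2 * (sup_norm (msupport FX) w * L2_norm FX (\<lambda>x. r x - ratio h x))\<^sup>2 +
    2 * (ennreal c * L2_norm FX (\<lambda>x. w x - \<omega> h x))\<^sup>2"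
proof -
  let ?W = "sup_norm (msupport FX) w"
  note h[THEN ratio_measurable, measurable] h[THEN omega, measurable]
  have ae: "AE x in FX. ennreal \<bar>w x\<bar> \<le> ?W" by (rule AE_le_sup_norm) simp
  have "(\<integral>\<^sup>+x. ennreal ((w x * r x - \<omega> h x * ratio h x)\<^sup>2) \<partial>FX) \<le>
    (\<integral>\<^sup>+x. 2 * (?W\<^sup>2 * ennreal ((r x - ratio h x)\<^sup>2)) + 2 * ((ennreal c)\<^sup>2 * ennreal ((w x - \<omega> h x)\<^sup>2)) \<partial>FX)"
  proof (rule nn_integral_mono_AE)
    show "AE x in FX. ennreal ((w x * r x - \<omega> h x * ratio h x)\<^sup>2) \<le>
      2 * (?W\<^sup>2 * ennreal ((r x - ratio h x)\<^sup>2)) + 2 * ((ennreal c)\<^sup>2 * ennreal ((w x - \<omega> h x)\<^sup>2))"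
      using ae c(2)
    proof eventually_elim
      case (elim x)
      have "a * b - c * d = a * (b - d) + d * (a - c)" for a b c d :: real
        by (simp add: algebra_simps)
      then have "ennreal ((w x * r x - \<omega> h x * ratio h x)\<^sup>2) \<le>
        2 * ennreal ((w x * (r x - ratio h x))\<^sup>2) + 2 * ennreal ((ratio h x * (w x - \<omega> h x))\<^sup>2)"
        by (simp only: power2_sum_le_ennreal)
      also have "ennreal ((w x * (r x - ratio h x))\<^sup>2) = (ennreal \<bar>w x\<bar>)\<^sup>2 * ennreal ((r x - ratio h x)\<^sup>2)"
        by (rule ennreal_mult_square)
      also have "ennreal ((ratio h x * (w x - \<omega> h x))\<^sup>2) = (ennreal \<bar>ratio h x\<bar>)\<^sup>2 * ennreal ((w x - \<omega> h x)\<^sup>2)"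
        by (rule ennreal_mult_square)
      also have "2 * ((ennreal \<bar>w x\<bar>)\<^sup>2 * ennreal ((r x - ratio h x)\<^sup>2)) +
          2 * ((ennreal \<bar>ratio h x\<bar>)\<^sup>2 * ennreal ((w x - \<omega> h x)\<^sup>2)) \<le>
        2 * (?W\<^sup>2 * ennreal ((r x - ratio h x)\<^sup>2)) + 2 * ((ennreal c)\<^sup>2 * ennreal ((w x - \<omega> h x)\<^sup>2))"
        using elim by (intro add_mono mult_left_mono mult_right_mono power_mono ennreal_leI) auto
      finally show ?case .
    qed
  qed
  also have "\<dots> = 2 * (?W\<^sup>2 * (\<integral>\<^sup>+x. ennreal ((r x - ratio h x)\<^sup>2) \<partial>FX)) +
      2 * ((ennreal c)\<^sup>2 * (\<integral>\<^sup>+x. ennreal ((w x - \<omega> h x)\<^sup>2) \<partial>FX))"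
    by (simp add: nn_integral_add nn_integral_cmult)
  also have "\<dots> = 2 * (?W * L2_norm FX (\<lambda>x. r x - ratio h x))\<^sup>2 +
    2 * (ennreal c * L2_norm FX (\<lambda>x. w x - \<omega> h x))\<^sup>2"
    by (simp add: L2_norm_square power_mult_distrib)
  finally show ?thesis .
qed

lemma group_contrast_measurable:
  assumes "\<And>h. h \<in> {2..NG + 1} \<Longrightarrow> w h \<in> borel_measurable borel"
    and "\<And>h. h \<in> {1..NG + 1} \<Longrightarrow> q h \<in> borel_measurable borel"
  shows "(\<lambda>s. group_contrast NG q w (obs_group s) (obs_cov s)) \<in> borel_measurable obs_measure"
proof -
  have [measurable]: "(\<lambda>s. w h (obs_cov s)) \<in> borel_measurable obs_measure" if "h \<in> {2..NG + 1}" for h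
    using measurable_compose[OF obs_proj_measurable(4) assms(1)[OF that]] .
  have [measurable]: "(\<lambda>s. q h (obs_cov s)) \<in> borel_measurable obs_measure" if "h \<in> {1..NG + 1}" for h
    using measurable_compose[OF obs_proj_measurable(4) assms(2)[OF that]] .
  show ?thesis
    unfolding group_contrast_def
    by (intro borel_measurable_diff borel_measurable_sum borel_measurable_times borel_measurable_divide) auto
qed

lemma contrast_measurable[measurable]:
  "(\<lambda>s. contrast (obs_group s) (obs_cov s)) \<in> borel_measurable obs_measure"
  by (intro group_contrast_measurable omega p_measurable)

text \<open>The contrast has the true propensities, so its ratios are bounded; the sup norms of the
  weights are the only random factors besides the norm of \<open>m\<close>.\<close>

lemma contrast_cov_second_moment:
  assumes w: "\<And>h. h \<in> {2..NG + 1} \<Longrightarrow> w h \<in> borel_measurable borel" and m[measurable]: "m \<in> borel_measurable borel"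
    and c: "c \<ge> 0" "\<And>h. h \<in> {2..NG + 1} \<Longrightarrow> AE x in FX. \<bar>ratio h x\<bar> \<le> c"
  shows "(\<integral>\<^sup>+s. ennreal ((group_contrast NG p w (obs_group s) (obs_cov s) * m (obs_cov s))\<^sup>2) \<partial>Q) \<le>
    (L2_norm FX m)\<^sup>2 + (\<Sum>h=2..NG+1. (ennreal c)\<^sup>2 * (sup_norm (msupport FX) (w h) * L2_norm FX m)\<^sup>2)"
proof -
  let ?W = "\<lambda>h. sup_norm (msupport FX) (w h)"
  have wr[measurable]: "(\<lambda>x. w h x * ratio h x) \<in> borel_measurable borel" if "h \<in> {2..NG + 1}" for h
    using that w ratio_measurable by auto
  let ?b = "\<lambda>x. ennreal ((1 + (\<Sum>h=2..NG+1. (w h x * ratio h x)\<^sup>2)) * (m x)\<^sup>2)"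
  have bm[measurable]: "?b \<in> borel_measurable borel"
    by (intro measurable_compose[OF _ measurable_ennreal] borel_measurable_times borel_measurable_add
        borel_measurable_sum borel_measurable_power wr) auto
  have "(\<integral>\<^sup>+s. ennreal ((group_contrast NG p w (obs_group s) (obs_cov s) * m (obs_cov s))\<^sup>2) \<partial>Q) \<le>
    (\<integral>\<^sup>+s. ?b (obs_cov s) \<partial>Q)"
    by (intro nn_integral_mono ennreal_leI)
       (subst power_mult_distrib, intro mult_right_mono group_contrast_square_le zero_le_power2)
  also have "\<dots> = (\<integral>\<^sup>+x. ?b x \<partial>FX)" by (rule nn_integral_cov[OF bm])
  also have "\<dots> \<le> (\<integral>\<^sup>+x. ennreal ((m x)\<^sup>2) + (\<Sum>h=2..NG+1. ((ennreal c)\<^sup>2 * (?W h)\<^sup>2) * ennreal ((m x)\<^sup>2)) \<partial>FX)"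
  proof (rule nn_integral_mono_AE)
    have "AE x in FX. \<forall>h\<in>{2..NG+1}. ennreal \<bar>w h x\<bar> \<le> ?W h \<and> \<bar>ratio h x\<bar> \<le> c"
      using c(2) AE_le_sup_norm[of FX] by (intro AE_finite_allI) auto
    then show "AE x in FX. ?b x \<le> ennreal ((m x)\<^sup>2) + (\<Sum>h=2..NG+1. ((ennreal c)\<^sup>2 * (?W h)\<^sup>2) * ennreal ((m x)\<^sup>2))"
    proof eventually_elim
      case (elim x)
      have "?b x = ennreal ((m x)\<^sup>2) + (\<Sum>h=2..NG+1. ennreal ((w h x * ratio h x)\<^sup>2) * ennreal ((m x)\<^sup>2))"
        by (rule ennreal_one_plus_sum_mult)
      also have "\<dots> = ennreal ((m x)\<^sup>2) + (\<Sum>h=2..NG+1. ((ennreal \<bar>ratio h x\<bar>)\<^sup>2 * (ennreal \<bar>w h x\<bar>)\<^sup>2) * ennreal ((m x)\<^sup>2))"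
        by (subst mult.commute[of "w _ x"], subst ennreal_mult_square) (simp add: ennreal_power)
      also have "\<dots> \<le> ennreal ((m x)\<^sup>2) + (\<Sum>h=2..NG+1. ((ennreal c)\<^sup>2 * (?W h)\<^sup>2) * ennreal ((m x)\<^sup>2))"
        using elim by (intro add_mono order_refl sum_mono mult_right_mono mult_mono power_mono ennreal_leI) auto
      finally show ?case .
    qed
  qed
  also have "\<dots> = (\<integral>\<^sup>+x. ennreal ((m x)\<^sup>2) \<partial>FX) +
    (\<Sum>h=2..NG+1. ((ennreal c)\<^sup>2 * (?W h)\<^sup>2) * (\<integral>\<^sup>+x. ennreal ((m x)\<^sup>2) \<partial>FX))"
    by (simp add: nn_integral_add nn_integral_sum nn_integral_cmult)
  also have "\<dots> = (L2_norm FX m)\<^sup>2 + (\<Sum>h=2..NG+1. (ennreal c)\<^sup>2 * (?W h * L2_norm FX m)\<^sup>2)"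
    by (simp add: L2_norm_square power_mult_distrib mult.assoc)
  finally show ?thesis .
qed

text \<open>In each untreated term the group probability \<open>p h\<close> cancels the denominator
  of the true ratio and leaves \<open>p 1 * w h * m\<close>. As the weights sum to one, these terms
  add up to the treated term. With an estimated ratio the cancellation would not be exact.\<close>

lemma contrast_cov_mean:
  assumes w: "\<And>h. h \<in> {2..NG + 1} \<Longrightarrow> w h \<in> borel_measurable borel" and m[measurable]: "m \<in> borel_measurable borel"
    and W: "\<And>h. h \<in> {2..NG + 1} \<Longrightarrow> sup_norm (msupport FX) (w h) < \<top>" and mfin: "L2_norm FX m < \<top>"
    and sum1: "\<And>x. x \<in> msupport FX \<Longrightarrow> (\<Sum>h=2..NG+1. w h x) = 1"
  shows "(\<integral>s. group_contrast NG p w (obs_group s) (obs_cov s) * m (obs_cov s) \<partial>Q) = 0"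
proof -
  interpret FX: prob_space FX by (rule prob_space_FX)
  have m2: "integrable FX (\<lambda>x. (m x)\<^sup>2)" using mfin by (auto simp: L2_norm_def split: if_splits)
  have m1: "integrable FX m" by (rule FX.square_integrable_imp_integrable[OF _ m2]) measurable
  obtain c where c: "c \<ge> 0" "\<And>h. h \<in> {2..NG + 1} \<Longrightarrow> AE x in FX. \<bar>ratio h x\<bar> \<le> c" using ratio_bounded by auto
  let ?f = "\<lambda>h x. w h x * ratio h x * m x"
  have fm: "?f h \<in> borel_measurable borel" if "h \<in> {2..NG + 1}" for h
    using that w ratio_measurable by auto
  have f1: "integrable FX (?f h)" if h: "h \<in> {2..NG + 1}" for h
  proof -
    obtain v where v: "sup_norm (msupport FX) (w h) = ennreal v" "v \<ge> 0"
      using W[OF h] by (cases "sup_norm (msupport FX) (w h)") auto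
    have "AE x in FX. ennreal \<bar>w h x\<bar> \<le> ennreal v" using AE_le_sup_norm[of FX "w h"] v by simp
    then have "AE x in FX. \<bar>w h x\<bar> \<le> v" using v by simp
    with c(2)[OF h] have ae: "AE x in FX. norm (?f h x) \<le> norm (v * c * m x)"
    proof eventually_elim
      case (elim x)
      then have "\<bar>w h x\<bar> * \<bar>ratio h x\<bar> * \<bar>m x\<bar> \<le> v * c * \<bar>m x\<bar>"
        using v c(1) by (intro mult_right_mono mult_mono) auto
      then show ?case using v c(1) by (simp add: abs_mult)
    qed
    have int: "integrable FX (\<lambda>x. v * c * m x)" using m1 by simp
    show ?thesis
      by (rule Bochner_Integration.integrable_bound[OF int _ ae]) (use fm[OF h] in simp)
  qed
  have iG: "integrable P (\<lambda>u. of_bool (G u = g) * f (X u))"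
    if "integrable FX f" "f \<in> borel_measurable borel" for f :: "'x \<Rightarrow> real" and g
    using that by (intro integrable_of_bool_mult) (auto simp: integrable_FX)
  have meas: "(\<lambda>s. group_contrast NG p w (obs_group s) (obs_cov s) * m (obs_cov s)) \<in> borel_measurable obs_measure"
    using w by (intro borel_measurable_times group_contrast_measurable p_measurable) auto
  have p1: "integrable FX (\<lambda>x. p 1 x * m x)"
  proof (rule Bochner_Integration.integrable_bound[OF m1])
    have "AE x in FX. 0 < p 1 x \<and> p 1 x \<le> 1" by (rule p_bounds) simp
    then show "AE x in FX. norm (p 1 x * m x) \<le> norm (m x)"
      by eventually_elim (simp add: abs_mult mult_left_le_one_le)
    have "p 1 \<in> borel_measurable borel" by (rule p_measurable) simp
    then show "(\<lambda>x. p 1 x * m x) \<in> borel_measurable FX" by simp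
  qed
  have "(\<integral>s. group_contrast NG p w (obs_group s) (obs_cov s) * m (obs_cov s) \<partial>Q) =
    (\<integral>u. group_contrast NG p w (G u) (X u) * m (X u) \<partial>P)"
    by (subst integral_Q[OF meas]) simp
  also have "\<dots> = (\<integral>u. of_bool (G u = 1) * m (X u) - (\<Sum>h=2..NG+1. of_bool (G u = h) * ?f h (X u)) \<partial>P)"
    by (intro Bochner_Integration.integral_cong)
       (simp_all add: group_contrast_def left_diff_distrib sum_distrib_right mult.assoc)
  also have "\<dots> = (\<integral>u. of_bool (G u = 1) * m (X u) \<partial>P) - (\<Sum>h=2..NG+1. \<integral>u. of_bool (G u = h) * ?f h (X u) \<partial>P)"
  proof -
    have i: "integrable P (\<lambda>u. of_bool (G u = h) * ?f h (X u))" if "h \<in> {2..NG + 1}" for h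
      by (rule iG[OF f1[OF that] fm[OF that]])
    have "(\<integral>u. of_bool (G u = 1) * m (X u) - (\<Sum>h=2..NG+1. of_bool (G u = h) * ?f h (X u)) \<partial>P) =
      (\<integral>u. of_bool (G u = 1) * m (X u) \<partial>P) - (\<integral>u. (\<Sum>h=2..NG+1. of_bool (G u = h) * ?f h (X u)) \<partial>P)"
      by (rule Bochner_Integration.integral_diff[OF iG[OF m1 m] Bochner_Integration.integrable_sum[OF i]])
    then show ?thesis by (simp only: Bochner_Integration.integral_sum[OF i])
  qed
  also have "(\<integral>u. of_bool (G u = 1) * m (X u) \<partial>P) = (\<integral>x. p 1 x * m x \<partial>FX)"
    by (rule integral_group[OF _ m m1]) simp
  also have "(\<Sum>h=2..NG+1. \<integral>u. of_bool (G u = h) * ?f h (X u) \<partial>P) = (\<Sum>h=2..NG+1. \<integral>x. p h x * ?f h x \<partial>FX)"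
  proof (rule sum.cong[OF refl])
    fix h assume h: "h \<in> {2..NG + 1}"
    show "(\<integral>u. of_bool (G u = h) * ?f h (X u) \<partial>P) = (\<integral>x. p h x * ?f h x \<partial>FX)"
      using h by (intro integral_group[OF _ fm[OF h] f1[OF h]]) auto
  qed
  also have "\<dots> = (\<integral>x. (\<Sum>h=2..NG+1. p h x * ?f h x) \<partial>FX)"
  proof (rule Bochner_Integration.integral_sum[symmetric])
    fix h assume h: "h \<in> {2..NG + 1}"
    then have h': "h \<in> {1..NG + 1}" by auto
    show "integrable FX (\<lambda>x. p h x * ?f h x)"
    proof (rule Bochner_Integration.integrable_bound[OF f1[OF h]])
      have le: "norm (q * y) \<le> norm y" if "0 < q \<and> q \<le> 1" for q y :: real
        using that by (simp add: abs_mult mult_left_le_one_le)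
      from p_bounds[OF h'] show "AE x in FX. norm (p h x * ?f h x) \<le> norm (?f h x)"
        by eventually_elim (rule le)
      show "(\<lambda>x. p h x * ?f h x) \<in> borel_measurable FX"
        unfolding measurable_cong_sets[OF sets_FX refl]
        by (rule borel_measurable_times[OF p_measurable[OF h'] fm[OF h]])
    qed
  qed
  also have "\<dots> = (\<integral>x. p 1 x * m x \<partial>FX)"
  proof (rule integral_cong_AE)
    have "AE x in FX. \<forall>h\<in>{2..NG+1}. p h x \<noteq> 0"
    proof (rule AE_finite_allI)
      fix h assume "h \<in> {2..NG + 1}"
      then have "h \<in> {1..NG + 1}" by auto
      from p_bounds[OF this] show "AE x in FX. p h x \<noteq> 0" by eventually_elim auto
    qed simp
    \<comment> \<open>The weights are known to sum to one on the support only, but the support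
      carries all the mass.\<close>
    moreover have "AE x in FX. x \<in> msupport FX" by (rule AE_in_msupport) simp
    ultimately show "AE x in FX. (\<Sum>h=2..NG+1. p h x * ?f h x) = p 1 x * m x"
    proof eventually_elim
      case (elim x)
      have "(\<Sum>h=2..NG+1. p h x * ?f h x) = (\<Sum>h=2..NG+1. w h x * (p 1 x * m x))"
        using elim by (intro sum.cong) auto
      also have "\<dots> = p 1 x * m x"
        using sum1[OF elim(2)] by (simp add: sum_distrib_right[symmetric])
      finally show ?case .
    qed
    have "(\<lambda>x. p h x * ?f h x) \<in> borel_measurable FX" if h: "h \<in> {2..NG + 1}" for h
    proof -
      from h have h': "h \<in> {1..NG + 1}" by auto
      show ?thesis
        unfolding measurable_cong_sets[OF sets_FX refl]
        by (rule borel_measurable_times[OF p_measurable[OF h'] fm[OF h]])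
    qed
    then show "(\<lambda>x. \<Sum>h=2..NG+1. p h x * ?f h x) \<in> borel_measurable FX"
      by (rule borel_measurable_sum)
  qed (rule borel_measurable_integrable[OF p1])
  finally show ?thesis by simp
qed

text \<open>With errors in both nuisance functions there is no centring to exploit, so the absolute
  value is bounded by Cauchy-Schwarz; the result is the product to which the product rate
  applies.\<close>

lemma ratio_error_first_moment:
  assumes h: "h \<in> {2..NG + 1}"
    and [measurable]: "w \<in> borel_measurable borel" "r \<in> borel_measurable borel" "m \<in> borel_measurable borel"
  shows "(\<integral>\<^sup>+s. ennreal \<bar>of_bool (obs_group s = h) * (w (obs_cov s) * (r (obs_cov s) - ratio h (obs_cov s))) *
      m (obs_cov s)\<bar> \<partial>Q) \<le>
    sup_norm (msupport FX) w * (L2_norm FX (\<lambda>x. r x - ratio h x) * L2_norm FX m)"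
proof -
  let ?W = "sup_norm (msupport FX) w"
  note h[THEN ratio_measurable, measurable]
  have "(\<integral>\<^sup>+s. ennreal \<bar>of_bool (obs_group s = h) * (w (obs_cov s) * (r (obs_cov s) - ratio h (obs_cov s))) *
      m (obs_cov s)\<bar> \<partial>Q) \<le> (\<integral>\<^sup>+s. (\<lambda>x. ennreal \<bar>w x * ((r x - ratio h x) * m x)\<bar>) (obs_cov s) \<partial>Q)"
    by (intro nn_integral_mono ennreal_leI) (auto simp: abs_mult mult_ac)
  also have "\<dots> = (\<integral>\<^sup>+x. ennreal \<bar>w x * ((r x - ratio h x) * m x)\<bar> \<partial>FX)"
    by (rule nn_integral_cov) measurable
  also have "\<dots> \<le> (\<integral>\<^sup>+x. ?W * ennreal \<bar>(r x - ratio h x) * m x\<bar> \<partial>FX)"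
  proof (rule nn_integral_mono_AE)
    have "AE x in FX. ennreal \<bar>w x\<bar> \<le> ?W" by (rule AE_le_sup_norm) simp
    then show "AE x in FX. ennreal \<bar>w x * ((r x - ratio h x) * m x)\<bar> \<le> ?W * ennreal \<bar>(r x - ratio h x) * m x\<bar>"
      by eventually_elim (simp only: abs_mult[of "w _"] ennreal_mult' abs_ge_zero, rule mult_right_mono, auto)
  qed
  also have "\<dots> = ?W * (\<integral>\<^sup>+x. ennreal \<bar>(r x - ratio h x) * m x\<bar> \<partial>FX)"
    by (rule nn_integral_cmult) measurable
  also have "\<dots> \<le> ?W * (L2_norm FX (\<lambda>x. r x - ratio h x) * L2_norm FX m)"
    by (intro mult_left_mono nn_integral_mult_le_L2) auto
  finally show ?thesis .
qed

lemma group_cov_residual_first_moment: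
  assumes t: "t \<in> {\<T> - 1, \<T>}" and f[measurable]: "f \<in> borel_measurable borel"
  shows "(\<integral>\<^sup>+s. ennreal \<bar>of_bool (obs_group s = h) * f (obs_cov s) * residual t s\<bar> \<partial>Q) \<le>
    L2_norm FX f * L2_norm Q (residual t)"
proof -
  note residual_measurable[OF t, measurable]
  have "(\<integral>\<^sup>+s. ennreal \<bar>of_bool (obs_group s = h) * f (obs_cov s) * residual t s\<bar> \<partial>Q) \<le>
    (\<integral>\<^sup>+s. ennreal \<bar>f (obs_cov s) * residual t s\<bar> \<partial>Q)"
    by (intro nn_integral_mono ennreal_leI) auto
  also have "\<dots> \<le> L2_norm Q (\<lambda>s. f (obs_cov s)) * L2_norm Q (residual t)"
    by (intro nn_integral_mult_le_L2 measurable_Q) measurable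
  also have "L2_norm Q (\<lambda>s. f (obs_cov s)) = L2_norm FX f"
  proof (rule antisym; rule power2_le_power2_ennrealD)
    have fQ: "(\<lambda>s. f (obs_cov s)) \<in> borel_measurable Q" by (rule measurable_Q) measurable
    have "(L2_norm Q (\<lambda>s. f (obs_cov s)))\<^sup>2 = (L2_norm FX f)\<^sup>2"
      by (subst L2_norm_square[OF fQ], subst L2_norm_square, simp, rule nn_integral_cov) simp
    then show "(L2_norm Q (\<lambda>s. f (obs_cov s)))\<^sup>2 \<le> (L2_norm FX f)\<^sup>2"
      "(L2_norm FX f)\<^sup>2 \<le> (L2_norm Q (\<lambda>s. f (obs_cov s)))\<^sup>2" by simp_all
  qed
  finally show ?thesis .
qed

lemma residual_L2: "t \<in> {\<T> - 1, \<T>} \<Longrightarrow> L2_norm Q (residual t) < \<top>"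
  using residual_square by (auto simp: L2_norm_def)

lemma contrast_bounded: "\<exists>c\<ge>0. AE s in Q. \<bar>contrast (obs_group s) (obs_cov s)\<bar> \<le> c"
proof -
  obtain c where c: "c \<ge> 0" "\<And>h. h \<in> {2..NG + 1} \<Longrightarrow> AE x in FX. \<bar>ratio h x\<bar> \<le> c" using ratio_bounded by auto
  obtain v where v: "v \<ge> 0" "\<And>h. h \<in> {2..NG + 1} \<Longrightarrow> AE x in FX. \<bar>\<omega> h x\<bar> \<le> v" using omega_bounded by auto
  have "AE x in FX. \<forall>h\<in>{2..NG+1}. \<bar>ratio h x\<bar> \<le> c \<and> \<bar>\<omega> h x\<bar> \<le> v"
    using c(2) v(2) by (intro AE_finite_allI) auto
  then have "AE u in P. \<forall>h\<in>{2..NG+1}. \<bar>ratio h (X u)\<bar> \<le> c \<and> \<bar>\<omega> h (X u)\<bar> \<le> v" by (rule AE_FX_D)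
  then have "AE u in P. \<bar>contrast (G u) (X u)\<bar> \<le> 1 + v * c"
  proof eventually_elim
    case (elim u)
    consider "G u = 1" | "G u \<in> {2..NG + 1}" | "G u \<notin> {1..NG + 1}" by force
    then show ?case
    proof cases
      case 1
      then show ?thesis using c v by (simp add: group_contrast_treated)
    next
      case 2
      have "\<bar>contrast (G u) (X u)\<bar> = \<bar>\<omega> (G u) (X u)\<bar> * \<bar>ratio (G u) (X u)\<bar>"
        by (simp only: group_contrast_untreated[OF 2] abs_minus_cancel abs_mult)
      also have "\<dots> \<le> v * c" using elim 2 v c by (intro mult_mono) auto
      finally show ?thesis by simp
    next
      case 3
      then show ?thesis using c v by (simp add: group_contrast_other)
    qed
  qed
  then have "AE u in P. \<bar>contrast (obs_group (S u)) (obs_cov (S u))\<bar> \<le> 1 + v * c" by simp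
  then have "AE s in Q. \<bar>contrast (obs_group s) (obs_cov s)\<bar> \<le> 1 + v * c"
    unfolding Q_def by (subst AE_distr_iff) auto
  then show ?thesis using c v by (intro exI[of _ "1 + v * c"]) auto
qed

lemma contrast_square_integrable:
  assumes f: "f \<in> borel_measurable obs_measure" "integrable Q (\<lambda>s. (f s)\<^sup>2)"
  shows "integrable Q (\<lambda>s. (contrast (obs_group s) (obs_cov s) * f s)\<^sup>2)"
proof -
  obtain c where c: "c \<ge> 0" "AE s in Q. \<bar>contrast (obs_group s) (obs_cov s)\<bar> \<le> c" using contrast_bounded by auto
  have "integrable Q (\<lambda>s. c\<^sup>2 * (f s)\<^sup>2)" using f by simp
  then show ?thesis
  proof (rule Bochner_Integration.integrable_bound)
    show "AE s in Q. norm ((contrast (obs_group s) (obs_cov s) * f s)\<^sup>2) \<le> norm (c\<^sup>2 * (f s)\<^sup>2)"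
      using c(2)
    proof eventually_elim
      case (elim s)
      then have "(contrast (obs_group s) (obs_cov s))\<^sup>2 \<le> c\<^sup>2" using c(1) by (intro power2_le_iff_abs_le[THEN iffD2]) auto
      then show ?case by (auto simp: power_mult_distrib intro!: mult_right_mono)
    qed
    show "(\<lambda>s. (contrast (obs_group s) (obs_cov s) * f s)\<^sup>2) \<in> borel_measurable Q"
      using f by (intro measurable_Q) measurable
  qed
qed

lemma B_square: "integrable Q (\<lambda>s. (B s)\<^sup>2)"
  using residual_square_integrable by (subst integrable_Q) auto

text \<open>In each untreated group \<open>B\<close> is centred given \<open>X\<close>, so these
  terms have mean zero whatever the weights are. Only the treated term remains, and every limit
  \<open>\<omega>\<close> leads to the same \<open>\<theta>\<close>.\<close>

lemma contrast_residual_mean: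
  "(\<integral>s. contrast (obs_group s) (obs_cov s) * B s \<partial>Q) = pi1 * \<theta>"
proof -
  interpret Q: prob_space Q by (rule Q_facts)
  obtain c where c: "c \<ge> 0" "\<And>h. h \<in> {2..NG + 1} \<Longrightarrow> AE x in FX. \<bar>ratio h x\<bar> \<le> c" using ratio_bounded by auto
  obtain v where v: "v \<ge> 0" "\<And>h. h \<in> {2..NG + 1} \<Longrightarrow> AE x in FX. \<bar>\<omega> h x\<bar> \<le> v" using omega_bounded by auto
  have iB: "integrable P (\<lambda>u. B (S u))"
    by (rule square_integrable_imp_integrable[OF _ residual_square_integrable]) measurable
  have i: "integrable P (\<lambda>u. of_bool (G u = h) * (\<omega> h (X u) * ratio h (X u)) * B (S u))" if h: "h \<in> {2..NG + 1}" for h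
  proof -
    have "AE u in P. \<bar>ratio h (X u)\<bar> \<le> c \<and> \<bar>\<omega> h (X u)\<bar> \<le> v"
      using AE_FX_D[OF c(2)[OF h]] AE_FX_D[OF v(2)[OF h]] by eventually_elim simp
    then have ae: "AE u in P. norm (of_bool (G u = h) * (\<omega> h (X u) * ratio h (X u)) * B (S u)) \<le> norm (v * c * B (S u))"
    proof eventually_elim
      case (elim u)
      then have "\<bar>\<omega> h (X u)\<bar> * \<bar>ratio h (X u)\<bar> * \<bar>B (S u)\<bar> \<le> v * c * \<bar>B (S u)\<bar>"
        using v c(1) by (intro mult_right_mono mult_mono) auto
      then show ?case using v c(1) by (auto simp: abs_mult)
    qed
    have int: "integrable P (\<lambda>u. v * c * B (S u))" using iB by simp
    note ratio_measurable[OF h, measurable] omega[OF h, measurable]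
    show ?thesis
      by (rule Bochner_Integration.integrable_bound[OF int _ ae]) measurable
  qed
  have "(\<integral>s. contrast (obs_group s) (obs_cov s) * B s \<partial>Q) = (\<integral>u. contrast (G u) (X u) * B (S u) \<partial>P)"
    by (subst integral_Q) auto
  also have "\<dots> = (\<integral>u. of_bool (G u = 1) * B (S u) -
      (\<Sum>h=2..NG+1. of_bool (G u = h) * (\<omega> h (X u) * ratio h (X u)) * B (S u)) \<partial>P)"
    by (intro Bochner_Integration.integral_cong)
       (simp_all add: group_contrast_def left_diff_distrib sum_distrib_right mult.assoc)
  also have "\<dots> = (\<integral>u. of_bool (G u = 1) * B (S u) \<partial>P) -
      (\<integral>u. (\<Sum>h=2..NG+1. of_bool (G u = h) * (\<omega> h (X u) * ratio h (X u)) * B (S u)) \<partial>P)"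
    by (rule Bochner_Integration.integral_diff[OF integrable_of_bool_mult[OF iB] Bochner_Integration.integrable_sum[OF i]]) measurable
  also have "(\<integral>u. (\<Sum>h=2..NG+1. of_bool (G u = h) * (\<omega> h (X u) * ratio h (X u)) * B (S u)) \<partial>P) =
    (\<Sum>h=2..NG+1. \<integral>u. of_bool (G u = h) * (\<omega> h (X u) * ratio h (X u)) * B (S u) \<partial>P)"
    by (rule Bochner_Integration.integral_sum[OF i])
  also have "\<dots> = 0"
  proof (rule sum.neutral, rule ballI)
    fix h assume h: "h \<in> {2..NG + 1}"
    show "(\<integral>u. of_bool (G u = h) * (\<omega> h (X u) * ratio h (X u)) * B (S u) \<partial>P) = 0"
      by (rule untreated_residual_mean[OF h borel_measurable_times[OF omega[OF h] ratio_measurable[OF h]]])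
  qed
  finally show ?thesis using treated_residual_mean by simp
qed

end

section \<open>Cross-fitted error terms\<close>

text \<open>An infinite value exceeds every real bound. Finiteness of the sup norms is what makes
  the conditional mean in \<open>contrast_cov_mean\<close> meaningful.\<close>

lemma bigO_p_eventually_finite:
  assumes Z: "bigO_p M (\<lambda>n. 1) Z"
  shows "eventually (\<lambda>(n, \<xi>). Z n \<xi> < \<top>) (in_prob M)"
  unfolding eventually_in_prob
proof (rule tendsto_0_ennrealI)
  fix \<epsilon> :: real assume "\<epsilon> > 0"
  with Z obtain C where C: "\<forall>\<^sub>F n in sequentially.
      outer_measure_of M {\<xi> \<in> space M. Z n \<xi> > ennreal (C * 1)} \<le> ennreal \<epsilon>"
    unfolding bigO_p_def by blast
  then show "\<forall>\<^sub>F n in sequentially.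
      outer_measure_of M {\<xi> \<in> space M. \<not> (case (n, \<xi>) of (n, \<xi>) \<Rightarrow> Z n \<xi> < \<top>)} \<le> ennreal \<epsilon>"
  proof eventually_elim
    case (elim n)
    have "outer_measure_of M {\<xi> \<in> space M. \<not> (case (n, \<xi>) of (n, \<xi>) \<Rightarrow> Z n \<xi> < \<top>)} \<le>
      outer_measure_of M {\<xi> \<in> space M. Z n \<xi> > ennreal (C * 1)}"
      by (intro outer_measure_of_mono) (auto simp: less_top[symmetric])
    then show ?case using elim by simp
  qed
qed

lemma measurable_obs_cov_pair:
  assumes "(\<lambda>(d, x). f d x) \<in> borel_measurable (R \<Otimes>\<^sub>M borel)"
  shows "(\<lambda>z. f (fst z) (obs_cov (snd z))) \<in> borel_measurable (R \<Otimes>\<^sub>M obs_measure)"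
proof -
  have "(\<lambda>z. (fst z, obs_cov (snd z))) \<in> R \<Otimes>\<^sub>M obs_measure \<rightarrow>\<^sub>M R \<Otimes>\<^sub>M borel" by measurable
  from measurable_compose[OF this assms] show ?thesis by simp
qed

locale rc_estimation =
  rc_population P NG \<T> Y1 Y0 G T X p \<mu> \<omega> FX lam pi1 \<theta> Q +
  iid: iid_sample M obs_measure Q Z
  for P :: "'p measure" and NG \<T> Y1 Y0 G T and X :: "'p \<Rightarrow> 'x::euclidean_space"
    and p \<mu> \<omega> FX lam pi1 \<theta> Q
    and M :: "'s measure" and Z :: "nat \<Rightarrow> 's \<Rightarrow> 'x obs" +
  fixes L :: nat and I :: "nat \<Rightarrow> nat \<Rightarrow> nat set"
    and \<mu>h ph wh :: "nat \<Rightarrow> nat \<Rightarrow> nat \<Rightarrow> 'x estimator"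
  assumes folds: "equal_folds L I"
    and estimators: "\<And>n l. l \<in> {1..L} \<Longrightarrow>
      (\<forall>t\<in>{\<T> - 1, \<T>}. fold_estimator I n l (\<mu>h n l t)) \<and>
      (\<forall>g\<in>{1..NG + 1}. fold_estimator I n l (ph n l g)) \<and>
      (\<forall>g\<in>{2..NG + 1}. fold_estimator I n l (wh n l g))"
    and weights_sum: "\<And>n l. n \<ge> 1 \<Longrightarrow> l \<in> {1..L} \<Longrightarrow> AE \<xi> in M. \<forall>x\<in>msupport FX.
      (\<Sum>g = 2..NG + 1. wh n l g (training I Z n l \<xi>) x) = 1"
    and weights_bounded: "\<And>l g. l \<in> {1..L} \<Longrightarrow> g \<in> {2..NG + 1} \<Longrightarrow>
      bigO_p M (\<lambda>n. 1) (\<lambda>n \<xi>. sup_norm (msupport FX) (wh n l g (training I Z n l \<xi>)))"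
    and mu_rate: "\<And>l t. l \<in> {1..L} \<Longrightarrow> t \<in> {\<T> - 1, \<T>} \<Longrightarrow>
      smallo_p M (\<lambda>n. 1) (\<lambda>n \<xi>. L2_norm FX (\<lambda>x. \<mu>h n l t (training I Z n l \<xi>) x - \<mu> t x))"
    and p_rate: "\<And>l g. l \<in> {1..L} \<Longrightarrow> g \<in> {2..NG + 1} \<Longrightarrow>
      smallo_p M (\<lambda>n. 1) (\<lambda>n \<xi>. L2_norm FX (\<lambda>x.
        ph n l 1 (training I Z n l \<xi>) x / ph n l g (training I Z n l \<xi>) x - p 1 x / p g x))"
    and w_rate: "\<And>l g. l \<in> {1..L} \<Longrightarrow> g \<in> {2..NG + 1} \<Longrightarrow>
      smallo_p M (\<lambda>n. 1) (\<lambda>n \<xi>. L2_norm FX (\<lambda>x. wh n l g (training I Z n l \<xi>) x - \<omega> g x))"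
    and product_rate: "\<And>l g t. l \<in> {1..L} \<Longrightarrow> g \<in> {2..NG + 1} \<Longrightarrow> t \<in> {\<T> - 1, \<T>} \<Longrightarrow>
      smallo_p M (\<lambda>n. 1 / sqrt (real n)) (\<lambda>n \<xi>.
        L2_norm FX (\<lambda>x.
          ph n l 1 (training I Z n l \<xi>) x / ph n l g (training I Z n l \<xi>) x - p 1 x / p g x) *
        L2_norm FX (\<lambda>x. \<mu>h n l t (training I Z n l \<xi>) x - \<mu> t x))"
begin

abbreviation "TR n l \<equiv> PiM (off_fold I n l) (\<lambda>_. obs_measure :: 'x obs measure)"
abbreviation "tr n l \<xi> \<equiv> training I Z n l \<xi>"
abbreviation "ratioh n l h d x \<equiv> ph n l 1 d x / ph n l h d x"

lemma fold_facts:
  assumes l: "l \<in> {1..L}"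
  shows "off_fold I n l \<inter> I n l = {}" "finite (off_fold I n l)" "off_fold I n l \<subseteq> {1..}"
    "I n l \<subseteq> {1..n}" "finite (I n l)"
proof -
  have "(\<Union>l\<in>{1..L}. I n l) = {1..n}" using folds unfolding equal_folds_def by blast
  then show "I n l \<subseteq> {1..n}" using l by blast
  then show "finite (I n l)" by (rule finite_subset) simp
qed (auto simp: off_fold_def)

lemma sum_folds: "(\<Sum>l=1..L. \<Sum>i\<in>I n l. f i) = (\<Sum>i=1..n. f i)" for f :: "nat \<Rightarrow> real"
proof -
  have *: "(\<Union>l\<in>{1..L}. I n l) = {1..n}" "disjoint_family_on (I n) {1..L}"
    using folds unfolding equal_folds_def by auto
  have "(\<Sum>i\<in>(\<Union>l\<in>{1..L}. I n l). f i) = (\<Sum>l=1..L. \<Sum>i\<in>I n l. f i)"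
    using *(2) fold_facts(5) by (intro sum.UNION_disjoint) (auto simp: disjoint_family_on_def)
  then show ?thesis by (simp add: *(1))
qed

lemma estimator_measurable:
  assumes l: "l \<in> {1..L}"
  shows "t \<in> {\<T> - 1, \<T>} \<Longrightarrow> (\<lambda>(d, x). \<mu>h n l t d x) \<in> borel_measurable (TR n l \<Otimes>\<^sub>M borel)"
    and "g \<in> {1..NG + 1} \<Longrightarrow> (\<lambda>(d, x). ph n l g d x) \<in> borel_measurable (TR n l \<Otimes>\<^sub>M borel)"
    and "g \<in> {2..NG + 1} \<Longrightarrow> (\<lambda>(d, x). wh n l g d x) \<in> borel_measurable (TR n l \<Otimes>\<^sub>M borel)"
  using estimators[OF l, of n] unfolding fold_estimator_def by blast+

lemma training_eq: "tr n l \<xi> = restrict (\<lambda>i. Z i \<xi>) (off_fold I n l)"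
  by (simp add: training_def)

lemma training_measurable: "l \<in> {1..L} \<Longrightarrow> tr n l \<in> measurable M (TR n l)"
  unfolding training_eq[abs_def] by (intro iid.restrict_S_measurable fold_facts)

lemma estimator_section:
  assumes l: "l \<in> {1..L}" and \<xi>: "\<xi> \<in> space M"
  shows "t \<in> {\<T> - 1, \<T>} \<Longrightarrow> \<mu>h n l t (tr n l \<xi>) \<in> borel_measurable borel"
    and "g \<in> {1..NG + 1} \<Longrightarrow> ph n l g (tr n l \<xi>) \<in> borel_measurable borel"
    and "g \<in> {2..NG + 1} \<Longrightarrow> wh n l g (tr n l \<xi>) \<in> borel_measurable borel"
proof -
  have d: "tr n l \<xi> \<in> space (TR n l)" using measurable_space[OF training_measurable[OF l] \<xi>] .
  have sec: "f (tr n l \<xi>) \<in> borel_measurable borel"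
    if "(\<lambda>(d, x). f d x) \<in> borel_measurable (TR n l \<Otimes>\<^sub>M borel)" for f :: "'x estimator"
    using measurable_Pair2[OF that d] by simp
  show "t \<in> {\<T> - 1, \<T>} \<Longrightarrow> \<mu>h n l t (tr n l \<xi>) \<in> borel_measurable borel"
    and "g \<in> {1..NG + 1} \<Longrightarrow> ph n l g (tr n l \<xi>) \<in> borel_measurable borel"
    and "g \<in> {2..NG + 1} \<Longrightarrow> wh n l g (tr n l \<xi>) \<in> borel_measurable borel"
    by (intro sec estimator_measurable[OF l]; assumption)+
qed

lemma estimator_obs_measurable:
  assumes l: "l \<in> {1..L}"
  shows "t \<in> {\<T> - 1, \<T>} \<Longrightarrow> (\<lambda>z. \<mu>h n l t (fst z) (obs_cov (snd z))) \<in> borel_measurable (TR n l \<Otimes>\<^sub>M obs_measure)"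
    and "g \<in> {1..NG + 1} \<Longrightarrow> (\<lambda>z. ph n l g (fst z) (obs_cov (snd z))) \<in> borel_measurable (TR n l \<Otimes>\<^sub>M obs_measure)"
    and "g \<in> {2..NG + 1} \<Longrightarrow> (\<lambda>z. wh n l g (fst z) (obs_cov (snd z))) \<in> borel_measurable (TR n l \<Otimes>\<^sub>M obs_measure)"
  by (intro measurable_obs_cov_pair estimator_measurable[OF l]; assumption)+

definition weight_error where
  "weight_error n l h d x = wh n l h d x * ratioh n l h d x - \<omega> h x * ratio h x"

definition outcome_error where
  "outcome_error n l t d x = \<mu>h n l t d x - \<mu> t x"

text \<open>Up to sign, one summand of \<open>(A' - A) B\<close> in the notation of the
  overview.\<close>

definition err_weight where
  "err_weight n l h d s = of_bool (obs_group s = h) * weight_error n l h d (obs_cov s) * B s"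

text \<open>The contribution of period \<open>t\<close> to \<open>A'' \<Delta>\<close>, before the
  division by \<open>lam t\<close>.\<close>

definition err_outcome where
  "err_outcome n l t d s = group_contrast NG p (\<lambda>h. wh n l h d) (obs_group s) (obs_cov s) * outcome_error n l t d (obs_cov s)"

text \<open>Up to sign, one summand of the contribution of period \<open>t\<close> to
  \<open>(A' - A'') \<Delta>\<close>, again before scaling.\<close>

definition err_product where
  "err_product n l h t d s = of_bool (obs_group s = h) * (wh n l h d (obs_cov s) *
    (ratioh n l h d (obs_cov s) - ratio h (obs_cov s))) * outcome_error n l t d (obs_cov s)"

text \<open>The uncentred single-period counterpart of \<open>err_weight\<close>, present because
  the period means are also studied one by one.\<close>

definition err_level where
  "err_level n l h t d s = of_bool (obs_group s = h) * weight_error n l h d (obs_cov s) * residual t s"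

lemma err_measurable:
  assumes l: "l \<in> {1..L}" and h: "h \<in> {2..NG + 1}" and t: "t \<in> {\<T> - 1, \<T>}"
  shows "(\<lambda>(d, s). err_weight n l h d s) \<in> borel_measurable (TR n l \<Otimes>\<^sub>M obs_measure)"
    and "(\<lambda>(d, s). err_outcome n l t d s) \<in> borel_measurable (TR n l \<Otimes>\<^sub>M obs_measure)"
    and "(\<lambda>(d, s). err_product n l h t d s) \<in> borel_measurable (TR n l \<Otimes>\<^sub>M obs_measure)"
    and "(\<lambda>(d, s). err_level n l h t d s) \<in> borel_measurable (TR n l \<Otimes>\<^sub>M obs_measure)"
proof -
  have h1: "h \<in> {1..NG + 1}" "1 \<in> {1..NG + 1}" using h by auto
  note [measurable] = estimator_obs_measurable(1)[OF l t] estimator_obs_measurable(2)[OF l h1(1)]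
    estimator_obs_measurable(2)[OF l h1(2)] estimator_obs_measurable(3)[OF l h] mu_measurable[OF t]
    p_measurable[OF h1(1)] p_measurable[OF h1(2)] omega[OF h] residual_measurable[OF t]
  have gc: "(\<lambda>z. group_contrast NG p (\<lambda>h. wh n l h (fst z)) (obs_group (snd z)) (obs_cov (snd z)))
    \<in> borel_measurable (TR n l \<Otimes>\<^sub>M obs_measure)"
    unfolding group_contrast_def
  proof (intro borel_measurable_diff borel_measurable_sum borel_measurable_times borel_measurable_divide)
    fix g assume g: "g \<in> {2..NG + 1}"
    then have g': "g \<in> {1..NG + 1}" by auto
    note [measurable] = estimator_obs_measurable(3)[OF l g] p_measurable[OF g']
    show "(\<lambda>z. wh n l g (fst z) (obs_cov (snd z))) \<in> borel_measurable (TR n l \<Otimes>\<^sub>M obs_measure)"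
      "(\<lambda>z. of_bool (obs_group (snd z) = g)) \<in> borel_measurable (TR n l \<Otimes>\<^sub>M obs_measure)"
      "(\<lambda>z. p g (obs_cov (snd z))) \<in> borel_measurable (TR n l \<Otimes>\<^sub>M obs_measure)"
      by measurable
  qed measurable
  show "(\<lambda>(d, s). err_weight n l h d s) \<in> borel_measurable (TR n l \<Otimes>\<^sub>M obs_measure)"
    "(\<lambda>(d, s). err_product n l h t d s) \<in> borel_measurable (TR n l \<Otimes>\<^sub>M obs_measure)"
    "(\<lambda>(d, s). err_level n l h t d s) \<in> borel_measurable (TR n l \<Otimes>\<^sub>M obs_measure)"
    unfolding err_weight_def err_product_def err_level_def weight_error_def outcome_error_def case_prod_unfold by measurable
  have [measurable]: "(\<lambda>z. outcome_error n l t (fst z) (obs_cov (snd z))) \<in> borel_measurable (TR n l \<Otimes>\<^sub>M obs_measure)"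
    unfolding outcome_error_def by measurable
  show "(\<lambda>(d, s). err_outcome n l t d s) \<in> borel_measurable (TR n l \<Otimes>\<^sub>M obs_measure)"
    unfolding err_outcome_def case_prod_unfold by (intro borel_measurable_times gc) measurable
qed

abbreviation "Wn l h n \<xi> \<equiv> sup_norm (msupport FX) (wh n l h (tr n l \<xi>))"
abbreviation "ep l h n \<xi> \<equiv> L2_norm FX (\<lambda>x. ratioh n l h (tr n l \<xi>) x - ratio h x)"
abbreviation "ew l h n \<xi> \<equiv> L2_norm FX (\<lambda>x. wh n l h (tr n l \<xi>) x - \<omega> h x)"
abbreviation "em l t n \<xi> \<equiv> L2_norm FX (outcome_error n l t (tr n l \<xi>))"

lemma rates:
  assumes l: "l \<in> {1..L}" and h: "h \<in> {2..NG + 1}" and t: "t \<in> {\<T> - 1, \<T>}"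
  shows "((\<lambda>(n, \<xi>). Wn l h n \<xi> * ep l h n \<xi>) \<longlongrightarrow> 0) (in_prob M)"
    and "((\<lambda>(n, \<xi>). ew l h n \<xi>) \<longlongrightarrow> 0) (in_prob M)"
    and "((\<lambda>(n, \<xi>). em l t n \<xi>) \<longlongrightarrow> 0) (in_prob M)"
    and "((\<lambda>(n, \<xi>). Wn l h n \<xi> * em l t n \<xi>) \<longlongrightarrow> 0) (in_prob M)"
    and "((\<lambda>(n, \<xi>). Wn l h n \<xi> * (ennreal (sqrt (real n)) * (ep l h n \<xi> * em l t n \<xi>))) \<longlongrightarrow> 0) (in_prob M)"
  using bigO_p_mult_tendsto_0[OF weights_bounded[OF l h] smallo_p_tendsto[OF p_rate[OF l h]]]
    smallo_p_tendsto[OF w_rate[OF l h]]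
    smallo_p_tendsto[OF mu_rate[OF l t]]
    bigO_p_mult_tendsto_0[OF weights_bounded[OF l h] smallo_p_tendsto[OF mu_rate[OF l t]]]
    bigO_p_mult_tendsto_0[OF weights_bounded[OF l h] smallo_p_sqrt_tendsto[OF product_rate[OF l h t]]]
  unfolding outcome_error_def[abs_def] .

section \<open>Negligibility of the error terms\<close>

lemma tendsto_0_in_prob_le:
  fixes f g :: "nat \<Rightarrow> 's \<Rightarrow> ennreal"
  assumes "((\<lambda>(n, \<xi>). g n \<xi>) \<longlongrightarrow> 0) (in_prob M)"
    and "\<And>n \<xi>. \<xi> \<in> space M \<Longrightarrow> n \<ge> 1 \<Longrightarrow> f n \<xi> \<le> g n \<xi>"
  shows "((\<lambda>(n, \<xi>). f n \<xi>) \<longlongrightarrow> 0) (in_prob M)"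
proof (rule tendsto_0_ennreal_le[OF assms(1)])
  show "eventually (\<lambda>x. (case x of (n, \<xi>) \<Rightarrow> f n \<xi>) \<le> (case x of (n, \<xi>) \<Rightarrow> g n \<xi>)) (in_prob M)"
    using assms(2)
    by (intro eventually_in_prob_sequentially eventually_sequentiallyI[of 1]) auto
qed

lemma weight_error_tendsto:
  assumes l: "l \<in> {1..L}" and h: "h \<in> {2..NG + 1}"
  shows "((\<lambda>(n, \<xi>). \<integral>\<^sup>+x. ennreal ((weight_error n l h (tr n l \<xi>) x)\<^sup>2) \<partial>FX) \<longlongrightarrow> 0) (in_prob M)"
proof -
  obtain c where c: "c \<ge> 0" "\<And>h. h \<in> {2..NG + 1} \<Longrightarrow> AE x in FX. \<bar>ratio h x\<bar> \<le> c" using ratio_bounded by auto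
  show ?thesis
  proof (rule tendsto_0_in_prob_le)
    have "((\<lambda>x. 2 * (case x of (n, \<xi>) \<Rightarrow> Wn l h n \<xi> * ep l h n \<xi>)\<^sup>2 +
        2 * (ennreal c * (case x of (n, \<xi>) \<Rightarrow> ew l h n \<xi>))\<^sup>2) \<longlongrightarrow> 0 + 0) (in_prob M)"
      using l h periods_in
      by (intro tendsto_add tendsto_0_ennreal_cmult tendsto_0_ennreal_square rates[of _ _ \<T>]) auto
    then show "((\<lambda>(n, \<xi>). 2 * (Wn l h n \<xi> * ep l h n \<xi>)\<^sup>2 + 2 * (ennreal c * ew l h n \<xi>)\<^sup>2) \<longlongrightarrow> 0) (in_prob M)"
      by (simp add: case_prod_unfold)
    fix n \<xi> assume \<xi>: "\<xi> \<in> space M"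
    have h1: "h \<in> {1..NG + 1}" "1 \<in> {1..NG + 1}" using h by auto
    note [measurable] = estimator_section(2)[OF l \<xi> h1(1)] estimator_section(2)[OF l \<xi> h1(2)]
    show "(\<integral>\<^sup>+x. ennreal ((weight_error n l h (tr n l \<xi>) x)\<^sup>2) \<partial>FX) \<le>
      2 * (Wn l h n \<xi> * ep l h n \<xi>)\<^sup>2 + 2 * (ennreal c * ew l h n \<xi>)\<^sup>2"
      unfolding weight_error_def
      by (rule weighted_ratio_L2[OF h estimator_section(3)[OF l \<xi> h] _ c(1) c(2)[OF h]]) measurable
  qed
qed

lemma weight_error_section:
  assumes l: "l \<in> {1..L}" and h: "h \<in> {2..NG + 1}" and \<xi>: "\<xi> \<in> space M"
  shows "weight_error n l h (tr n l \<xi>) \<in> borel_measurable borel"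
proof -
  have h1: "h \<in> {1..NG + 1}" "1 \<in> {1..NG + 1}" using h by auto
  note [measurable] = estimator_section(2)[OF l \<xi> h1(1)] estimator_section(2)[OF l \<xi> h1(2)]
    estimator_section(3)[OF l \<xi> h] omega[OF h] p_measurable[OF h1(1)] p_measurable[OF h1(2)]
  show ?thesis unfolding weight_error_def[abs_def] by measurable
qed

lemma outcome_error_section:
  assumes l: "l \<in> {1..L}" and t: "t \<in> {\<T> - 1, \<T>}" and \<xi>: "\<xi> \<in> space M"
  shows "outcome_error n l t (tr n l \<xi>) \<in> borel_measurable borel"
  unfolding outcome_error_def[abs_def]
  by (intro borel_measurable_diff estimator_section(1)[OF l \<xi> t] mu_measurable[OF t])

text \<open>With the training sample fixed, the weight error is a function of \<open>X\<close>
  alone, so multiplying by it preserves the zero conditional mean of \<open>B\<close>. Consistency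
  of weights and ratios is then enough.\<close>

lemma err_weight_tendsto:
  assumes l: "l \<in> {1..L}" and h: "h \<in> {2..NG + 1}"
  shows "((\<lambda>(n, \<xi>). (\<Sum>i\<in>I n l. err_weight n l h (tr n l \<xi>) (Z i \<xi>)) / sqrt (real n)) \<longlongrightarrow> 0) (in_prob M)"
  unfolding training_eq
proof (rule iid.crossfit_second_moment)
  fix n
  show "off_fold I n l \<inter> I n l = {}" "finite (off_fold I n l)" "off_fold I n l \<subseteq> {1..}" "I n l \<subseteq> {1..n}"
    using fold_facts[OF l, of n] by blast+
  show "(\<lambda>(d, s). err_weight n l h d s) \<in> borel_measurable (TR n l \<Otimes>\<^sub>M obs_measure)"
    by (rule err_measurable(1)[OF l h, of \<T>]) simp
next
  have h1: "h \<in> {1..NG + 1}" using h by auto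
  obtain C :: real where C: "C \<ge> 0" "\<And>h f. h \<in> {1..NG + 1} \<Longrightarrow> f \<in> borel_measurable borel \<Longrightarrow>
    (\<integral>\<^sup>+s. ennreal ((of_bool (obs_group s = h) * f (obs_cov s) * B s)\<^sup>2) \<partial>Q) \<le>
      ennreal C * (\<integral>\<^sup>+x. ennreal ((f x)\<^sup>2) \<partial>FX)"
    using group_residual_second_moment by blast
  show "((\<lambda>(n, \<xi>). \<integral>\<^sup>+s. ennreal ((err_weight n l h (restrict (\<lambda>i. Z i \<xi>) (off_fold I n l)) s)\<^sup>2) \<partial>Q) \<longlongrightarrow> 0) (in_prob M)"
    unfolding training_eq[symmetric]
  proof (rule tendsto_0_in_prob_le)
    have "((\<lambda>x. ennreal C * (case x of (n, \<xi>) \<Rightarrow> \<integral>\<^sup>+x. ennreal ((weight_error n l h (tr n l \<xi>) x)\<^sup>2) \<partial>FX)) \<longlongrightarrow> 0) (in_prob M)"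
      by (intro tendsto_0_ennreal_cmult weight_error_tendsto[OF l h]) simp
    then show "((\<lambda>(n, \<xi>). ennreal C * (\<integral>\<^sup>+x. ennreal ((weight_error n l h (tr n l \<xi>) x)\<^sup>2) \<partial>FX)) \<longlongrightarrow> 0) (in_prob M)"
      by (simp add: case_prod_unfold)
    fix n \<xi> assume \<xi>: "\<xi> \<in> space M"
    show "(\<integral>\<^sup>+s. ennreal ((err_weight n l h (tr n l \<xi>) s)\<^sup>2) \<partial>Q) \<le>
      ennreal C * (\<integral>\<^sup>+x. ennreal ((weight_error n l h (tr n l \<xi>) x)\<^sup>2) \<partial>FX)"
      unfolding err_weight_def by (rule C(2)[OF h1 weight_error_section[OF l h \<xi>]])
  qed
  show "eventually (\<lambda>(n, \<xi>). (\<integral>s. err_weight n l h (restrict (\<lambda>i. Z i \<xi>) (off_fold I n l)) s \<partial>Q) = 0) (in_prob M)"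
    unfolding training_eq[symmetric] err_weight_def
    using group_residual_mean[OF h weight_error_section[OF l h]]
    by (intro eventually_in_prob_sequentially always_eventually) auto
qed

text \<open>The conditional mean vanishes for training samples with finite sup norms, a finite
  outcome error and weights summing to one. Each of these properties holds with probability tending
  to one, which the second moment criterion allows for.\<close>

lemma err_outcome_tendsto:
  assumes l: "l \<in> {1..L}" and t: "t \<in> {\<T> - 1, \<T>}"
  shows "((\<lambda>(n, \<xi>). (\<Sum>i\<in>I n l. err_outcome n l t (tr n l \<xi>) (Z i \<xi>)) / sqrt (real n)) \<longlongrightarrow> 0) (in_prob M)"
  unfolding training_eq
proof (rule iid.crossfit_second_moment)
  have two: "2 \<in> {2..NG + 1}" using dims by auto
  fix n
  show "off_fold I n l \<inter> I n l = {}" "finite (off_fold I n l)" "off_fold I n l \<subseteq> {1..}" "I n l \<subseteq> {1..n}"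
    using fold_facts[OF l, of n] by blast+
  show "(\<lambda>(d, s). err_outcome n l t d s) \<in> borel_measurable (TR n l \<Otimes>\<^sub>M obs_measure)"
    by (rule err_measurable(2)[OF l two t])
next
  have two: "2 \<in> {2..NG + 1}" using dims by auto
  obtain c where c: "c \<ge> 0" "\<And>h. h \<in> {2..NG + 1} \<Longrightarrow> AE x in FX. \<bar>ratio h x\<bar> \<le> c" using ratio_bounded by auto
  show "((\<lambda>(n, \<xi>). \<integral>\<^sup>+s. ennreal ((err_outcome n l t (restrict (\<lambda>i. Z i \<xi>) (off_fold I n l)) s)\<^sup>2) \<partial>Q) \<longlongrightarrow> 0) (in_prob M)"
    unfolding training_eq[symmetric]
  proof (rule tendsto_0_in_prob_le)
    have "((\<lambda>x. (case x of (n, \<xi>) \<Rightarrow> em l t n \<xi>)\<^sup>2 +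
        (\<Sum>h=2..NG+1. (ennreal c)\<^sup>2 * (case x of (n, \<xi>) \<Rightarrow> Wn l h n \<xi> * em l t n \<xi>)\<^sup>2)) \<longlongrightarrow> 0 + (\<Sum>h=2..NG+1. 0)) (in_prob M)"
      using l t
      by (intro tendsto_add tendsto_sum tendsto_0_ennreal_cmult tendsto_0_ennreal_square rates(3)[OF l two t] rates(4)[OF l _ t])
         (use ennreal_power[OF c(1), of 2] in auto)
    then show "((\<lambda>(n, \<xi>). (em l t n \<xi>)\<^sup>2 + (\<Sum>h=2..NG+1. (ennreal c)\<^sup>2 * (Wn l h n \<xi> * em l t n \<xi>)\<^sup>2)) \<longlongrightarrow> 0) (in_prob M)"
      by (simp add: case_prod_unfold)
    fix n \<xi> assume \<xi>: "\<xi> \<in> space M"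
    show "(\<integral>\<^sup>+s. ennreal ((err_outcome n l t (tr n l \<xi>) s)\<^sup>2) \<partial>Q) \<le>
      (em l t n \<xi>)\<^sup>2 + (\<Sum>h=2..NG+1. (ennreal c)\<^sup>2 * (Wn l h n \<xi> * em l t n \<xi>)\<^sup>2)"
      unfolding err_outcome_def
      by (rule contrast_cov_second_moment[OF estimator_section(3)[OF l \<xi>] outcome_error_section[OF l t \<xi>] c])
  qed
  have "eventually (\<lambda>x. \<forall>h\<in>{2..NG+1}. (case x of (n, \<xi>) \<Rightarrow> Wn l h n \<xi> < \<top>)) (in_prob M)"
    using bigO_p_eventually_finite[OF weights_bounded[OF l]]
    by (intro eventually_ball_finite) auto
  moreover have "eventually (\<lambda>x. (case x of (n, \<xi>) \<Rightarrow> em l t n \<xi>) \<le> ennreal 1) (in_prob M)"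
    by (rule tendsto_0_ennrealD[OF rates(3)[OF l two t]]) simp
  moreover have "eventually (\<lambda>(n, \<xi>). \<forall>x\<in>msupport FX. (\<Sum>g = 2..NG + 1. wh n l g (tr n l \<xi>) x) = 1) (in_prob M)"
    using weights_sum[OF _ l] by (intro eventually_in_prob_AE eventually_sequentiallyI[of 1]) auto
  moreover have "eventually (\<lambda>(n, \<xi>). \<xi> \<in> space M) (in_prob M)"
    by (intro eventually_in_prob_sequentially) auto
  ultimately show "eventually (\<lambda>(n, \<xi>). (\<integral>s. err_outcome n l t (restrict (\<lambda>i. Z i \<xi>) (off_fold I n l)) s \<partial>Q) = 0) (in_prob M)"
    unfolding training_eq[symmetric]
  proof eventually_elim
    case (elim x)
    obtain n \<xi> where x: "x = (n, \<xi>)" by (cases x)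
    with elim have \<xi>: "\<xi> \<in> space M" by simp
    have "(\<integral>s. err_outcome n l t (tr n l \<xi>) s \<partial>Q) = 0"
      unfolding err_outcome_def
    proof (rule contrast_cov_mean[OF estimator_section(3)[OF l \<xi>] outcome_error_section[OF l t \<xi>]])
      show "em l t n \<xi> < \<top>" using elim by (auto simp: x intro: le_less_trans[of _ 1])
    qed (use elim x in auto)
    then show ?case by (simp add: x)
  qed
qed

text \<open>The triangle inequality leaves the factor \<open>real n / sqrt (real n)\<close>, which
  is just the root-n factor that the product rate absorbs; the sup norm of the weights is bounded in
  probability.\<close>

lemma err_product_tendsto:
  assumes l: "l \<in> {1..L}" and h: "h \<in> {2..NG + 1}" and t: "t \<in> {\<T> - 1, \<T>}"
  shows "((\<lambda>(n, \<xi>). (\<Sum>i\<in>I n l. err_product n l h t (tr n l \<xi>) (Z i \<xi>)) / sqrt (real n)) \<longlongrightarrow> 0) (in_prob M)"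
  unfolding training_eq
proof (rule iid.crossfit_first_moment)
  fix n
  show "off_fold I n l \<inter> I n l = {}" "finite (off_fold I n l)" "off_fold I n l \<subseteq> {1..}" "I n l \<subseteq> {1..n}"
    using fold_facts[OF l, of n] by blast+
  show "(\<lambda>(d, s). err_product n l h t d s) \<in> borel_measurable (TR n l \<Otimes>\<^sub>M obs_measure)"
    by (rule err_measurable(3)[OF l h t])
  show "n \<ge> 1 \<Longrightarrow> sqrt (real n) > 0" by simp
next
  show "((\<lambda>(n, \<xi>). ennreal (real n / sqrt (real n)) *
      (\<integral>\<^sup>+s. ennreal \<bar>err_product n l h t (restrict (\<lambda>i. Z i \<xi>) (off_fold I n l)) s\<bar> \<partial>Q)) \<longlongrightarrow> 0) (in_prob M)"
    unfolding training_eq[symmetric]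
  proof (rule tendsto_0_in_prob_le[OF rates(5)[OF l h t]])
    fix n \<xi> assume \<xi>: "\<xi> \<in> space M"
    have h1: "h \<in> {1..NG + 1}" "1 \<in> {1..NG + 1}" using h by auto
    note [measurable] = estimator_section(2)[OF l \<xi> h1(1)] estimator_section(2)[OF l \<xi> h1(2)]
    have "(\<integral>\<^sup>+s. ennreal \<bar>err_product n l h t (tr n l \<xi>) s\<bar> \<partial>Q) \<le> Wn l h n \<xi> * (ep l h n \<xi> * em l t n \<xi>)"
      unfolding err_product_def
      by (rule ratio_error_first_moment[OF h estimator_section(3)[OF l \<xi> h] _ outcome_error_section[OF l t \<xi>]]) measurable
    then have "ennreal (real n / sqrt (real n)) * (\<integral>\<^sup>+s. ennreal \<bar>err_product n l h t (tr n l \<xi>) s\<bar> \<partial>Q) \<le>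
      ennreal (real n / sqrt (real n)) * (Wn l h n \<xi> * (ep l h n \<xi> * em l t n \<xi>))"
      by (rule mult_left_mono) simp
    then show "ennreal (real n / sqrt (real n)) * (\<integral>\<^sup>+s. ennreal \<bar>err_product n l h t (tr n l \<xi>) s\<bar> \<partial>Q) \<le>
      Wn l h n \<xi> * (ennreal (sqrt (real n)) * (ep l h n \<xi> * em l t n \<xi>))"
      by (simp add: real_div_sqrt mult_ac)
  qed
qed

text \<open>The single-period residual is not centred, so the sum is only shown to vanish after
  division by \<open>n\<close>, by Cauchy-Schwarz. This suffices for consistency of the period
  means.\<close>

lemma err_level_tendsto:
  assumes l: "l \<in> {1..L}" and h: "h \<in> {2..NG + 1}" and t: "t \<in> {\<T> - 1, \<T>}"
  shows "((\<lambda>(n, \<xi>). (\<Sum>i\<in>I n l. err_level n l h t (tr n l \<xi>) (Z i \<xi>)) / real n) \<longlongrightarrow> 0) (in_prob M)"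
  unfolding training_eq
proof (rule iid.crossfit_first_moment)
  fix n
  show "off_fold I n l \<inter> I n l = {}" "finite (off_fold I n l)" "off_fold I n l \<subseteq> {1..}" "I n l \<subseteq> {1..n}"
    using fold_facts[OF l, of n] by blast+
  show "(\<lambda>(d, s). err_level n l h t d s) \<in> borel_measurable (TR n l \<Otimes>\<^sub>M obs_measure)"
    by (rule err_measurable(4)[OF l h t])
  show "n \<ge> 1 \<Longrightarrow> real n > 0" by simp
next
  let ?f = "\<lambda>n \<xi>. L2_norm FX (weight_error n l h (tr n l \<xi>))"
  have f0: "((\<lambda>(n, \<xi>). ?f n \<xi>) \<longlongrightarrow> 0) (in_prob M)"
  proof (rule tendsto_0_ennrealI)
    fix \<epsilon> :: real assume \<epsilon>: "\<epsilon> > 0"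
    have "eventually (\<lambda>x. (case x of (n, \<xi>) \<Rightarrow> \<integral>\<^sup>+x. ennreal ((weight_error n l h (tr n l \<xi>) x)\<^sup>2) \<partial>FX) \<le> ennreal (\<epsilon>\<^sup>2)) (in_prob M)"
      using \<epsilon> by (intro tendsto_0_ennrealD[OF weight_error_tendsto[OF l h]]) simp
    moreover have "eventually (\<lambda>(n, \<xi>). \<xi> \<in> space M) (in_prob M)"
      by (intro eventually_in_prob_sequentially) auto
    ultimately show "eventually (\<lambda>x. (case x of (n, \<xi>) \<Rightarrow> ?f n \<xi>) \<le> ennreal \<epsilon>) (in_prob M)"
    proof eventually_elim
      case (elim x)
      obtain n \<xi> where x: "x = (n, \<xi>)" by (cases x)
      with elim have \<xi>: "\<xi> \<in> space M" by simp
      have "weight_error n l h (tr n l \<xi>) \<in> borel_measurable FX"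
        unfolding measurable_cong_sets[OF sets_FX refl] by (rule weight_error_section[OF l h \<xi>])
      then have "(?f n \<xi>)\<^sup>2 \<le> (ennreal \<epsilon>)\<^sup>2"
        using elim(1) \<epsilon> by (simp add: x L2_norm_square ennreal_power)
      then show ?case unfolding x by (simp add: power2_le_power2_ennrealD)
    qed
  qed
  show "((\<lambda>(n, \<xi>). ennreal (real n / real n) *
      (\<integral>\<^sup>+s. ennreal \<bar>err_level n l h t (restrict (\<lambda>i. Z i \<xi>) (off_fold I n l)) s\<bar> \<partial>Q)) \<longlongrightarrow> 0) (in_prob M)"
    unfolding training_eq[symmetric]
  proof (rule tendsto_0_in_prob_le)
    have "((\<lambda>x. L2_norm Q (residual t) * (case x of (n, \<xi>) \<Rightarrow> ?f n \<xi>)) \<longlongrightarrow> 0) (in_prob M)"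
      by (rule tendsto_0_ennreal_cmult[OF f0 residual_L2[OF t]])
    then show "((\<lambda>(n, \<xi>). L2_norm Q (residual t) * ?f n \<xi>) \<longlongrightarrow> 0) (in_prob M)"
      by (simp add: case_prod_unfold)
    fix n :: nat and \<xi> assume \<xi>: "\<xi> \<in> space M" and n: "n \<ge> 1"
    have "(\<integral>\<^sup>+s. ennreal \<bar>err_level n l h t (tr n l \<xi>) s\<bar> \<partial>Q) \<le> ?f n \<xi> * L2_norm Q (residual t)"
      unfolding err_level_def by (rule group_cov_residual_first_moment[OF t weight_error_section[OF l h \<xi>]])
    then show "ennreal (real n / real n) * (\<integral>\<^sup>+s. ennreal \<bar>err_level n l h t (tr n l \<xi>) s\<bar> \<partial>Q) \<le> L2_norm Q (residual t) * ?f n \<xi>"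
      using n by (simp add: mult.commute)
  qed
qed

end

section \<open>Asymptotic linearity\<close>

text \<open>With \<open>D\<close>, \<open>D'\<close> the cross-fitted sample means for the periods \<open>\<T>\<close> and \<open>\<T> - 1\<close>, \<open>W\<close> the
  normalized sum of influence values and \<open>R\<close> the cross-fitting remainder.\<close>

lemma linearization_identity:
  fixes s l l' lh lh' ph q :: real
  assumes pos: "s > 0" "l > 0" "l' > 0" "q > 0" "lh \<noteq> 0" "lh' \<noteq> 0" "ph \<noteq> 0"
    and D: "s * (D / l - D' / l') = A / s + R"
    and W: "W = (- (\<theta> / q) * (s\<^sup>2 * ph) - s\<^sup>2 * (lh - l) / l * (e / (q * l') + \<theta>)
      + s\<^sup>2 * (lh' - l') / l' * (e / (q * l')) + 1 / q * A) / s"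
    and eK: "eK / l - e / l' = q * \<theta>"
  shows "s * (1 / ph * (D / lh - D' / lh') - \<theta>) - W =
    1 / ph * (W * (q - ph) + R - s * (lh - l) * (1 / l * (D / lh - eK / l)) +
      s * (lh' - l') * (1 / l' * (D' / lh' - e / l')))"
proof -
  \<comment> \<open>\<open>x\<close> and \<open>y\<close> are the period means divided by the
    estimated sampling probabilities; \<open>a\<close> and \<open>b\<close> will be the root-n
    errors of those estimates.\<close>
  define x where "x = D / lh"
  define y where "y = D' / lh'"
  define a where "a = s * (lh - l)"
  define b where "b = s * (lh' - l')"
  have Dx: "D = x * lh" "D' = y * lh'" using pos by (simp_all add: x_def y_def)
  have qW: "q * W = - \<theta> * s * ph - a / l * (e / l' + q * \<theta>) + b / l' * (e / l') + A / s"
    using pos unfolding W a_def b_def by (simp add: field_simps power2_eq_square)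
  \<comment> \<open>Passing between the estimated and the true divisor costs exactly
    \<open>x * (lh - l) / l\<close>, so no Taylor remainder arises.\<close>
  have "D / l = x + x * (lh - l) / l" "D' / l' = y + y * (lh' - l') / l'"
    using pos by (simp_all add: Dx field_simps)
  then have "s * (x - y) = A / s + R - a * x / l + b * y / l'"
    using D by (simp add: a_def b_def algebra_simps)
  moreover have "eK / l = e / l' + q * \<theta>" using eK by simp
  \<comment> \<open>The terms of \<open>W\<close> in \<open>e\<close> are the first-order effects of
    \<open>a\<close> and \<open>b\<close> at the limits \<open>eK / l\<close> of \<open>x\<close>
    and \<open>e / l'\<close> of \<open>y\<close>. After subtracting them only the deviations of
    \<open>x\<close> and \<open>y\<close> from these limits multiply \<open>a\<close> and
    \<open>b\<close>.\<close>
  ultimately have "s * (x - y) - s * \<theta> * ph - ph * W =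
    W * (q - ph) + R - a * (1 / l * (x - eK / l)) + b * (1 / l' * (y - e / l'))"
    using qW by (simp add: algebra_simps)
  then have "1 / ph * (s * (x - y) - s * \<theta> * ph - ph * W) =
    1 / ph * (W * (q - ph) + R - a * (1 / l * (x - eK / l)) + b * (1 / l' * (y - e / l')))"
    by simp
  moreover have "1 / ph * (s * (x - y) - s * \<theta> * ph - ph * W) = s * (1 / ph * (x - y) - \<theta>) - W"
    using pos by (simp add: field_simps)
  ultimately show ?thesis by (simp only: x_def y_def a_def b_def)
qed

lemma diff_sum_split:
  fixes f g k :: "'a \<Rightarrow> real"
  assumes "\<And>h. f h = g h + k h"
  shows "a - (\<Sum>h\<in>H. f h) = a - (\<Sum>h\<in>H. g h) - (\<Sum>h\<in>H. k h)"
  unfolding assms by (simp add: sum.distrib)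

context rc_estimation
begin

abbreviation "contrasth n l d s \<equiv>
  group_contrast NG (\<lambda>g. ph n l g d) (\<lambda>g. wh n l g d) (obs_group s) (obs_cov s)"

abbreviation "contr s \<equiv> contrast (obs_group s) (obs_cov s)"

lemma contrast_diff:
  "contrasth n l d s = contr s - (\<Sum>h=2..NG+1. of_bool (obs_group s = h) * weight_error n l h d (obs_cov s))"
  "contrasth n l d s = group_contrast NG p (\<lambda>h. wh n l h d) (obs_group s) (obs_cov s) -
    (\<Sum>h=2..NG+1. of_bool (obs_group s = h) * (wh n l h d (obs_cov s) * (ratioh n l h d (obs_cov s) - ratio h (obs_cov s))))"
  unfolding group_contrast_def weight_error_def
  by (rule diff_sum_split, simp add: algebra_simps del: times_divide_eq_left times_divide_eq_right)+

lemma residual_decomposition: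
  "contrasth n l d s * (residual t s - outcome_error n l t d (obs_cov s)) =
    contr s * residual t s - (\<Sum>h=2..NG+1. err_level n l h t d s) - err_outcome n l t d s + (\<Sum>h=2..NG+1. err_product n l h t d s)"
proof -
  have "contrasth n l d s * residual t s = contr s * residual t s - (\<Sum>h=2..NG+1. err_level n l h t d s)"
    unfolding contrast_diff(1) err_level_def by (simp only: left_diff_distrib sum_distrib_right)
  moreover have "contrasth n l d s * outcome_error n l t d (obs_cov s) =
    err_outcome n l t d s - (\<Sum>h=2..NG+1. err_product n l h t d s)"
    unfolding contrast_diff(2) err_outcome_def err_product_def by (simp only: left_diff_distrib sum_distrib_right)
  ultimately show ?thesis by (simp add: right_diff_distrib)
qed

text \<open>Divided by the true sampling probabilities and subtracted, the single-period residuals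
  form \<open>B\<close>, so the uncentred level errors recombine into centred ones. Only the latter
  have to be negligible at the root-n scale.\<close>

lemma err_level_diff:
  "(\<Sum>h=2..NG+1. err_level n l h \<T> d s) / lam \<T> - (\<Sum>h=2..NG+1. err_level n l h (\<T> - 1) d s) / lam (\<T> - 1) =
    (\<Sum>h=2..NG+1. err_weight n l h d s)"
  unfolding err_weight_def err_level_def B_residual
  by (simp add: sum_divide_distrib sum_subtractf[symmetric] right_diff_distrib)

text \<open>The cross-fitted numerator for period \<open>t\<close>, still to be divided by
  \<open>lam_hat\<close> and \<open>pi1_hat\<close>. Subtracting the outcome error turns the
  residual from \<open>\<mu> t\<close> into the one from the estimated regression.\<close>

definition mean_est where
  "mean_est t n \<xi> = (\<Sum>l=1..L. \<Sum>i\<in>I n l. contrasth n l (tr n l \<xi>) (Z i \<xi>) *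
    (residual t (Z i \<xi>) - outcome_error n l t (tr n l \<xi>) (obs_cov (Z i \<xi>)))) / real n"

text \<open>At \<open>\<T> - 1\<close> this is the expectation of \<open>varphi\<close> that enters
  the influence function.\<close>

definition mean_target where
  "mean_target t = (\<integral>s. contr s * residual t s \<partial>Q)"

definition sum_err_weight where "sum_err_weight l h n \<xi> = (\<Sum>i\<in>I n l. err_weight n l h (tr n l \<xi>) (Z i \<xi>))"
definition sum_err_outcome where "sum_err_outcome l t n \<xi> = (\<Sum>i\<in>I n l. err_outcome n l t (tr n l \<xi>) (Z i \<xi>))"
definition sum_err_product where "sum_err_product l h t n \<xi> = (\<Sum>i\<in>I n l. err_product n l h t (tr n l \<xi>) (Z i \<xi>))"
definition sum_err_level where "sum_err_level l h t n \<xi> = (\<Sum>i\<in>I n l. err_level n l h t (tr n l \<xi>) (Z i \<xi>))"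

lemma mean_est_eq:
  "mean_est t n \<xi> * real n = (\<Sum>i=1..n. contr (Z i \<xi>) * residual t (Z i \<xi>)) +
    (\<Sum>l=1..L. - (\<Sum>h=2..NG+1. sum_err_level l h t n \<xi>) - sum_err_outcome l t n \<xi> + (\<Sum>h=2..NG+1. sum_err_product l h t n \<xi>))"
  if "n \<ge> 1"
proof -
  have "(\<Sum>i\<in>I n l. contrasth n l (tr n l \<xi>) (Z i \<xi>) *
      (residual t (Z i \<xi>) - outcome_error n l t (tr n l \<xi>) (obs_cov (Z i \<xi>)))) =
    (\<Sum>i\<in>I n l. contr (Z i \<xi>) * residual t (Z i \<xi>)) +
      (- (\<Sum>h=2..NG+1. sum_err_level l h t n \<xi>) - sum_err_outcome l t n \<xi> + (\<Sum>h=2..NG+1. sum_err_product l h t n \<xi>))" for l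
    unfolding residual_decomposition sum_err_outcome_def sum_err_product_def sum_err_level_def
    by (simp add: sum.distrib sum_subtractf sum.swap[of _ "I n l"])
  then have "mean_est t n \<xi> * real n = (\<Sum>l=1..L. (\<Sum>i\<in>I n l. contr (Z i \<xi>) * residual t (Z i \<xi>)) +
      (- (\<Sum>h=2..NG+1. sum_err_level l h t n \<xi>) - sum_err_outcome l t n \<xi> + (\<Sum>h=2..NG+1. sum_err_product l h t n \<xi>)))"
    using that unfolding mean_est_def by simp
  then show ?thesis
    by (simp only: sum.distrib[of _ _ "{1..L}"] sum_folds)
qed

lemma case_prod_tendsto: "((\<lambda>(n, \<xi>). f n \<xi>) \<longlongrightarrow> c) H \<Longrightarrow> ((\<lambda>x. f (fst x) (snd x)) \<longlongrightarrow> c) H"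
  by (simp add: case_prod_unfold)

lemma eventually_pos: "eventually (\<lambda>x. fst x \<ge> 1 \<and> snd x \<in> space M) (in_prob M)"
  by (intro eventually_in_prob_sequentially eventually_sequentiallyI[of 1]) auto

lemma sum_err_tendsto:
  assumes l: "l \<in> {1..L}" and h: "h \<in> {2..NG + 1}" and t: "t \<in> {\<T> - 1, \<T>}"
  shows "((\<lambda>x. sum_err_weight l h (fst x) (snd x) / sqrt (real (fst x))) \<longlongrightarrow> 0) (in_prob M)"
    and "((\<lambda>x. sum_err_outcome l t (fst x) (snd x) / sqrt (real (fst x))) \<longlongrightarrow> 0) (in_prob M)"
    and "((\<lambda>x. sum_err_product l h t (fst x) (snd x) / sqrt (real (fst x))) \<longlongrightarrow> 0) (in_prob M)"
    and "((\<lambda>x. sum_err_level l h t (fst x) (snd x) / real (fst x)) \<longlongrightarrow> 0) (in_prob M)"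
  unfolding sum_err_weight_def sum_err_outcome_def sum_err_product_def sum_err_level_def
  by (rule case_prod_tendsto[OF err_weight_tendsto[OF l h]] case_prod_tendsto[OF err_outcome_tendsto[OF l t]]
    case_prod_tendsto[OF err_product_tendsto[OF l h t]] case_prod_tendsto[OF err_level_tendsto[OF l h t]])+

lemma inverse_sqrt_lim: "((\<lambda>x. 1 / sqrt (real (fst x))) \<longlongrightarrow> 0) (in_prob M)"
proof -
  have "(\<lambda>n. 1 / sqrt (real n)) \<longlonglongrightarrow> 0"
    by (rule tendsto_divide_0[OF tendsto_const], rule filterlim_at_top_imp_at_infinity,
        rule filterlim_compose[OF sqrt_at_top filterlim_real_sequentially])
  from tendsto_in_prob_sequentially[OF this, of M] show ?thesis by (simp add: case_prod_unfold)
qed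

lemma div_n_lim:
  fixes f :: "nat \<times> 's \<Rightarrow> real"
  assumes "((\<lambda>x. f x / sqrt (real (fst x))) \<longlongrightarrow> 0) (in_prob M)"
  shows "((\<lambda>x. f x / real (fst x)) \<longlongrightarrow> 0) (in_prob M)"
proof -
  have "((\<lambda>x. f x / sqrt (real (fst x)) * (1 / sqrt (real (fst x)))) \<longlongrightarrow> 0 * 0) (in_prob M)"
    by (rule tendsto_mult[OF assms inverse_sqrt_lim])
  then show ?thesis by simp
qed

lemma residual_meas: "t \<in> {\<T> - 1, \<T>} \<Longrightarrow> (\<lambda>s. contr s * residual t s) \<in> borel_measurable obs_measure"
  by (intro borel_measurable_times contrast_measurable residual_measurable)

text \<open>No rate is available, because the level errors vanish only after division by
  \<open>n\<close>; the other errors are even negligible after division by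
  \<open>sqrt n\<close>.\<close>

lemma mean_est_tendsto:
  assumes t: "t \<in> {\<T> - 1, \<T>}"
  shows "((\<lambda>x. mean_est t (fst x) (snd x)) \<longlongrightarrow> mean_target t) (in_prob M)"
proof -
  have "((\<lambda>(n, \<xi>). (\<Sum>i=1..n. contr (Z i \<xi>) * residual t (Z i \<xi>)) / real n) \<longlongrightarrow> mean_target t) (in_prob M)"
    unfolding mean_target_def
    by (rule iid.tendsto_mean[OF residual_meas[OF t]
      contrast_square_integrable[OF residual_measurable[OF t] residual_square[OF t]]])
  then have 1: "((\<lambda>x. (\<Sum>i=1..fst x. contr (Z i (snd x)) * residual t (Z i (snd x))) / real (fst x)) \<longlongrightarrow> mean_target t) (in_prob M)"
    by (simp add: case_prod_unfold)
  have two: "2 \<in> {2..NG + 1}" using dims by auto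
  have "((\<lambda>x. \<Sum>l=1..L. - (\<Sum>h=2..NG+1. sum_err_level l h t (fst x) (snd x) / real (fst x)) - sum_err_outcome l t (fst x) (snd x) / real (fst x)
      + (\<Sum>h=2..NG+1. sum_err_product l h t (fst x) (snd x) / real (fst x))) \<longlongrightarrow> (\<Sum>l=1..L. - (\<Sum>h=2..NG+1. 0) - 0 + (\<Sum>h=2..NG+1. 0))) (in_prob M)"
    by (intro tendsto_sum tendsto_add tendsto_diff tendsto_minus sum_err_tendsto(4)[OF _ _ t]
      div_n_lim[OF sum_err_tendsto(3)[OF _ _ t]] div_n_lim[OF sum_err_tendsto(2)[OF _ two t]])
  from tendsto_add[OF 1 this]
  have "((\<lambda>x. (\<Sum>i=1..fst x. contr (Z i (snd x)) * residual t (Z i (snd x))) / real (fst x) +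
    (\<Sum>l=1..L. - (\<Sum>h=2..NG+1. sum_err_level l h t (fst x) (snd x) / real (fst x)) - sum_err_outcome l t (fst x) (snd x) / real (fst x)
      + (\<Sum>h=2..NG+1. sum_err_product l h t (fst x) (snd x) / real (fst x)))) \<longlongrightarrow> mean_target t) (in_prob M)"
    by simp
  then show ?thesis
  proof (rule Lim_transform_eventually)
    show "eventually (\<lambda>x. (\<Sum>i=1..fst x. contr (Z i (snd x)) * residual t (Z i (snd x))) / real (fst x) +
    (\<Sum>l=1..L. - (\<Sum>h=2..NG+1. sum_err_level l h t (fst x) (snd x) / real (fst x)) - sum_err_outcome l t (fst x) (snd x) / real (fst x)
      + (\<Sum>h=2..NG+1. sum_err_product l h t (fst x) (snd x) / real (fst x))) = mean_est t (fst x) (snd x)) (in_prob M)"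
      using eventually_pos
    proof eventually_elim
      case (elim x)
      then have n: "fst x \<ge> 1" by simp
      have "mean_est t (fst x) (snd x) = mean_est t (fst x) (snd x) * real (fst x) / real (fst x)" using n by simp
      then show ?case unfolding mean_est_eq[OF n]
        by (simp add: add_divide_distrib diff_divide_distrib sum_divide_distrib)
    qed
  qed
qed

definition remainder where
  "remainder n \<xi> = (\<Sum>l=1..L. - (\<Sum>h=2..NG+1. sum_err_weight l h n \<xi> / sqrt (real n))
    - (sum_err_outcome l \<T> n \<xi> / sqrt (real n) - (\<Sum>h=2..NG+1. sum_err_product l h \<T> n \<xi> / sqrt (real n))) / lam \<T>
    + (sum_err_outcome l (\<T> - 1) n \<xi> / sqrt (real n) - (\<Sum>h=2..NG+1. sum_err_product l h (\<T> - 1) n \<xi> / sqrt (real n))) / lam (\<T> - 1))"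

lemma remainder_tendsto: "((\<lambda>x. remainder (fst x) (snd x)) \<longlongrightarrow> 0) (in_prob M)"
proof -
  have two: "2 \<in> {2..NG + 1}" using dims by auto
  have "((\<lambda>x. remainder (fst x) (snd x)) \<longlongrightarrow> (\<Sum>l=1..L. - (\<Sum>h=2..NG+1. 0)
    - (0 - (\<Sum>h=2..NG+1. 0)) / lam \<T> + (0 - (\<Sum>h=2..NG+1. 0)) / lam (\<T> - 1))) (in_prob M)"
    unfolding remainder_def using lam_T_pos
    by (intro tendsto_sum tendsto_add tendsto_diff tendsto_minus tendsto_divide tendsto_const
      sum_err_tendsto(1)[OF _ _ insertI1] sum_err_tendsto(2)[OF _ two] sum_err_tendsto(3)) auto
  then show ?thesis by simp
qed

text \<open>The divisors are the true \<open>lam\<close>: only then do the level errors of the two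
  periods combine into \<open>sum_err_weight\<close>, which is negligible at this scale.\<close>

lemma mean_est_scaled:
  assumes n: "n \<ge> 1"
  shows "sqrt (real n) * (mean_est \<T> n \<xi> / lam \<T> - mean_est (\<T> - 1) n \<xi> / lam (\<T> - 1)) =
    (\<Sum>i=1..n. contr (Z i \<xi>) * B (Z i \<xi>)) / sqrt (real n) + remainder n \<xi>"
proof -
  let ?s = "sqrt (real n)"
  have s: "?s > 0" "?s * ?s = real n" using n by auto
  have sw: "(\<Sum>h=2..NG+1. sum_err_level l h t n \<xi>) = (\<Sum>i\<in>I n l. \<Sum>h=2..NG+1. err_level n l h t (tr n l \<xi>) (Z i \<xi>))" for l t
    unfolding sum_err_level_def by (rule sum.swap)
  have level_diff: "(\<Sum>h=2..NG+1. sum_err_level l h \<T> n \<xi>) / lam \<T> - (\<Sum>h=2..NG+1. sum_err_level l h (\<T> - 1) n \<xi>) / lam (\<T> - 1) =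
    (\<Sum>h=2..NG+1. sum_err_weight l h n \<xi>)" for l
  proof -
    have "(\<Sum>h=2..NG+1. sum_err_level l h \<T> n \<xi>) / lam \<T> - (\<Sum>h=2..NG+1. sum_err_level l h (\<T> - 1) n \<xi>) / lam (\<T> - 1) =
      (\<Sum>i\<in>I n l. \<Sum>h=2..NG+1. err_weight n l h (tr n l \<xi>) (Z i \<xi>))"
      unfolding sw by (simp only: sum_divide_distrib[of _ "I n l"] sum_subtractf[symmetric] err_level_diff)
    also have "\<dots> = (\<Sum>h=2..NG+1. sum_err_weight l h n \<xi>)" unfolding sum_err_weight_def by (rule sum.swap)
    finally show ?thesis .
  qed
  define f where "f l = (\<Sum>h=2..NG+1. sum_err_weight l h n \<xi>)" for l
  define g where "g t l = sum_err_outcome l t n \<xi> - (\<Sum>h=2..NG+1. sum_err_product l h t n \<xi>)" for t l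
  define k where "k t l = (\<Sum>h=2..NG+1. sum_err_level l h t n \<xi>)" for t l
  have kf: "k \<T> l / lam \<T> - k (\<T> - 1) l / lam (\<T> - 1) = f l" for l
    unfolding k_def f_def by (rule level_diff)
  have m: "mean_est t n \<xi> * real n = (\<Sum>i=1..n. contr (Z i \<xi>) * residual t (Z i \<xi>)) + (\<Sum>l=1..L. - k t l - g t l)" for t
    unfolding mean_est_eq[OF n] k_def g_def by (simp add: algebra_simps)
  have fs: "(\<Sum>h=2..NG+1. sum_err_weight l h n \<xi> / ?s) = f l / ?s" for l
    by (simp only: f_def sum_divide_distrib)
  have gs: "sum_err_outcome l t n \<xi> / ?s - (\<Sum>h=2..NG+1. sum_err_product l h t n \<xi> / ?s) = g t l / ?s" for t l
    by (simp only: g_def sum_divide_distrib diff_divide_distrib)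
  have "- (a / q) - b / q / c + b' / q / c' = (- a - b / c + b' / c') / q" for a b b' c c' q :: real
    by (simp add: diff_divide_distrib add_divide_distrib mult.commute)
  then have "remainder n \<xi> = (\<Sum>l=1..L. (- f l - g \<T> l / lam \<T> + g (\<T> - 1) l / lam (\<T> - 1)) / ?s)"
    unfolding remainder_def fs gs by simp
  also have "\<dots> = (\<Sum>l=1..L. - f l - g \<T> l / lam \<T> + g (\<T> - 1) l / lam (\<T> - 1)) / ?s"
    by (rule sum_divide_distrib[symmetric])
  also have "(\<Sum>l=1..L. - f l - g \<T> l / lam \<T> + g (\<T> - 1) l / lam (\<T> - 1)) =
    (\<Sum>l=1..L. - k \<T> l - g \<T> l) / lam \<T> - (\<Sum>l=1..L. - k (\<T> - 1) l - g (\<T> - 1) l) / lam (\<T> - 1)"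
    unfolding kf[symmetric] sum_divide_distrib sum_subtractf[symmetric]
    by (intro sum.cong refl) (simp add: diff_divide_distrib)
  finally have r: "remainder n \<xi> * ?s =
    (\<Sum>l=1..L. - k \<T> l - g \<T> l) / lam \<T> - (\<Sum>l=1..L. - k (\<T> - 1) l - g (\<T> - 1) l) / lam (\<T> - 1)"
    using s by simp
  have b: "(\<Sum>i=1..n. contr (Z i \<xi>) * B (Z i \<xi>)) = (\<Sum>i=1..n. contr (Z i \<xi>) * residual \<T> (Z i \<xi>)) / lam \<T> -
    (\<Sum>i=1..n. contr (Z i \<xi>) * residual (\<T> - 1) (Z i \<xi>)) / lam (\<T> - 1)"
    unfolding B_residual sum_divide_distrib sum_subtractf[symmetric]
    by (intro sum.cong refl) (simp add: right_diff_distrib)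
  have gen: "q * (x / a - y / b) * q = (x * (q * q)) / a - (y * (q * q)) / b" for q x y a b :: real
    by (simp add: right_diff_distrib left_diff_distrib mult_ac)
  have "?s * (mean_est \<T> n \<xi> / lam \<T> - mean_est (\<T> - 1) n \<xi> / lam (\<T> - 1)) * ?s =
    (mean_est \<T> n \<xi> * real n) / lam \<T> - (mean_est (\<T> - 1) n \<xi> * real n) / lam (\<T> - 1)"
    unfolding gen s(2) ..
  also have "\<dots> = (\<Sum>i=1..n. contr (Z i \<xi>) * B (Z i \<xi>)) + remainder n \<xi> * ?s"
    unfolding m r b by (simp add: add_divide_distrib)
  also have "\<dots> = ((\<Sum>i=1..n. contr (Z i \<xi>) * B (Z i \<xi>)) / ?s + remainder n \<xi>) * ?s"
    using s(1) by (simp add: distrib_right)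
  finally show ?thesis using s(1) by (simp only: mult_cancel_right) auto
qed

lemma theta_hat_eq:
  "theta_rc_hat NG \<T> L I Z \<mu>h ph wh n \<xi> =
    1 / pi1_hat Z n \<xi> * (mean_est \<T> n \<xi> / lam_hat Z n \<xi> \<T> - mean_est (\<T> - 1) n \<xi> / lam_hat Z n \<xi> (\<T> - 1))"
proof -
  let ?l = "lam_hat Z n \<xi> \<T>" and ?l' = "lam_hat Z n \<xi> (\<T> - 1)"
  define c where "c l i = contrasth n l (tr n l \<xi>) (Z i \<xi>)" for l i
  define r where "r t l i = residual t (Z i \<xi>) - outcome_error n l t (tr n l \<xi>) (obs_cov (Z i \<xi>))" for t l i
  have "phi_rc NG \<T> (Z i \<xi>) (\<lambda>t. \<mu>h n l t (tr n l \<xi>)) (\<lambda>g. ph n l g (tr n l \<xi>)) (\<lambda>g. wh n l g (tr n l \<xi>))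
      (pi1_hat Z n \<xi>) (lam_hat Z n \<xi>) =
    1 / pi1_hat Z n \<xi> * ((c l i * r \<T> l i) / ?l - (c l i * r (\<T> - 1) l i) / ?l')" for l i
    unfolding phi_rc_def c_def r_def residual_def outcome_error_def obs_outcome_def obs_group_def obs_period_def obs_cov_def
    by (simp add: case_prod_unfold diff_divide_distrib left_diff_distrib right_diff_distrib mult.assoc)
  then have "theta_rc_hat NG \<T> L I Z \<mu>h ph wh n \<xi> =
    1 / real n * (\<Sum>l=1..L. \<Sum>i\<in>I n l. 1 / pi1_hat Z n \<xi> * ((c l i * r \<T> l i) / ?l - (c l i * r (\<T> - 1) l i) / ?l'))"
    unfolding theta_rc_hat_def by simp
  also have "\<dots> = 1 / pi1_hat Z n \<xi> * ((\<Sum>l=1..L. \<Sum>i\<in>I n l. c l i * r \<T> l i) / real n / ?l -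
      (\<Sum>l=1..L. \<Sum>i\<in>I n l. c l i * r (\<T> - 1) l i) / real n / ?l')"
    by (simp add: sum_distrib_left[symmetric] sum_divide_distrib[symmetric] sum_subtractf diff_divide_distrib mult_ac)
  finally show ?thesis by (simp only: mean_est_def c_def r_def)
qed

section \<open>Estimated group and period frequencies\<close>

lemma bool_square: "f \<in> obs_measure \<rightarrow>\<^sub>M count_space UNIV \<Longrightarrow> integrable Q (\<lambda>s. (of_bool (f s = c) - a :: real)\<^sup>2)"
proof -
  assume f[measurable]: "f \<in> obs_measure \<rightarrow>\<^sub>M count_space UNIV"
  interpret Q: prob_space Q by (rule Q_facts)
  have m: "(\<lambda>s. (of_bool (f s = c) - a :: real)\<^sup>2) \<in> borel_measurable Q" by (rule measurable_Q) measurable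
  have "(of_bool b - a)\<^sup>2 \<le> (1 + \<bar>a\<bar>)\<^sup>2" for b
    by (rule power2_le_iff_abs_le[THEN iffD2]) (auto simp: of_bool_def)
  then show ?thesis by (intro Q.integrable_const_bound[OF _ m, of "(1 + \<bar>a\<bar>)\<^sup>2"]) auto
qed

lemma integral_of_bool:
  assumes [measurable]: "f \<in> obs_measure \<rightarrow>\<^sub>M count_space UNIV"
  shows "(\<integral>s. of_bool (f s = c) \<partial>Q) = measure P {u \<in> space P. f (S u) = c}"
proof -
  have "(\<integral>s. of_bool (f s = c) \<partial>Q) = (\<integral>u. (of_bool (f (S u) = c) :: real) \<partial>P)" by (subst integral_Q) auto
  also have "\<dots> = (\<integral>u. (indicator {u \<in> space P. f (S u) = c} u :: real) \<partial>P)"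
    by (intro Bochner_Integration.integral_cong) auto
  finally show ?thesis by simp
qed

lemma period_mean: "(\<integral>s. of_bool (obs_period s = t) \<partial>Q) = lam t"
  by (simp add: integral_of_bool lam_def)

lemma treated_mean: "(\<integral>s. of_bool (obs_group s = 1) \<partial>Q) = pi1"
  by (simp add: integral_of_bool pi1_def)

lemma lam_hat_eq: "lam_hat Z n \<xi> t = (\<Sum>i=1..n. of_bool (obs_period (Z i \<xi>) = t)) / real n"
  by (simp add: lam_hat_def obs_period_def case_prod_unfold)

lemma pi1_hat_eq: "pi1_hat Z n \<xi> = (\<Sum>i=1..n. of_bool (obs_group (Z i \<xi>) = 1)) / real n"
  by (simp add: pi1_hat_def obs_group_def case_prod_unfold)

lemma lam_hat_tendsto: "((\<lambda>x. lam_hat Z (fst x) (snd x) t) \<longlongrightarrow> lam t) (in_prob M)"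
  using iid.tendsto_mean[of "\<lambda>s. of_bool (obs_period s = t)"] bool_square[of obs_period t 0]
  by (simp add: lam_hat_eq period_mean case_prod_unfold)

lemma pi1_hat_tendsto: "((\<lambda>x. pi1_hat Z (fst x) (snd x)) \<longlongrightarrow> pi1) (in_prob M)"
  using iid.tendsto_mean[of "\<lambda>s. of_bool (obs_group s = 1)"] bool_square[of obs_group 1 0]
  by (simp add: pi1_hat_eq treated_mean case_prod_unfold)

lemma lam_hat_bigO: "bigO_p M (\<lambda>n. 1) (\<lambda>n \<xi>. ennreal \<bar>sqrt (real n) * (lam_hat Z n \<xi> t - lam t)\<bar>)"
proof -
  interpret Q: prob_space Q by (rule Q_facts)
  have i: "integrable Q (\<lambda>s. of_bool (obs_period s = t) :: real)"
    by (rule Q.integrable_const_bound[of _ 1]) (auto intro!: measurable_Q)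
  have "bigO_p M (\<lambda>n. 1) (\<lambda>n \<xi>. ennreal \<bar>(\<Sum>i=1..n. of_bool (obs_period (Z i \<xi>) = t) - lam t) / sqrt (real n)\<bar>)"
    by (rule iid.bigO_p_normalized_sum[OF _ bool_square]) (use i in \<open>simp_all add: period_mean Q.prob_space\<close>)
  moreover have "(\<Sum>i=1..n. of_bool (obs_period (Z i \<xi>) = t) - lam t) / sqrt (real n) = sqrt (real n) * (lam_hat Z n \<xi> t - lam t)" for n \<xi>
  proof (cases "n = 0")
    case False
    have gen: "(a - q * q * b) / q = q * (a / (q * q) - b)" if "q > 0" for a b q :: real
      using that by (simp add: field_simps)
    have s: "sqrt (real n) > 0" "sqrt (real n) * sqrt (real n) = real n" using False by auto
    have "(\<Sum>i=1..n. of_bool (obs_period (Z i \<xi>) = t) - lam t) =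
      (\<Sum>i=1..n. of_bool (obs_period (Z i \<xi>) = t)) - real n * lam t"
      by (simp only: sum_subtractf sum_constant card_atLeastAtMost) simp
    then show ?thesis unfolding lam_hat_eq by (simp only: gen[OF s(1), unfolded s(2)])
  qed simp
  ultimately show ?thesis by simp
qed

section \<open>The influence function and asymptotic linearity\<close>

abbreviation "e0 \<equiv> mean_target (\<T> - 1)"
abbreviation "\<psi> \<equiv> psi_rc NG \<T> \<mu> p \<omega> pi1 lam \<theta> e0"

lemma psi_eq: "\<psi> s = - (\<theta> / pi1) * of_bool (obs_group s = 1)
     - (of_bool (obs_period s = \<T>) - lam \<T>) / lam \<T> * (e0 / (pi1 * lam (\<T> - 1)) + \<theta>)
     + (of_bool (obs_period s = \<T> - 1) - lam (\<T> - 1)) / lam (\<T> - 1) * (e0 / (pi1 * lam (\<T> - 1)))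
     + 1 / pi1 * (contr s * B s)"
  unfolding psi_rc_def obs_group_def obs_period_def obs_cov_def by (simp add: case_prod_unfold mult.assoc)

lemma psi_measurable: "\<psi> \<in> borel_measurable obs_measure"
  unfolding psi_eq[abs_def] by measurable

text \<open>This relation between the limits of the two period means allows \<open>psi_rc\<close> to
  be written with the expectation at \<open>\<T> - 1\<close> alone; it is the premise
  \<open>eK\<close> of \<open>linearization_identity\<close>.\<close>

lemma target_diff: "mean_target \<T> / lam \<T> - e0 / lam (\<T> - 1) = pi1 * \<theta>"
proof -
  interpret Q: prob_space Q by (rule Q_facts)
  have i: "integrable Q (\<lambda>s. contr s * residual t s)" if t: "t \<in> {\<T> - 1, \<T>}" for t
    by (rule Q.square_integrable_imp_integrable[OF measurable_Q[OF residual_meas[OF t]]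
      contrast_square_integrable[OF residual_measurable[OF t] residual_square[OF t]]])
  have "pi1 * \<theta> = (\<integral>s. contr s * residual \<T> s / lam \<T> - contr s * residual (\<T> - 1) s / lam (\<T> - 1) \<partial>Q)"
    unfolding contrast_residual_mean[symmetric] B_residual by (simp add: right_diff_distrib)
  also have "\<dots> = mean_target \<T> / lam \<T> - e0 / lam (\<T> - 1)"
    unfolding mean_target_def using i[of \<T>] i[of "\<T> - 1"] by simp
  finally show ?thesis by simp
qed

lemma square_integrable_add:
  fixes f g :: "'x obs \<Rightarrow> real"
  assumes "integrable Q (\<lambda>s. (f s)\<^sup>2)" "integrable Q (\<lambda>s. (g s)\<^sup>2)" "f \<in> borel_measurable Q" "g \<in> borel_measurable Q"
  shows "integrable Q (\<lambda>s. (f s + g s)\<^sup>2)"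
proof (rule Bochner_Integration.integrable_bound[of Q "\<lambda>s. 2 * (f s)\<^sup>2 + 2 * (g s)\<^sup>2"])
  have "(a + b)\<^sup>2 \<le> 2 * a\<^sup>2 + 2 * b\<^sup>2" for a b :: real
    using zero_le_power2[of "a - b"] by (simp add: power2_eq_square algebra_simps)
  then show "AE s in Q. norm ((f s + g s)\<^sup>2) \<le> norm (2 * (f s)\<^sup>2 + 2 * (g s)\<^sup>2)" by auto
qed (use assms in auto)

lemma psi_square: "integrable Q (\<lambda>s. (\<psi> s)\<^sup>2)"
proof -
  interpret Q: prob_space Q by (rule Q_facts)
  let ?c1 = "- (\<theta> / pi1)" and ?c2 = "- (e0 / (pi1 * lam (\<T> - 1)) + \<theta>) / lam \<T>"
    and ?c3 = "(e0 / (pi1 * lam (\<T> - 1))) / lam (\<T> - 1)" and ?c4 = "1 / pi1"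
  let ?f1 = "\<lambda>s. ?c1 * (of_bool (obs_group s = 1) - 0)"
  let ?f2 = "\<lambda>s. ?c2 * (of_bool (obs_period s = \<T>) - lam \<T>)"
  let ?f3 = "\<lambda>s. ?c3 * (of_bool (obs_period s = \<T> - 1) - lam (\<T> - 1))"
  let ?f4 = "\<lambda>s. ?c4 * (contr s * B s)"
  have sq: "integrable Q (\<lambda>s. (c * f s)\<^sup>2)" if "integrable Q (\<lambda>s. (f s)\<^sup>2)" for c :: real and f
    unfolding power_mult_distrib using that by (rule integrable_mult_right)
  have eq: "\<psi> s = ((?f1 s + ?f2 s) + ?f3 s) + ?f4 s" for s
  proof -
    have "a * b - c / d * f + g / h * i + j = a * (b - 0) + (- f / d) * c + i / h * g + j" for a b c d f g h i j :: real
      by (simp add: mult.commute)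
    then show ?thesis unfolding psi_eq by blast
  qed
  show ?thesis
    unfolding eq
    by (intro square_integrable_add sq bool_square contrast_square_integrable B_square measurable_Q) measurable
qed

text \<open>The sampling-frequency terms are centred by themselves, and the mean
  \<open>- \<theta>\<close> of the treated indicator term cancels the mean \<open>\<theta>\<close>
  of the residual term.\<close>

lemma psi_mean: "(\<integral>s. \<psi> s \<partial>Q) = 0"
proof -
  interpret Q: prob_space Q by (rule Q_facts)
  have i: "integrable Q (\<lambda>s. of_bool (f s = c) :: real)" if [measurable]: "f \<in> obs_measure \<rightarrow>\<^sub>M count_space UNIV" for f c
    by (rule Q.integrable_const_bound[of _ 1]) (auto intro!: measurable_Q)
  have iB: "integrable Q (\<lambda>s. contr s * B s)"
    by (rule Q.square_integrable_imp_integrable[OF measurable_Q contrast_square_integrable[OF B_measurable B_square]]) measurable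
  have "(\<integral>s. \<psi> s \<partial>Q) = - (\<theta> / pi1) * pi1
     - (lam \<T> - lam \<T>) / lam \<T> * (e0 / (pi1 * lam (\<T> - 1)) + \<theta>)
     + (lam (\<T> - 1) - lam (\<T> - 1)) / lam (\<T> - 1) * (e0 / (pi1 * lam (\<T> - 1)))
     + 1 / pi1 * (pi1 * \<theta>)"
    unfolding psi_eq using i[OF obs_proj_measurable(2)] i[OF obs_proj_measurable(3)] iB
    by (simp add: treated_mean period_mean contrast_residual_mean Q.prob_space del: times_divide_eq_left times_divide_eq_right)
  then show ?thesis using pi1_pos by simp
qed

definition influence_sum where
  "influence_sum n \<xi> = (\<Sum>i=1..n. \<psi> (Z i \<xi>)) / sqrt (real n)"

text \<open>Brings the influence sum into the shape of the premise \<open>W\<close> of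
  \<open>linearization_identity\<close>, with \<open>s = sqrt (real n)\<close>.\<close>

lemma influence_sum_eq:
  assumes n: "n \<ge> 1"
  shows "influence_sum n \<xi> = (- (\<theta> / pi1) * ((sqrt (real n))\<^sup>2 * pi1_hat Z n \<xi>)
      - (sqrt (real n))\<^sup>2 * (lam_hat Z n \<xi> \<T> - lam \<T>) / lam \<T> * (e0 / (pi1 * lam (\<T> - 1)) + \<theta>)
      + (sqrt (real n))\<^sup>2 * (lam_hat Z n \<xi> (\<T> - 1) - lam (\<T> - 1)) / lam (\<T> - 1) * (e0 / (pi1 * lam (\<T> - 1)))
      + 1 / pi1 * (\<Sum>i=1..n. contr (Z i \<xi>) * B (Z i \<xi>))) / sqrt (real n)"
proof -
  have l: "(sqrt (real n))\<^sup>2 * (lam_hat Z n \<xi> t - lam t) = (\<Sum>i=1..n. of_bool (obs_period (Z i \<xi>) = t) - lam t)" for t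
    using n by (simp add: lam_hat_eq sum_subtractf right_diff_distrib)
  have g: "(sqrt (real n))\<^sup>2 * pi1_hat Z n \<xi> = (\<Sum>i=1..n. of_bool (obs_group (Z i \<xi>) = 1))"
    using n by (simp add: pi1_hat_eq)
  show ?thesis
    unfolding influence_sum_def psi_eq l g
    by (simp only: sum.distrib sum_subtractf sum_distrib_left[symmetric] sum_divide_distrib[symmetric] sum_distrib_right[symmetric])
qed

text \<open>Apart from the cross-fitting remainder, every error in the exact identity is a quantity
  bounded in probability times a vanishing one: the influence sum times the error of
  \<open>pi1_hat\<close>, or a root-n error of \<open>lam_hat\<close> times the deviation of a
  period mean from its limit.\<close>

lemma asymptotically_linear:
  "((\<lambda>x. sqrt (real (fst x)) * (theta_rc_hat NG \<T> L I Z \<mu>h ph wh (fst x) (snd x) - \<theta>) - influence_sum (fst x) (snd x))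
    \<longlongrightarrow> 0) (in_prob M)"
proof -
  let ?t = "\<T>" and ?t' = "\<T> - 1"
  let ?lh = "\<lambda>t x. lam_hat Z (fst x) (snd x) t" and ?ph = "\<lambda>x. pi1_hat Z (fst x) (snd x)"
  let ?D = "\<lambda>t x. mean_est t (fst x) (snd x)"
  let ?W = "\<lambda>x. influence_sum (fst x) (snd x)"
  let ?a = "\<lambda>t x. sqrt (real (fst x)) * (?lh t x - lam t)"
  have O: "((\<lambda>x. Y (fst x) (snd x) * f x) \<longlongrightarrow> 0) (in_prob M)"
    if "bigO_p M (\<lambda>n. 1) (\<lambda>n \<xi>. ennreal \<bar>Y n \<xi>\<bar>)" "(f \<longlongrightarrow> 0) (in_prob M)" for Y :: "nat \<Rightarrow> 's \<Rightarrow> real" and f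
    using bigO_p_mult_real_tendsto_0[OF that(1), of "\<lambda>n \<xi>. f (n, \<xi>)"] that(2) by (simp add: case_prod_unfold)
  have W: "bigO_p M (\<lambda>n. 1) (\<lambda>n \<xi>. ennreal \<bar>influence_sum n \<xi>\<bar>)"
    unfolding influence_sum_def by (rule iid.bigO_p_normalized_sum[OF psi_measurable psi_square psi_mean])
  have "((\<lambda>x. pi1 - ?ph x) \<longlongrightarrow> pi1 - pi1) (in_prob M)"
    by (intro tendsto_diff tendsto_const pi1_hat_tendsto)
  then have 1: "((\<lambda>x. ?W x * (pi1 - ?ph x)) \<longlongrightarrow> 0) (in_prob M)"
    by (intro O[OF W]) simp
  have 2: "((\<lambda>x. ?a t x * (1 / lam t * (?D t x / ?lh t x - mean_target t / lam t))) \<longlongrightarrow> 0) (in_prob M)"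
    if t: "t \<in> {?t', ?t}" for t
  proof (rule O[OF lam_hat_bigO])
    have lt: "lam t > 0" using t lam_T_pos by auto
    have "((\<lambda>x. 1 / lam t * (?D t x / ?lh t x - mean_target t / lam t)) \<longlongrightarrow>
      1 / lam t * (mean_target t / lam t - mean_target t / lam t)) (in_prob M)"
      using lt by (intro tendsto_mult tendsto_diff tendsto_divide tendsto_const mean_est_tendsto[OF t] lam_hat_tendsto) auto
    then show "((\<lambda>x. 1 / lam t * (?D t x / ?lh t x - mean_target t / lam t)) \<longlongrightarrow> 0) (in_prob M)" by simp
  qed
  have 3: "((\<lambda>x. 1 / ?ph x) \<longlongrightarrow> 1 / pi1) (in_prob M)"
    using pi1_pos by (intro tendsto_divide tendsto_const pi1_hat_tendsto) auto
  have "((\<lambda>x. 1 / ?ph x * (?W x * (pi1 - ?ph x) + remainder (fst x) (snd x)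
      - ?a ?t x * (1 / lam ?t * (?D ?t x / ?lh ?t x - mean_target ?t / lam ?t))
      + ?a ?t' x * (1 / lam ?t' * (?D ?t' x / ?lh ?t' x - mean_target ?t' / lam ?t')))) \<longlongrightarrow> 1 / pi1 * (0 + 0 - 0 + 0)) (in_prob M)"
    by (intro tendsto_mult[OF 3] tendsto_add tendsto_diff 1 2 remainder_tendsto) auto
  then have lim: "((\<lambda>x. 1 / ?ph x * (?W x * (pi1 - ?ph x) + remainder (fst x) (snd x)
      - ?a ?t x * (1 / lam ?t * (?D ?t x / ?lh ?t x - mean_target ?t / lam ?t))
      + ?a ?t' x * (1 / lam ?t' * (?D ?t' x / ?lh ?t' x - mean_target ?t' / lam ?t')))) \<longlongrightarrow> 0) (in_prob M)"
    by simp
  \<comment> \<open>The identity divides by the estimated frequencies; their positive limits exclude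
    the value 0 with probability tending to one.\<close>
  have nz: "eventually (\<lambda>x. ?ph x \<noteq> 0) (in_prob M)" "eventually (\<lambda>x. ?lh ?t x \<noteq> 0) (in_prob M)"
    "eventually (\<lambda>x. ?lh ?t' x \<noteq> 0) (in_prob M)"
    using pi1_pos lam_T_pos
    by (auto intro!: tendsto_imp_eventually_ne[OF pi1_hat_tendsto] tendsto_imp_eventually_ne[OF lam_hat_tendsto])
  show ?thesis
  proof (rule Lim_transform_eventually[OF lim])
    show "eventually (\<lambda>x. 1 / ?ph x * (?W x * (pi1 - ?ph x) + remainder (fst x) (snd x)
      - ?a ?t x * (1 / lam ?t * (?D ?t x / ?lh ?t x - mean_target ?t / lam ?t))
      + ?a ?t' x * (1 / lam ?t' * (?D ?t' x / ?lh ?t' x - mean_target ?t' / lam ?t'))) =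
      sqrt (real (fst x)) * (theta_rc_hat NG \<T> L I Z \<mu>h ph wh (fst x) (snd x) - \<theta>) - influence_sum (fst x) (snd x)) (in_prob M)"
      using eventually_pos nz
    proof eventually_elim
      case (elim x)
      then have n: "fst x \<ge> 1" by simp
      show ?case
        unfolding theta_hat_eq
        by (rule linearization_identity[symmetric, OF _ lam_T_pos pi1_pos elim(3,4,2) mean_est_scaled[OF n]
          influence_sum_eq[OF n] target_diff]) (use n in simp)
    qed
  qed
qed

lemma Z_measurable: "l \<in> {1..L} \<Longrightarrow> i \<in> I n l \<Longrightarrow> Z i \<in> measurable M obs_measure"
  using fold_facts(4)[of l n] by (intro iid.S_measurable) auto

text \<open>\<open>distr\<close> is the intended law only for a measurable map. The decomposition
  into error terms is reused here, since their joint measurability in training sample and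
  observation is already established.\<close>

lemma theta_hat_measurable: "(\<lambda>\<xi>. theta_rc_hat NG \<T> L I Z \<mu>h ph wh n \<xi>) \<in> borel_measurable M"
proof -
  have Z[measurable]: "Z i \<in> measurable M obs_measure" if "i \<in> {1..n}" for i
    using that by (intro iid.S_measurable) auto
  have lam: "(\<lambda>\<xi>. lam_hat Z n \<xi> t) \<in> borel_measurable M" for t
    unfolding lam_hat_eq by (intro borel_measurable_divide borel_measurable_sum) measurable
  have pi: "(\<lambda>\<xi>. pi1_hat Z n \<xi>) \<in> borel_measurable M"
    unfolding pi1_hat_eq by (intro borel_measurable_divide borel_measurable_sum) measurable
  have est: "(\<lambda>\<xi>. mean_est t n \<xi>) \<in> borel_measurable M" if t: "t \<in> {\<T> - 1, \<T>}" for t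
    unfolding mean_est_def residual_decomposition
  proof (intro borel_measurable_divide borel_measurable_sum borel_measurable_add borel_measurable_diff)
    fix l i assume l: "l \<in> {1..L}" and i: "i \<in> I n l"
    note [measurable] = Z_measurable[OF l i] training_measurable[OF l]
    have c: "(\<lambda>\<xi>. f (tr n l \<xi>) (Z i \<xi>)) \<in> borel_measurable M"
      if "(\<lambda>(d, s). f d s) \<in> borel_measurable (TR n l \<Otimes>\<^sub>M obs_measure)" for f :: "(nat \<Rightarrow> 'x obs) \<Rightarrow> 'x obs \<Rightarrow> real"
    proof -
      have "(\<lambda>\<xi>. (tr n l \<xi>, Z i \<xi>)) \<in> M \<rightarrow>\<^sub>M TR n l \<Otimes>\<^sub>M obs_measure" by measurable
      from measurable_compose[OF this that] show ?thesis by simp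
    qed
    show "(\<lambda>\<xi>. contr (Z i \<xi>) * residual t (Z i \<xi>)) \<in> borel_measurable M"
      using measurable_compose[OF Z_measurable[OF l i] residual_meas[OF t]] .
    have two: "2 \<in> {2..NG + 1}" using dims by auto
    show "(\<lambda>\<xi>. err_outcome n l t (tr n l \<xi>) (Z i \<xi>)) \<in> borel_measurable M"
      by (rule c[OF err_measurable(2)[OF l two t]])
    show "(\<lambda>\<xi>. err_product n l h t (tr n l \<xi>) (Z i \<xi>)) \<in> borel_measurable M" if "h \<in> {2..NG + 1}" for h
      by (rule c[OF err_measurable(3)[OF l that t]])
    show "(\<lambda>\<xi>. err_level n l h t (tr n l \<xi>) (Z i \<xi>)) \<in> borel_measurable M" if "h \<in> {2..NG + 1}" for h
      by (rule c[OF err_measurable(4)[OF l that t]])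
  qed auto
  show ?thesis
    unfolding theta_hat_eq
    by (intro borel_measurable_times borel_measurable_diff borel_measurable_divide borel_measurable_const lam pi est) auto
qed

lemma varphi_mean: "(\<integral>u. varphi NG (\<T> - 1) \<mu> p \<omega> (S u) \<partial>P) = e0"
proof -
  have "varphi NG (\<T> - 1) \<mu> p \<omega> s = contr s * residual (\<T> - 1) s" for s
    unfolding varphi_def residual_def obs_outcome_def obs_group_def obs_period_def obs_cov_def
    by (simp add: case_prod_unfold)
  then show ?thesis
    unfolding mean_target_def by (subst integral_Q[OF residual_meas]) simp_all
qed

lemma psi_second_moment: "(\<integral>u. (\<psi> (S u))\<^sup>2 \<partial>P) = (\<integral>s. (\<psi> s)\<^sup>2 \<partial>Q)"
  using psi_measurable by (subst integral_Q) auto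

lemma asymptotic_normality:
  "weak_conv_m
    (\<lambda>n. distr M borel (\<lambda>\<xi>. sqrt (real n) * (theta_rc_hat NG \<T> L I Z \<mu>h ph wh n \<xi> - \<theta>)))
    (normal_law 0 (\<integral>s. (\<psi> s)\<^sup>2 \<partial>Q))"
proof (rule iid.weak_conv_m_slutsky[where W = influence_sum])
  show "(\<lambda>\<xi>. sqrt (real n) * (theta_rc_hat NG \<T> L I Z \<mu>h ph wh n \<xi> - \<theta>)) \<in> borel_measurable M" for n
    by (intro borel_measurable_times borel_measurable_diff borel_measurable_const theta_hat_measurable)
  show "influence_sum n \<in> borel_measurable M" for n
    unfolding influence_sum_def[abs_def]
    by (intro borel_measurable_divide borel_measurable_sum borel_measurable_const
      measurable_compose[OF iid.S_measurable psi_measurable]) auto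
  show "((\<lambda>(n, \<xi>). sqrt (real n) * (theta_rc_hat NG \<T> L I Z \<mu>h ph wh n \<xi> - \<theta>) - influence_sum n \<xi>) \<longlongrightarrow> 0) (in_prob M)"
    using asymptotically_linear by (simp add: case_prod_unfold)
  show "real_distribution (normal_law 0 (\<integral>s. (\<psi> s)\<^sup>2 \<partial>Q))"
    unfolding normal_law_def
    by (rule prob_space.real_distribution_distr[OF prob_space_normal_density]) auto
  show "(\<lambda>n. char (distr M borel (influence_sum n)) t) \<longlonglongrightarrow> char (normal_law 0 (\<integral>s. (\<psi> s)\<^sup>2 \<partial>Q)) t" for t
    unfolding influence_sum_def[abs_def] by (rule iid.char_normalized_sum[OF psi_measurable psi_square psi_mean])
qed

end

theorem theorem6:
  fixes P :: "'p measure" and M :: "'s measure"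
    and NG \<T> L :: nat
    and Y1 Y0 :: "nat \<Rightarrow> 'p \<Rightarrow> real" and G T :: "'p \<Rightarrow> nat"
    and X :: "'p \<Rightarrow> 'x::euclidean_space"
    and p \<mu> \<omega> :: "nat \<Rightarrow> 'x \<Rightarrow> real"
    and S :: "nat \<Rightarrow> 's \<Rightarrow> 'x obs"
    and I :: "nat \<Rightarrow> nat \<Rightarrow> nat set"
    and \<mu>h ph wh :: "nat \<Rightarrow> nat \<Rightarrow> nat \<Rightarrow> 'x estimator"
    and FX :: "'x measure" and lam :: "nat \<Rightarrow> real" and pi1 \<theta> e V :: real
  defines "FX \<equiv> distr P borel X"
    and "lam \<equiv> \<lambda>t. measure P {u \<in> space P. T u = t}"
    and "pi1 \<equiv> measure P {u \<in> space P. G u = 1}"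
    and "\<theta> \<equiv> (\<integral>u. (Y1 \<T> u - Y0 \<T> u) \<partial>(given P (\<lambda>u. G u = 1)))"
    and "e \<equiv> (\<integral>u. varphi NG (\<T> - 1) \<mu> p \<omega> (rc_obs \<T> Y1 Y0 G T X u) \<partial>P)"
    and "V \<equiv> (\<integral>u. (psi_rc NG \<T> \<mu> p \<omega> pi1 lam \<theta> e (rc_obs \<T> Y1 Y0 G T X u))\<^sup>2 \<partial>P)"
  assumes population: "prob_space P"
    and dims: "NG \<ge> 1" "\<T> \<ge> 2" "L \<ge> 1"
    and outcomes: "\<And>t. t \<in> {1..\<T>} \<Longrightarrow> Y1 t \<in> borel_measurable P \<and> Y0 t \<in> borel_measurable P"
    and groups: "G \<in> P \<rightarrow>\<^sub>M count_space UNIV" "\<And>u. u \<in> space P \<Longrightarrow> G u \<in> {1..NG + 1}"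
    and periods: "T \<in> P \<rightarrow>\<^sub>M count_space UNIV" "\<And>u. u \<in> space P \<Longrightarrow> T u \<in> {1..\<T>}"
    and covariates: "X \<in> borel_measurable P"
    and moments: "integrable P (Y0 \<T>)" "integrable P (Y0 (\<T> - 1))"
      "integrable P (\<lambda>u. of_bool (G u = 1) * Y1 \<T> u)"
    and propensity: "\<And>g. g \<in> {1..NG + 1} \<Longrightarrow> regression_fun P X (\<lambda>u. of_bool (G u = g)) (p g)"
    and mu: "\<And>t. t \<in> {\<T> - 1, \<T>} \<Longrightarrow>
      regression_fun (given P (\<lambda>u. G u \<noteq> 1)) X
        (\<lambda>u. of_bool (T u = t) * observed_outcome \<T> Y1 Y0 G T u) (\<mu> t)"
    and mu_L2: "\<And>t. t \<in> {\<T> - 1, \<T>} \<Longrightarrow> L2_norm FX (\<mu> t) < \<infinity>"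
    and no_anticipation: "\<And>t. t \<in> {1..\<T> - 1} \<Longrightarrow> AE u in P. Y1 t u = Y0 t u"
    and overlap: "\<And>g. g \<in> {1..NG + 1} \<Longrightarrow> AE u in P. p g (X u) > 0"
    and parallel_trends: "\<And>g. g \<in> {2..NG + 1} \<Longrightarrow> AE u in P.
      real_cond_exp (given P (\<lambda>v. G v = 1)) (gen_by P X) (\<lambda>v. Y0 \<T> v - Y0 (\<T> - 1) v) u =
      real_cond_exp (given P (\<lambda>v. G v = g)) (gen_by P X) (\<lambda>v. Y0 \<T> v - Y0 (\<T> - 1) v) u"
    and time_invariance: "indep_rv P
      ((\<Pi>\<^sub>M t\<in>{1..\<T>}. borel) \<Otimes>\<^sub>M borel \<Otimes>\<^sub>M count_space UNIV)
      (\<lambda>u. (\<lambda>t\<in>{1..\<T>}. period_outcome Y1 Y0 G t u, X u, G u))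
      (count_space UNIV) T"
    and lam_pos: "\<And>t. t \<in> {1..\<T>} \<Longrightarrow> lam t > 0"
    and sampling: "prob_space M" "prob_space.indep_vars M (\<lambda>_. obs_measure) S {1..}"
      "\<And>i. i \<ge> 1 \<Longrightarrow> distr M obs_measure (S i) = distr P obs_measure (rc_obs \<T> Y1 Y0 G T X)"
    and folds: "equal_folds L I"
    and estimators: "\<And>n l. l \<in> {1..L} \<Longrightarrow>
      (\<forall>t\<in>{\<T> - 1, \<T>}. fold_estimator I n l (\<mu>h n l t)) \<and>
      (\<forall>g\<in>{1..NG + 1}. fold_estimator I n l (ph n l g)) \<and>
      (\<forall>g\<in>{2..NG + 1}. fold_estimator I n l (wh n l g))"
    and omega: "\<omega> 1 = (\<lambda>x. 1)" "\<And>g. g \<in> {2..NG + 1} \<Longrightarrow> \<omega> g \<in> borel_measurable borel"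
    and bounded_residual: "\<And>g. g \<in> {1..NG + 1} \<Longrightarrow> \<exists>C::real. AE u in P.
      nn_cond_exp (given P (\<lambda>v. G v = g)) (gen_by P X)
        (\<lambda>v. ennreal ((scaled_residual \<T> \<mu> lam (rc_obs \<T> Y1 Y0 G T X v))\<^sup>2)) u \<le> ennreal C"
    and bounded_inverse_p: "\<And>g. g \<in> {1..NG + 1} \<Longrightarrow> \<exists>C. AE x in FX. \<bar>1 / p g x\<bar> \<le> C"
    and bounded_omega: "\<And>g. g \<in> {1..NG + 1} \<Longrightarrow> \<exists>C. AE x in FX. \<bar>\<omega> g x\<bar> \<le> C"
    and weights_sum: "\<And>n l. n \<ge> 1 \<Longrightarrow> l \<in> {1..L} \<Longrightarrow> AE \<xi> in M. \<forall>x\<in>msupport FX.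
      (\<Sum>g = 2..NG + 1. wh n l g (training I S n l \<xi>) x) = 1"
    and weights_bounded: "\<And>l g. l \<in> {1..L} \<Longrightarrow> g \<in> {2..NG + 1} \<Longrightarrow>
      bigO_p M (\<lambda>n. 1) (\<lambda>n \<xi>. sup_norm (msupport FX) (wh n l g (training I S n l \<xi>)))"
    and mu_rate: "\<And>l t. l \<in> {1..L} \<Longrightarrow> t \<in> {\<T> - 1, \<T>} \<Longrightarrow>
      smallo_p M (\<lambda>n. 1) (\<lambda>n \<xi>. L2_norm FX (\<lambda>x. \<mu>h n l t (training I S n l \<xi>) x - \<mu> t x))"
    and p_rate: "\<And>l g. l \<in> {1..L} \<Longrightarrow> g \<in> {2..NG + 1} \<Longrightarrow>
      smallo_p M (\<lambda>n. 1) (\<lambda>n \<xi>. L2_norm FX (\<lambda>x.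
        ph n l 1 (training I S n l \<xi>) x / ph n l g (training I S n l \<xi>) x - p 1 x / p g x))"
    and w_rate: "\<And>l g. l \<in> {1..L} \<Longrightarrow> g \<in> {2..NG + 1} \<Longrightarrow>
      smallo_p M (\<lambda>n. 1) (\<lambda>n \<xi>. L2_norm FX (\<lambda>x. wh n l g (training I S n l \<xi>) x - \<omega> g x))"
    and product_rate: "\<And>l g t. l \<in> {1..L} \<Longrightarrow> g \<in> {2..NG + 1} \<Longrightarrow> t \<in> {\<T> - 1, \<T>} \<Longrightarrow>
      smallo_p M (\<lambda>n. 1 / sqrt (real n)) (\<lambda>n \<xi>.
        L2_norm FX (\<lambda>x.
          ph n l 1 (training I S n l \<xi>) x / ph n l g (training I S n l \<xi>) x - p 1 x / p g x) *
        L2_norm FX (\<lambda>x. \<mu>h n l t (training I S n l \<xi>) x - \<mu> t x))"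
  shows "weak_conv_m
    (\<lambda>n. distr M borel (\<lambda>\<xi>. sqrt (real n) * (theta_rc_hat NG \<T> L I S \<mu>h ph wh n \<xi> - \<theta>)))
    (normal_law 0 V)"
proof -
  let ?Q = "distr P obs_measure (rc_obs \<T> Y1 Y0 G T X)"
  have population_locale: "rc_population P NG \<T> Y1 Y0 G T X p \<mu> \<omega> FX lam pi1 \<theta> ?Q"
  proof (intro rc_population.intro rc_population_axioms.intro)
    show "prob_space P" by (rule population)
    show "FX = distr P borel X" by (simp only: FX_def)
    show "lam = (\<lambda>t. measure P {u \<in> space P. T u = t})" by (simp only: lam_def)
    show "pi1 = measure P {u \<in> space P. G u = 1}" by (simp only: pi1_def)
    show "\<theta> = (\<integral>u. (Y1 \<T> u - Y0 \<T> u) \<partial>(given P (\<lambda>u. G u = 1)))" by (simp only: \<theta>_def)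
    show "?Q = distr P obs_measure (rc_obs \<T> Y1 Y0 G T X)" ..
  qed (fact dims outcomes groups periods(1) covariates moments propensity mu mu_L2 no_anticipation
    overlap parallel_trends time_invariance lam_pos omega(2) bounded_residual bounded_inverse_p bounded_omega)+
  have sample_locale: "iid_sample M obs_measure ?Q S"
    by (intro iid_sample.intro iid_sample_axioms.intro sampling)
  interpret rc_estimation P NG \<T> Y1 Y0 G T X p \<mu> \<omega> FX lam pi1 \<theta> ?Q M S L I \<mu>h ph wh
    by (intro rc_estimation.intro rc_estimation_axioms.intro population_locale sample_locale)
       (fact folds estimators weights_sum weights_bounded mu_rate p_rate w_rate product_rate)+
  have e: "e = mean_target (\<T> - 1)" unfolding e_def by (rule varphi_mean)
  have V: "V = (\<integral>s. (psi_rc NG \<T> \<mu> p \<omega> pi1 lam \<theta> (mean_target (\<T> - 1)) s)\<^sup>2 \<partial>?Q)"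
    unfolding V_def e by (rule psi_second_moment)
  show ?thesis unfolding V by (rule asymptotic_normality)
qed

end
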